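(* Let $g\geq 2$ and $h\geq 1$ be integers, and let $\Sigma_g$, $\Sigma_h$ be closed oriented surfaces of genus $g$ and $h$. Then the product 4-manifold $\Sigma_g\times\Sigma_h$ does not admit any locally conformally flat metric arising from a discrete and faithful representation, i.e. there is no locally conformally flat Riemannian metric on $\Sigma_g\times\Sigma_h$ whose holonomy representation $\rho:\pi_1(\Sigma_g\times\Sigma_h)\to \mathrm{Conf}^+(\mathbb{S}^4)$ is injective with discrete image.
   Context: A Riemannian $n$-manifold $(M,g)$ is called locally conformally flat (LCF) if every point has a neighborhood which is conformally diffeomorphic to an open subset of $\mathbb{R}^n$. $\mathrm{Conf}^+(\mathbb{S}^n)$ is the group of orientation preserving conformal transformations (Möbius transformations) of the round sphere $\mathbb{S}^n$; it is isomorphic to $\mathrm{Isom}^+\mathbb{H}^{n+1}\cong \mathrm{SO}_e(n+1,1)$, the identity component of the Lorentz group $\mathrm{O}(n+1,1)$. For an oriented LCF manifold $M$ of dimension $n\ge 3$ with universal cover $\widetilde{M}$, the developing map is an orientation preserving conformal immersion $D:\widetilde{M}\to\mathbb{S}^n$, obtained by continuing a local conformal chart; it is unique up to composition with a Möbius transformation. For each covering transformation $T$ of $\widetilde M$ there is a unique $a\in\mathrm{Conf}^+(\mathbb{S}^n)$ with $D\circ T=a\circ D$; the resulting homomorphism $\rho:\pi_1(M)\to\mathrm{Conf}^+(\mathbb{S}^n)$, $T\mapsto a$, is the holonomy representation of $M$ (well defined up to conjugation). *)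

theory Defs
  imports "HOL-Analysis.Analysis" "HOL-Algebra.Bij"
begin

text \<open>
  Manifolds are sets \<open>M\<close> in an arbitrary topological type, with the subspace topology, together with
  an atlas (not required to be maximal) of charts \<open>(U, \<phi>)\<close> modelled on \<open>real ^ 'n\<close>.  Tensors and
  derivatives are handled through their local expressions in the charts of the atlas.
\<close>

subsection \<open>Smooth manifolds\<close>

primrec Ck_on :: "nat \<Rightarrow> ('a::real_normed_vector \<Rightarrow> 'b::real_normed_vector) \<Rightarrow> 'a set \<Rightarrow> bool" where
  "Ck_on 0 f S \<longleftrightarrow> continuous_on S f"
| "Ck_on (Suc k) f S \<longleftrightarrow>
     (\<forall>x\<in>S. f differentiable (at x)) \<and> (\<forall>v. Ck_on k (\<lambda>x. frechet_derivative f (at x) v) S)"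

text \<open>Used for open \<open>S\<close> and finite-dimensional domain only, where this is the usual notion.\<close>

definition smooth_on :: "('a::euclidean_space \<Rightarrow> 'b::real_normed_vector) \<Rightarrow> 'a set \<Rightarrow> bool" where
  "smooth_on f S \<longleftrightarrow> (\<forall>k. Ck_on k f S)"

type_synonym ('a, 'n) chart = "'a set \<times> ('a \<Rightarrow> real ^ 'n)"

definition chart_on :: "'a::topological_space set \<Rightarrow> ('a, 'n::finite) chart \<Rightarrow> bool" where
  "chart_on M c \<longleftrightarrow> openin (top_of_set M) (fst c) \<and> open (snd c ` fst c) \<and>
     (\<exists>\<psi>. homeomorphism (fst c) (snd c ` fst c) (snd c) \<psi>)"

text \<open>
  \<open>local_rep c d f\<close> is the local expression of \<open>f\<close> in the charts \<open>c\<close>, \<open>d\<close>; it is meaningful on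
  \<open>snd c ` {x \<in> fst c. f x \<in> fst d}\<close>.  For \<open>f = id\<close> it is the transition map from \<open>c\<close> to \<open>d\<close>.
\<close>

definition local_rep ::
  "('a, 'n::finite) chart \<Rightarrow> ('b, 'm::finite) chart \<Rightarrow> ('a \<Rightarrow> 'b) \<Rightarrow> real ^ 'n \<Rightarrow> real ^ 'm" where
  "local_rep c d f = snd d \<circ> f \<circ> inv_into (fst c) (snd c)"

definition local_deriv ::
  "('a, 'n::finite) chart \<Rightarrow> ('b, 'm::finite) chart \<Rightarrow> ('a \<Rightarrow> 'b) \<Rightarrow> 'a \<Rightarrow> real ^ 'n \<Rightarrow> real ^ 'm" where
  "local_deriv c d f x = frechet_derivative (local_rep c d f) (at (snd c x))"

definition smooth_map_on ::
  "'a::topological_space set \<Rightarrow> ('a, 'n::finite) chart set \<Rightarrow>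
   ('b::topological_space, 'm::finite) chart set \<Rightarrow> ('a \<Rightarrow> 'b) \<Rightarrow> bool" where
  "smooth_map_on U A B f \<longleftrightarrow> continuous_on U f \<and>
     (\<forall>c\<in>A. \<forall>d\<in>B. smooth_on (local_rep c d f) (snd c ` {x \<in> U \<inter> fst c. f x \<in> fst d}))"

definition orientation_preserving_on ::
  "'a set \<Rightarrow> ('a, 'n::finite) chart set \<Rightarrow> ('b, 'n) chart set \<Rightarrow> ('a \<Rightarrow> 'b) \<Rightarrow> bool" where
  "orientation_preserving_on U A B f \<longleftrightarrow>
     (\<forall>c\<in>A. \<forall>d\<in>B. \<forall>x \<in> U \<inter> fst c. f x \<in> fst d \<longrightarrow> 0 < det (matrix (local_deriv c d f x)))"

text \<open>In an oriented manifold all charts of the atlas are positively oriented.\<close>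

definition oriented_manifold :: "'a::topological_space set \<Rightarrow> ('a, 'n::finite) chart set \<Rightarrow> bool" where
  "oriented_manifold M A \<longleftrightarrow>
     Hausdorff_space (top_of_set M) \<and> second_countable (top_of_set M) \<and>
     (\<forall>c\<in>A. chart_on M c) \<and> (\<Union>c\<in>A. fst c) = M \<and>
     smooth_map_on M A A id \<and> orientation_preserving_on M A A id"

definition join_vec :: "real ^ 'm \<Rightarrow> real ^ 'n \<Rightarrow> real ^ ('m + 'n)" where
  "join_vec u v = (\<chi> i. case i of Inl a \<Rightarrow> u $ a | Inr b \<Rightarrow> v $ b)"

definition prod_atlas ::
  "('a, 'm::finite) chart set \<Rightarrow> ('b, 'n::finite) chart set \<Rightarrow> ('a \<times> 'b, 'm + 'n) chart set" where
  "prod_atlas A B =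
     {(fst c \<times> fst d, \<lambda>(x, y). join_vec (snd c x) (snd d y)) | c d. c \<in> A \<and> d \<in> B}"

subsection \<open>Closed oriented surfaces of genus g\<close>

text \<open>
  The sides of the regular \<open>4g\<close>-gon (inscribed in the unit circle, with arcs as sides) are glued
  according to the word \<open>\<Prod>k<g. a\<^sub>k b\<^sub>k a\<^sub>k\<inverse> b\<^sub>k\<inverse>\<close>: side number \<open>4k + j\<close> is glued to side number
  \<open>4k + j + 2\<close>, for \<open>j = 0, 1\<close>, with reversal of the direction.
\<close>

definition side_pairing :: "nat \<Rightarrow> complex rel" where
  "side_pairing g =
     {(cis (2 * pi * (4 * real k + real j + t) / (4 * real g)),
       cis (2 * pi * (4 * real k + real j + 3 - t) / (4 * real g))) | k j t.
      k < g \<and> j < (2::nat) \<and> 0 \<le> t \<and> t \<le> 1}"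

text \<open>\<open>S\<close> is homeomorphic to the quotient of the polygon by the gluing; meant for \<open>g \<ge> 1\<close>.\<close>

definition has_genus :: "'a::topological_space set \<Rightarrow> nat \<Rightarrow> bool" where
  "has_genus S g \<longleftrightarrow>
     (\<exists>q. quotient_map (top_of_set (cball 0 1)) (top_of_set S) q \<and>
        (\<forall>x \<in> cball 0 1. \<forall>y \<in> cball 0 1.
           q x = q y \<longleftrightarrow> (x, y) \<in> (side_pairing g \<union> (side_pairing g)\<inverse>)\<^sup>*))"

definition closed_oriented_surface ::
  "nat \<Rightarrow> 'a::topological_space set \<Rightarrow> ('a, 2) chart set \<Rightarrow> bool" where
  "closed_oriented_surface g S A \<longleftrightarrow>
     oriented_manifold S A \<and> compact S \<and> connected S \<and> has_genus S g"

subsection \<open>Riemannian metrics and conformal maps\<close>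

text \<open>A metric assigns to each chart \<open>c\<close> and point \<open>x\<close> an inner product on the model space.\<close>

type_synonym ('a, 'n) metric_tensor =
  "('a, 'n) chart \<Rightarrow> 'a \<Rightarrow> real ^ 'n \<Rightarrow> real ^ 'n \<Rightarrow> real"

definition riemannian_metric ::
  "('a, 'n::finite) chart set \<Rightarrow> ('a, 'n) metric_tensor \<Rightarrow> bool" where
  "riemannian_metric A G \<longleftrightarrow>
     (\<forall>c\<in>A. \<forall>x \<in> fst c. bilinear (G c x) \<and> (\<forall>v w. G c x v w = G c x w v) \<and>
        (\<forall>v. v \<noteq> 0 \<longrightarrow> 0 < G c x v v)) \<and>
     (\<forall>c\<in>A. \<forall>v w. smooth_on (\<lambda>y. G c (inv_into (fst c) (snd c) y) v w) (snd c ` fst c)) \<and>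
     (\<forall>c\<in>A. \<forall>d\<in>A. \<forall>x \<in> fst c \<inter> fst d. \<forall>v w.
        G d x (local_deriv c d id x v) (local_deriv c d id x w) = G c x v w)"

text \<open>The pullback of \<open>H\<close> by \<open>f\<close> is \<open>\<mu> G\<close> for a positive function \<open>\<mu>\<close>.\<close>

definition conformal_on ::
  "'a set \<Rightarrow> ('a, 'n::finite) chart set \<Rightarrow> ('a, 'n) metric_tensor \<Rightarrow>
   ('b, 'm::finite) chart set \<Rightarrow> ('b, 'm) metric_tensor \<Rightarrow> ('a \<Rightarrow> 'b) \<Rightarrow> bool" where
  "conformal_on U A G B H f \<longleftrightarrow>
     (\<exists>\<mu>. \<forall>x\<in>U. 0 < \<mu> x \<and>
        (\<forall>c\<in>A. \<forall>d\<in>B. x \<in> fst c \<and> f x \<in> fst d \<longrightarrow>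
           (\<forall>v w. H d (f x) (local_deriv c d f x v) (local_deriv c d f x w) = \<mu> x * G c x v w)))"

definition conformal_diffeo ::
  "'a::topological_space set \<Rightarrow> ('a, 'n::finite) chart set \<Rightarrow> ('a, 'n) metric_tensor \<Rightarrow>
   'b::topological_space set \<Rightarrow> ('b, 'n) chart set \<Rightarrow> ('b, 'n) metric_tensor \<Rightarrow> ('a \<Rightarrow> 'b) \<Rightarrow> bool" where
  "conformal_diffeo U A G V B H f \<longleftrightarrow>
     bij_betw f U V \<and> smooth_map_on U A B f \<and> smooth_map_on V B A (inv_into U f) \<and>
     conformal_on U A G B H f"

definition euclidean_atlas :: "(real ^ 'n, 'n::finite) chart set" where
  "euclidean_atlas = {(UNIV, id)}"

definition euclidean_metric :: "(real ^ 'n, 'n::finite) metric_tensor" where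
  "euclidean_metric = (\<lambda>c x v w. v \<bullet> w)"

definition locally_conformally_flat ::
  "'a::topological_space set \<Rightarrow> ('a, 'n::finite) chart set \<Rightarrow> ('a, 'n) metric_tensor \<Rightarrow> bool" where
  "locally_conformally_flat M A G \<longleftrightarrow>
     (\<forall>x\<in>M. \<exists>U V f. x \<in> U \<and> openin (top_of_set M) U \<and> open V \<and>
        conformal_diffeo U A G V euclidean_atlas euclidean_metric f)"

subsection \<open>The round sphere and its conformal group\<close>

text \<open>\<open>S\<^sup>n\<close> is the unit sphere of \<open>real ^ ('n + 1)\<close>; the last coordinate has index \<open>Inr 1\<close>.\<close>

abbreviation round_sphere :: "(real ^ ('n::finite + 1)) set" where
  "round_sphere \<equiv> sphere 0 1"

definition stereographic :: "real ^ ('n::finite + 1) \<Rightarrow> real ^ 'n" where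
  "stereographic x = (\<chi> i. x $ Inl i / (1 - x $ Inr 1))"

text \<open>
  Using only stereographic projections precomposed with rotations makes this an oriented atlas
  (projections from opposite poles, without such a rotation, induce opposite orientations).
\<close>

definition sphere_atlas :: "(real ^ ('n::finite + 1), 'n) chart set" where
  "sphere_atlas =
     {({x \<in> round_sphere. (P *v x) $ Inr 1 \<noteq> 1}, \<lambda>x. stereographic (P *v x)) | P. rotation_matrix P}"

definition round_metric :: "(real ^ ('n::finite + 1), 'n) metric_tensor" where
  "round_metric c x v w =
     (let L = frechet_derivative (inv_into (fst c) (snd c)) (at (snd c x)) in L v \<bullet> L w)"

text \<open>The orientation preserving conformal transformations of \<open>S\<^sup>n\<close>, under composition.\<close>

definition Conf_plus :: "(real ^ ('n::finite + 1) \<Rightarrow> real ^ ('n + 1)) monoid" where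
  "Conf_plus = (BijGroup round_sphere)
     \<lparr>carrier := {a \<in> Bij round_sphere.
        conformal_diffeo round_sphere sphere_atlas round_metric
          round_sphere sphere_atlas round_metric a \<and>
        orientation_preserving_on round_sphere sphere_atlas sphere_atlas a}\<rparr>"

text \<open>
  The subspace topology on \<open>\<Gamma>\<close> is discrete, for the topology of uniform convergence on the
  sphere, which is the Lie group topology of the conformal group.
\<close>

definition discrete_transformations :: "(real ^ ('n::finite + 1) \<Rightarrow> real ^ ('n + 1)) set \<Rightarrow> bool" where
  "discrete_transformations \<Gamma> \<longleftrightarrow>
     (\<forall>a\<in>\<Gamma>. \<exists>\<epsilon>>0. \<forall>b\<in>\<Gamma>. (\<forall>x\<in>round_sphere. dist (a x) (b x) < \<epsilon>) \<longrightarrow> b = a)"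

subsection \<open>Developing map and holonomy\<close>

definition universal_cover ::
  "'c::topological_space set \<Rightarrow> ('c \<Rightarrow> 'a::topological_space) \<Rightarrow> 'a set \<Rightarrow> bool" where
  "universal_cover C p M \<longleftrightarrow> covering_space C p M \<and> simply_connected C"

text \<open>The group of covering transformations, isomorphic to the fundamental group of the base.\<close>

definition deck_group :: "'c::topological_space set \<Rightarrow> ('c \<Rightarrow> 'a) \<Rightarrow> ('c \<Rightarrow> 'c) monoid" where
  "deck_group C p = (BijGroup C)
     \<lparr>carrier := {T \<in> Bij C. (\<exists>T'. homeomorphism C C T T') \<and> (\<forall>x\<in>C. p (T x) = p x)}\<rparr>"

text \<open>
  The cover \<open>C\<close> carries the smooth structure, orientation and metric for which \<open>p\<close> is a local
  isometry.  So \<open>D\<close> is an orientation preserving conformal immersion of \<open>C\<close> iff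
  \<open>D \<circ> (p|W)\<inverse>\<close> is one for each open \<open>W\<close> which \<open>p\<close> maps homeomorphically onto an open set.
\<close>

definition developing_map ::
  "'c::topological_space set \<Rightarrow> ('c \<Rightarrow> 'a::topological_space) \<Rightarrow> 'a set \<Rightarrow>
   ('a, 'n::finite) chart set \<Rightarrow> ('a, 'n) metric_tensor \<Rightarrow> ('c \<Rightarrow> real ^ ('n + 1)) \<Rightarrow> bool" where
  "developing_map C p M A G D \<longleftrightarrow>
     D ` C \<subseteq> round_sphere \<and>
     (\<forall>W q. openin (top_of_set C) W \<and> openin (top_of_set M) (p ` W) \<and>
          homeomorphism W (p ` W) p q \<longrightarrow>
        smooth_map_on (p ` W) A sphere_atlas (D \<circ> q) \<and>
        conformal_on (p ` W) A G sphere_atlas round_metric (D \<circ> q) \<and>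
        orientation_preserving_on (p ` W) A sphere_atlas (D \<circ> q))"

definition holonomy_representation ::
  "'c::topological_space set \<Rightarrow> ('c \<Rightarrow> 'a) \<Rightarrow> ('c \<Rightarrow> real ^ ('n::finite + 1)) \<Rightarrow>
   (('c \<Rightarrow> 'c) \<Rightarrow> real ^ ('n + 1) \<Rightarrow> real ^ ('n + 1)) \<Rightarrow> bool" where
  "holonomy_representation C p D \<rho> \<longleftrightarrow>
     \<rho> \<in> hom (deck_group C p) Conf_plus \<and>
     (\<forall>T \<in> carrier (deck_group C p). \<forall>x\<in>C. D (T x) = \<rho> T (D x))"

end

theory Submission
  imports Defs
begin

text \<open>
  Only the holonomy group matters.  The deck group contains an element \<open>c\<close> of infinite order, from
  \<open>\<Sigma>\<^sub>h\<close>, commuting with two elements \<open>a\<close>, \<open>b\<close> from \<open>\<Sigma>\<^sub>g\<close> of which no powers generate a nilpotent group, as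
  is seen from the map of \<open>\<pi>\<^sub>1(\<Sigma>\<^sub>g)\<close> to the affine group of the line taking \<open>a\<close>, \<open>b\<close> to \<open>x \<mapsto> 2x\<close> and
  \<open>x \<mapsto> x + 1\<close>.  No discrete group of conformal transformations of the sphere contains such elements.
  By Liouville's theorem, a conformal transformation which fixes infinity is a similarity of
  Euclidean space.  The powers of \<open>c\<close> have a subsequence converging almost everywhere to a constant, which is
  a fixed point of \<open>c\<close> and may be moved to infinity.  If \<open>c\<close> is not an isometry, then \<open>a\<^sup>2\<close> and \<open>b\<^sup>2\<close> fix both
  fixed points of \<open>c\<close>, so their commutator is elliptic and has finite order.  If \<open>c\<close> is an isometry without
  further fixed points, then \<open>a\<close>, \<open>b\<close> are isometries too, and Bieberbach's argument makes the iterated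
  commutators of suitable powers of \<open>a\<close> and \<open>b\<close> converge to the identity.
\<close>

subsection \<open>Liouville's theorem for conformal bijections of Euclidean space\<close>

text \<open>A surface given as a glued polygon comes with no presentation of its fundamental group.
  What is needed is read off from real functions on the cover instead: a deck transformation
  \<open>S\<close> is represented by the point \<open>S x0\<close>, and lifts of circle-valued maps
  give functions \<theta> and \<phi>. The pair stands for the affine map taking \<open>x\<close> to
  \<open>2^\<theta> x + \<phi>\<close>: composing it on the right with doubling raises \<theta> by
  1, and with the unit translation raises \<phi> by \<open>2^\<theta>\<close>. Only the effect of
  right multiplication by \<open>a\<close> and \<open>b\<close> has to be known, so no homomorphism
  is constructed. A nilpotent target would not do, since the iterated commutators driven to the
  identity by Bieberbach's argument would be trivial in it. Infinite order of \<open>c\<close> is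
  used twice: its powers produce the fixed point, and an isometry in the discrete group with a
  finite fixed point has finite order. Liouville's theorem is needed only for bijections of the
  whole space; comparing the map with its inverse then excludes inversions, because a positive
  quadratic polynomial of the kind that occurs is bounded below.\<close>

abbreviation smooth :: "('a::euclidean_space \<Rightarrow> 'b::real_normed_vector) \<Rightarrow> bool" where
  "smooth f \<equiv> smooth_on f UNIV"

definition dird :: "'a \<Rightarrow> ('a::real_normed_vector \<Rightarrow> 'b::real_normed_vector) \<Rightarrow> 'a \<Rightarrow> 'b" where
  "dird v f x = frechet_derivative f (at x) v"

lemma dird_eqI: "(f has_derivative f') (at x) \<Longrightarrow> dird v f x = f' v"
  unfolding dird_def using frechet_derivative_at by metis

lemma has_derivative_dird: "f differentiable (at x) \<Longrightarrow> (f has_derivative (\<lambda>v. dird v f x)) (at x)"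
  unfolding dird_def using frechet_derivative_works[of f "at x"] by simp

lemma linear_dird: "f differentiable (at x) \<Longrightarrow> linear (\<lambda>v. dird v f x)"
  using has_derivative_dird has_derivative_linear by blast

lemma Ck_on_Suc_UNIV: "Ck_on (Suc k) f UNIV \<longleftrightarrow> (\<forall>x. f differentiable (at x)) \<and> (\<forall>v. Ck_on k (dird v f) UNIV)"
  by (simp add: dird_def[abs_def])

lemma Ck_on_mono: "Ck_on (Suc k) f UNIV \<Longrightarrow> Ck_on k f UNIV"
proof (induction k arbitrary: f)
  case 0
  then show ?case
    by (auto simp: continuous_on_eq_continuous_at intro: differentiable_imp_continuous_within)
next
  case (Suc k)
  then show ?case unfolding Ck_on_Suc_UNIV[of "Suc k"] Ck_on_Suc_UNIV[of k] by blast
qed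

lemma smooth_iff: "smooth f \<longleftrightarrow> (\<forall>x. f differentiable (at x)) \<and> (\<forall>v. smooth (dird v f))"
  unfolding smooth_on_def using Ck_on_Suc_UNIV Ck_on_mono by blast

lemma smooth_differentiable: "smooth f \<Longrightarrow> f differentiable (at x)"
  using smooth_iff by blast

lemma smooth_dird: "smooth f \<Longrightarrow> smooth (dird v f)"
  using smooth_iff by blast

lemma smooth_has_derivative: "smooth f \<Longrightarrow> (f has_derivative (\<lambda>v. dird v f x)) (at x)"
  using smooth_differentiable has_derivative_dird by blast

lemma smooth_continuous: "smooth f \<Longrightarrow> continuous_on UNIV f"
  unfolding smooth_on_def by (metis Ck_on.simps(1))

lemma Ck_on_const: "Ck_on k (\<lambda>x. c) UNIV"
proof (induction k arbitrary: c)
  case (Suc k)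
  have "dird v (\<lambda>x. c) = (\<lambda>x. 0)" for v :: 'a
    by (rule ext) (rule dird_eqI[where f'="\<lambda>_. 0"], simp)
  then show ?case using Suc by (simp only: Ck_on_Suc_UNIV) simp
qed simp

lemma Ck_on_add: "Ck_on k f UNIV \<Longrightarrow> Ck_on k g UNIV \<Longrightarrow> Ck_on k (\<lambda>x. f x + g x) UNIV"
proof (induction k arbitrary: f g)
  case 0 then show ?case by (simp add: continuous_on_add)
next
  case (Suc k)
  have "dird v (\<lambda>x. f x + g x) = (\<lambda>x. dird v f x + dird v g x)" for v
    using Suc.prems unfolding Ck_on_Suc_UNIV
    by (intro ext dird_eqI) (auto intro!: has_derivative_add has_derivative_dird)
  then show ?case using Suc unfolding Ck_on_Suc_UNIV by simp
qed

lemma Ck_on_bilinear: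
  assumes b: "bounded_bilinear pr"
  shows "Ck_on k f UNIV \<Longrightarrow> Ck_on k g UNIV \<Longrightarrow> Ck_on k (\<lambda>x. pr (f x) (g x)) UNIV"
proof (induction k arbitrary: f g)
  case 0 then show ?case by (simp add: bounded_bilinear.continuous_on[OF b])
next
  case (Suc k)
  have d: "((\<lambda>x. pr (f x) (g x)) has_derivative (\<lambda>v. pr (f x) (dird v g x) + pr (dird v f x) (g x))) (at x)" for x
    using Suc.prems unfolding Ck_on_Suc_UNIV
    by (intro bounded_bilinear.FDERIV[OF b] has_derivative_dird) auto
  have "dird v (\<lambda>x. pr (f x) (g x)) = (\<lambda>x. pr (f x) (dird v g x) + pr (dird v f x) (g x))" for v
    by (intro ext dird_eqI[OF d])
  moreover have "Ck_on k f UNIV" "Ck_on k g UNIV" using Suc.prems Ck_on_mono by blast+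
  ultimately show ?case using Suc d unfolding Ck_on_Suc_UNIV
    by (auto intro!: Ck_on_add differentiableI)
qed

lemma smooth_bilinear: "bounded_bilinear pr \<Longrightarrow> smooth f \<Longrightarrow> smooth g \<Longrightarrow> smooth (\<lambda>x. pr (f x) (g x))"
  unfolding smooth_on_def using Ck_on_bilinear by blast

lemma inverse_sqrt_has_derivative:
  assumes "(\<mu> has_derivative \<mu>') (at x)" "0 < \<mu> x"
  shows "((\<lambda>x. inverse (sqrt (\<mu> x))) has_derivative
     (\<lambda>v. (-1/2) * (inverse (sqrt (\<mu> x)) * (inverse (sqrt (\<mu> x)) * (inverse (sqrt (\<mu> x)) * \<mu>' v))))) (at x)"
proof -
  have "((\<lambda>y. inverse (sqrt y)) has_real_derivative
       (-1/2) * (inverse (sqrt (\<mu> x)) * (inverse (sqrt (\<mu> x)) * inverse (sqrt (\<mu> x))))) (at (\<mu> x))"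
    using assms(2) by (auto intro!: derivative_eq_intros simp: field_simps)
  then have "((\<lambda>y. inverse (sqrt y)) has_derivative
       (\<lambda>h. (-1/2) * (inverse (sqrt (\<mu> x)) * (inverse (sqrt (\<mu> x)) * inverse (sqrt (\<mu> x)))) * h)) (at (\<mu> x))"
    unfolding has_field_derivative_def .
  from has_derivative_compose[OF assms(1) this] show ?thesis by (simp add: mult_ac)
qed

text \<open>The derivative is a product of copies of the function itself and a derivative of \<mu>,
  so regularity of order \<open>k\<close> yields order \<open>k + 1\<close>.\<close>

lemma smooth_inverse_sqrt:
  assumes \<mu>: "smooth \<mu>" "\<And>x. 0 < \<mu> x"
  shows "smooth (\<lambda>x. inverse (sqrt (\<mu> x)))"
proof -
  let ?r = "\<lambda>x. inverse (sqrt (\<mu> x))"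
  have d: "(?r has_derivative (\<lambda>v. (-1/2) * (?r x * (?r x * (?r x * dird v \<mu> x))))) (at x)" for x
    using inverse_sqrt_has_derivative[OF smooth_has_derivative[OF \<mu>(1)] \<mu>(2)] .
  have d': "dird v ?r = (\<lambda>x. (-1/2) * (?r x * (?r x * (?r x * dird v \<mu> x))))" for v
    by (intro ext dird_eqI[OF d])
  have "Ck_on k ?r UNIV" for k
  proof (induction k)
    case 0
    have "\<mu> x \<noteq> 0" for x using \<mu>(2)[of x] by simp
    then show ?case using smooth_continuous[OF \<mu>(1)] by (auto intro!: continuous_intros)
  next
    case (Suc k)
    have "Ck_on k (dird v \<mu>) UNIV" for v using smooth_dird[OF \<mu>(1)] by (simp add: smooth_on_def)
    then have "Ck_on k (dird v ?r) UNIV" for v unfolding d'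
      by (intro Ck_on_bilinear[OF bounded_bilinear_mult] Ck_on_const Suc)
    then show ?case unfolding Ck_on_Suc_UNIV using d by (auto intro: differentiableI)
  qed
  then show ?thesis by (simp add: smooth_on_def)
qed

text \<open>The mean value theorem is applied first in direction \<open>v\<close>, then in direction
  \<open>w\<close>. The left side is symmetric in \<open>v\<close> and \<open>w\<close>, so the same
  number controls both mixed derivatives.\<close>

lemma second_difference:
  fixes f :: "'a::euclidean_space \<Rightarrow> real"
  assumes f: "smooth f" and s: "0 < s"
  obtains a b where "0 < a" "a < s" "0 < b" "b < s"
    "f (x + s *\<^sub>R v + s *\<^sub>R w) - f (x + s *\<^sub>R v) - f (x + s *\<^sub>R w) + f x
      = s * (s * dird w (dird v f) (x + a *\<^sub>R v + b *\<^sub>R w))"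
proof -
  define \<phi> where "\<phi> t = f (x + t *\<^sub>R v + s *\<^sub>R w) - f (x + t *\<^sub>R v)" for t
  have "\<exists>a>0. a < s \<and> \<phi> s - \<phi> 0 = (s - 0) * (dird v f (x + a *\<^sub>R v + s *\<^sub>R w) - dird v f (x + a *\<^sub>R v))"
  proof (rule MVT2[OF s])
    fix t :: real
    have "(\<phi> has_derivative (\<lambda>h. dird (h *\<^sub>R v) f (x + t *\<^sub>R v + s *\<^sub>R w) - dird (h *\<^sub>R v) f (x + t *\<^sub>R v))) (at t)"
      unfolding \<phi>_def
      by (intro has_derivative_diff has_derivative_compose[OF _ smooth_has_derivative[OF f]])
         (auto intro!: derivative_eq_intros)
    then show "DERIV \<phi> t :> dird v f (x + t *\<^sub>R v + s *\<^sub>R w) - dird v f (x + t *\<^sub>R v)"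
      unfolding has_field_derivative_def
      by (rule has_derivative_eq_rhs)
         (auto simp: linear_cmul[OF linear_dird[OF smooth_differentiable[OF f]]] algebra_simps)
  qed
  then obtain a where a: "0 < a" "a < s" "\<phi> s - \<phi> 0 = s * (dird v f (x + a *\<^sub>R v + s *\<^sub>R w) - dird v f (x + a *\<^sub>R v))"
    by auto
  define \<psi> where "\<psi> t = dird v f (x + a *\<^sub>R v + t *\<^sub>R w)" for t
  note g = smooth_dird[OF f, of v]
  have "\<exists>b>0. b < s \<and> \<psi> s - \<psi> 0 = (s - 0) * dird w (dird v f) (x + a *\<^sub>R v + b *\<^sub>R w)"
  proof (rule MVT2[OF s])
    fix t :: real
    have "(\<psi> has_derivative (\<lambda>h. dird (h *\<^sub>R w) (dird v f) (x + a *\<^sub>R v + t *\<^sub>R w))) (at t)"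
      unfolding \<psi>_def
      by (intro has_derivative_compose[OF _ smooth_has_derivative[OF g]])
         (auto intro!: derivative_eq_intros)
    then show "DERIV \<psi> t :> dird w (dird v f) (x + a *\<^sub>R v + t *\<^sub>R w)"
      unfolding has_field_derivative_def
      by (rule has_derivative_eq_rhs)
         (auto simp: linear_cmul[OF linear_dird[OF smooth_differentiable[OF g]]] algebra_simps)
  qed
  then obtain b where b: "0 < b" "b < s" "\<psi> s - \<psi> 0 = s * dird w (dird v f) (x + a *\<^sub>R v + b *\<^sub>R w)"
    by auto
  show thesis
    by (rule that[OF a(1,2) b(1,2)]) (use a(3) b(3) in \<open>simp add: \<phi>_def \<psi>_def\<close>)
qed

text \<open>If the mixed derivatives differed at \<open>x\<close>, continuity would keep them apart
  near \<open>x\<close>, whereas the symmetric second difference equates a value of the one with a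
  value of the other at points arbitrarily close to \<open>x\<close>.\<close>

lemma dird_commute_real:
  fixes f :: "'a::euclidean_space \<Rightarrow> real"
  assumes f: "smooth f"
  shows "dird v (dird w f) x = dird w (dird v f) x"
proof (rule ccontr)
  define e where "e = \<bar>dird v (dird w f) x - dird w (dird v f) x\<bar> / 2"
  assume "\<not> ?thesis"
  then have e: "e > 0" by (simp add: e_def)
  have "continuous (at x) (dird v (dird w f))" "continuous (at x) (dird w (dird v f))"
    using smooth_continuous[OF smooth_dird[OF smooth_dird[OF f]]]
    by (auto simp: continuous_on_eq_continuous_at)
  then obtain d1 d2 where d: "d1 > 0" "d2 > 0"
    "\<forall>y. dist y x < d1 \<longrightarrow> dist (dird v (dird w f) y) (dird v (dird w f) x) < e"
    "\<forall>y. dist y x < d2 \<longrightarrow> dist (dird w (dird v f) y) (dird w (dird v f) x) < e"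
    using e unfolding continuous_at_eps_delta by metis
  \<comment> \<open>The summand 1 keeps \<open>m\<close> positive when both directions vanish. With
    \<open>s\<close> as below, the intermediate points of both second differences stay within both
    radii.\<close>
  define m where "m = norm v + norm w + 1"
  have m: "m > 0" by (simp add: m_def add_nonneg_pos)
  define s where "s = min d1 d2 / m"
  have s: "s > 0" using d m by (simp add: s_def)
  have close: "dist (x + a *\<^sub>R v + b *\<^sub>R w) x < min d1 d2" if "0 < a" "a < s" "0 < b" "b < s" for a b
  proof -
    have "dist (x + a *\<^sub>R v + b *\<^sub>R w) x = norm (a *\<^sub>R v + b *\<^sub>R w)" by (simp add: dist_norm add.assoc)
    also have "\<dots> \<le> a * norm v + b * norm w" using norm_triangle_ineq[of "a *\<^sub>R v" "b *\<^sub>R w"] that by simp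
    also have "\<dots> \<le> s * norm v + s * norm w" using that by (intro add_mono mult_right_mono) auto
    also have "\<dots> < s * m" using s by (simp add: m_def algebra_simps)
    finally show ?thesis using m by (simp add: s_def)
  qed
  obtain a b where ab: "0 < a" "a < s" "0 < b" "b < s"
    "f (x + s *\<^sub>R v + s *\<^sub>R w) - f (x + s *\<^sub>R v) - f (x + s *\<^sub>R w) + f x
      = s * (s * dird w (dird v f) (x + a *\<^sub>R v + b *\<^sub>R w))"
    by (rule second_difference[OF f s])
  obtain a' b' where ab': "0 < a'" "a' < s" "0 < b'" "b' < s"
    "f (x + s *\<^sub>R w + s *\<^sub>R v) - f (x + s *\<^sub>R w) - f (x + s *\<^sub>R v) + f x
      = s * (s * dird v (dird w f) (x + a' *\<^sub>R w + b' *\<^sub>R v))"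
    by (rule second_difference[OF f s])
  have "s * (s * dird w (dird v f) (x + a *\<^sub>R v + b *\<^sub>R w)) = s * (s * dird v (dird w f) (x + b' *\<^sub>R v + a' *\<^sub>R w))"
    using ab(5) ab'(5) by (simp add: algebra_simps)
  then have "dird w (dird v f) (x + a *\<^sub>R v + b *\<^sub>R w) = dird v (dird w f) (x + b' *\<^sub>R v + a' *\<^sub>R w)"
    using s by simp
  moreover have "dist (dird w (dird v f) (x + a *\<^sub>R v + b *\<^sub>R w)) (dird w (dird v f) x) < e"
    using d(4) close[OF ab(1-4)] by simp
  moreover have "dist (dird v (dird w f) (x + b' *\<^sub>R v + a' *\<^sub>R w)) (dird v (dird w f) x) < e"
    using d(3) close[OF ab'(3,4,1,2)] by simp
  ultimately show False unfolding dist_real_def e_def by (simp add: abs_if split: if_splits)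
qed

lemma dird_inner:
  assumes "smooth f" "smooth g"
  shows "dird v (\<lambda>x. f x \<bullet> g x) x = f x \<bullet> dird v g x + dird v f x \<bullet> g x"
  by (rule dird_eqI) (intro bounded_bilinear.FDERIV[OF bounded_bilinear_inner] smooth_has_derivative assms)

lemma smooth_const: "smooth (\<lambda>x. c)"
  by (simp add: smooth_on_def Ck_on_const)

lemma dird_inner_const: "smooth f \<Longrightarrow> dird v (\<lambda>x. f x \<bullet> c) = (\<lambda>x. dird v f x \<bullet> c)"
  by (intro ext dird_eqI) (intro has_derivative_inner_left smooth_has_derivative)

lemma dird_commute:
  fixes f :: "'a::euclidean_space \<Rightarrow> 'b::euclidean_space"
  assumes f: "smooth f"
  shows "dird v (dird w f) x = dird w (dird v f) x"
proof (rule euclidean_eqI)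
  fix b :: 'b assume "b \<in> Basis"
  have s: "smooth (\<lambda>x. f x \<bullet> b)"
    by (intro smooth_bilinear[OF bounded_bilinear_inner] f smooth_const)
  show "dird v (dird w f) x \<bullet> b = dird w (dird v f) x \<bullet> b"
    using dird_commute_real[OF s, of v w x] by (simp add: dird_inner_const f smooth_dird)
qed


section \<open>Derivatives of a conformal map up to order three\<close>

locale conformal_map =
  fixes f :: "'a::euclidean_space \<Rightarrow> 'a" and \<mu> :: "'a \<Rightarrow> real"
  assumes smooth: "smooth f"
    and conf: "\<And>x v w. dird v f x \<bullet> dird w f x = \<mu> x * (v \<bullet> w)"
    and pos: "\<And>x. 0 < \<mu> x"
    and dim: "3 \<le> DIM('a)"
begin

lemma smooth_factor: "smooth \<mu>"
proof -
  obtain u :: 'a where "u \<in> Basis" using nonempty_Basis by blast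
  then have "\<mu> = (\<lambda>x. dird u f x \<bullet> dird u f x)" using conf[of u _ u] by auto
  then show ?thesis
    using smooth_bilinear[OF bounded_bilinear_inner smooth_dird[OF smooth] smooth_dird[OF smooth]] by metis
qed

text \<open>The reciprocal \<open>\<rho>\<close> of the dilatation: Liouville's theorem comes down to \<open>\<rho>\<close> being quadratic.\<close>

definition \<rho> :: "'a \<Rightarrow> real" where "\<rho> x = inverse (sqrt (\<mu> x))"

lemma smooth_rho: "smooth \<rho>"
  unfolding \<rho>_def[abs_def] by (rule smooth_inverse_sqrt[OF smooth_factor pos])

lemma rho_pos: "0 < \<rho> x"
  using pos by (simp add: \<rho>_def)

lemma factor_rho: "\<mu> x * \<rho> x * \<rho> x = 1"
  using pos[of x] by (simp add: \<rho>_def field_simps flip: power2_eq_square)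

text \<open>Differentiates \<open>\<mu> * \<rho> * \<rho> = 1\<close> and cancels one factor \<rho>.
  It trades derivatives of \<mu> for derivatives of \<rho>, in which the equations for
  \<open>f\<close> become linear.\<close>

lemma dird_factor_rho: "\<rho> x * dird a \<mu> x + 2 * \<mu> x * dird a \<rho> x = 0"
proof -
  have "((\<lambda>x. \<mu> x * \<rho> x * \<rho> x) has_derivative
     (\<lambda>v. (\<mu> x * \<rho> x) * dird v \<rho> x + (\<mu> x * dird v \<rho> x + dird v \<mu> x * \<rho> x) * \<rho> x)) (at x)"
    by (intro has_derivative_mult smooth_has_derivative smooth_factor smooth_rho)
  from dird_eqI[OF this, of a] have "dird a (\<lambda>x. 1 :: real) x =
     (\<mu> x * \<rho> x) * dird a \<rho> x + (\<mu> x * dird a \<rho> x + dird a \<mu> x * \<rho> x) * \<rho> x"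
    by (simp add: factor_rho)
  moreover have "dird a (\<lambda>x. 1 :: real) x = 0" by (rule dird_eqI[where f'="\<lambda>_. 0"]) simp
  ultimately have "\<rho> x * (\<rho> x * dird a \<mu> x + 2 * \<mu> x * dird a \<rho> x) = 0" by (simp add: algebra_simps)
  then show ?thesis using rho_pos[of x] by simp
qed

text \<open>The derivative of a conformal map is injective, hence onto. This turns identities
  between inner products with derivatives of \<open>f\<close> into identities between
  vectors.\<close>

lemma spanning: 
  assumes "\<And>c. h \<bullet> dird c f x = 0"
  shows "h = 0"
proof -
  have l: "linear (\<lambda>c. dird c f x)" by (rule linear_dird[OF smooth_differentiable[OF smooth]])
  have "inj (\<lambda>c. dird c f x)"
  proof (rule linear_injective_0[OF l, THEN iffD2], intro allI impI)
    fix c assume "dird c f x = 0"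
    then have "\<mu> x * (c \<bullet> c) = 0" using conf[of c x c] by simp
    then show "c = 0" using pos[of x] by simp
  qed
  then have "surj (\<lambda>c. dird c f x)" by (rule linear_inj_imp_surj[OF l])
  then obtain c where "h = dird c f x" by blast
  then show ?thesis using assms[of c] by simp
qed

text \<open>The computation of the Christoffel symbols: the conformality relation is differentiated
  with the three directions in each role, and symmetry of second derivatives isolates one
  term.\<close>

lemma second_derivative_inner:
  "2 * (dird a (dird b f) x \<bullet> dird c f x) =
     dird b \<mu> x * (a \<bullet> c) + dird a \<mu> x * (b \<bullet> c) - dird c \<mu> x * (a \<bullet> b)"
proof -
  have d: "dird a f x \<bullet> dird c (dird b f) x + dird c (dird a f) x \<bullet> dird b f x = dird c \<mu> x * (a \<bullet> b)" for a b c
  proof -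
    have "(\<lambda>x. dird a f x \<bullet> dird b f x) = (\<lambda>x. \<mu> x * (a \<bullet> b))" using conf by auto
    moreover have "dird c (\<lambda>x. \<mu> x * (a \<bullet> b)) x = dird c \<mu> x * (a \<bullet> b)"
      by (rule dird_eqI) (intro has_derivative_mult_left smooth_has_derivative smooth_factor)
    ultimately show ?thesis using dird_inner[OF smooth_dird smooth_dird, OF smooth smooth, of c a b x] by simp
  qed
  have "dird a f x \<bullet> dird b (dird c f) x + dird a (dird b f) x \<bullet> dird c f x = dird b \<mu> x * (a \<bullet> c)"
    using d[of a b c] unfolding dird_commute[OF smooth, of b a x] by simp
  moreover have "dird b f x \<bullet> dird a (dird c f) x + dird a (dird b f) x \<bullet> dird c f x = dird a \<mu> x * (b \<bullet> c)"
    using d[of b a c] by simp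
  moreover have "dird a f x \<bullet> dird b (dird c f) x + dird b f x \<bullet> dird a (dird c f) x = dird c \<mu> x * (a \<bullet> b)"
    using d[of a c b] unfolding dird_commute[OF smooth, of c b x] dird_commute[OF smooth, of c a x]
    by (simp add: inner_commute)
  ultimately show ?thesis by linarith
qed

text \<open>Equivalently, the mixed derivative of the product of \<rho> and \<open>f\<close> along
  orthogonal directions is the mixed derivative of \<rho> times \<open>f\<close>. Orthogonality
  kills the one term of \<open>second_derivative_inner\<close> that involves the derivative along
  \<open>c\<close>.\<close>

lemma second_derivative_orthogonal:
  assumes "a \<bullet> b = 0"
  shows "\<rho> x *\<^sub>R dird a (dird b f) x + dird a \<rho> x *\<^sub>R dird b f x + dird b \<rho> x *\<^sub>R dird a f x = 0"
proof (rule spanning)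
  fix c
  have "2 * ((\<rho> x *\<^sub>R dird a (dird b f) x + dird a \<rho> x *\<^sub>R dird b f x + dird b \<rho> x *\<^sub>R dird a f x) \<bullet> dird c f x)
      = \<rho> x * (2 * (dird a (dird b f) x \<bullet> dird c f x)) + 2 * dird a \<rho> x * (\<mu> x * (b \<bullet> c)) + 2 * dird b \<rho> x * (\<mu> x * (a \<bullet> c))"
    by (simp add: inner_add_left conf algebra_simps)
  also have "\<dots> = (a \<bullet> c) * (\<rho> x * dird b \<mu> x + 2 * \<mu> x * dird b \<rho> x) + (b \<bullet> c) * (\<rho> x * dird a \<mu> x + 2 * \<mu> x * dird a \<rho> x)"
    unfolding second_derivative_inner assms by (simp add: algebra_simps)
  also have "\<dots> = 0" by (simp add: dird_factor_rho)
  finally show "(\<rho> x *\<^sub>R dird a (dird b f) x + dird a \<rho> x *\<^sub>R dird b f x + dird b \<rho> x *\<^sub>R dird a f x) \<bullet> dird c f x = 0"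
    by simp
qed

lemma third_derivative_orthogonal:
  assumes "a \<bullet> b = 0"
  shows "dird c \<rho> x *\<^sub>R dird a (dird b f) x + \<rho> x *\<^sub>R dird c (dird a (dird b f)) x
     + dird c (dird a \<rho>) x *\<^sub>R dird b f x + dird a \<rho> x *\<^sub>R dird c (dird b f) x
     + dird c (dird b \<rho>) x *\<^sub>R dird a f x + dird b \<rho> x *\<^sub>R dird c (dird a f) x = 0"
proof -
  have "((\<lambda>x. \<rho> x *\<^sub>R dird a (dird b f) x + dird a \<rho> x *\<^sub>R dird b f x + dird b \<rho> x *\<^sub>R dird a f x) has_derivative
     (\<lambda>v. ((\<rho> x *\<^sub>R dird v (dird a (dird b f)) x + dird v \<rho> x *\<^sub>R dird a (dird b f) x)
       + (dird a \<rho> x *\<^sub>R dird v (dird b f) x + dird v (dird a \<rho>) x *\<^sub>R dird b f x))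
       + (dird b \<rho> x *\<^sub>R dird v (dird a f) x + dird v (dird b \<rho>) x *\<^sub>R dird a f x))) (at x)"
    by (intro has_derivative_add has_derivative_scaleR smooth_has_derivative smooth_dird smooth smooth_rho)
  from dird_eqI[OF this, of c] have "dird c (\<lambda>x. 0 :: 'a) x =
       ((\<rho> x *\<^sub>R dird c (dird a (dird b f)) x + dird c \<rho> x *\<^sub>R dird a (dird b f) x)
       + (dird a \<rho> x *\<^sub>R dird c (dird b f) x + dird c (dird a \<rho>) x *\<^sub>R dird b f x))
       + (dird b \<rho> x *\<^sub>R dird c (dird a f) x + dird c (dird b \<rho>) x *\<^sub>R dird a f x)"
    by (simp only: second_derivative_orthogonal[OF assms])
  moreover have "dird c (\<lambda>x. 0 :: 'a) x = 0" by (rule dird_eqI[where f'="\<lambda>_. 0"]) simp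
  ultimately show ?thesis by (simp add: algebra_simps)
qed

text \<open>Dimension at least 3 enters Liouville's theorem here: there is a direction orthogonal to
  two given ones.\<close>

lemma orthogonal_exists:
  obtains c :: 'a where "norm c = 1" "a \<bullet> c = 0" "b \<bullet> c = 0"
proof -
  have "dim {a, b} \<le> card {a, b}" by (rule dim_le_card') simp
  also have "\<dots> \<le> 2" using card_insert_le_m1[of 2 "{b}" a] by simp
  finally have "dim {a, b} < DIM('a)" using dim by simp
  then obtain d where d: "d \<noteq> 0" "\<And>y. y \<in> span {a, b} \<Longrightarrow> orthogonal d y"
    by (rule orthogonal_to_subspace_exists) blast
  show thesis
    by (rule that[of "sgn d"])
       (use d d(2)[OF span_base, of a] d(2)[OF span_base, of b]
         in \<open>auto simp: norm_sgn sgn_div_norm orthogonal_def inner_commute\<close>)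
qed

text \<open>
  The third derivatives of \<open>f\<close> are symmetric; interchanging two of three mutually orthogonal
  directions in \<open>third_derivative_orthogonal\<close> leaves only a multiple of a derivative of \<open>f\<close>.
\<close>

lemma hessian_orthogonal:
  assumes "a \<bullet> b = 0"
  shows "dird a (dird b \<rho>) x = 0"
proof -
  obtain c :: 'a where c: "norm c = 1" "a \<bullet> c = 0" "b \<bullet> c = 0" by (rule orthogonal_exists)
  have 1: "dird c (dird a (dird b f)) x = dird b (dird a (dird c f)) x"
  proof -
    have "dird a (dird b f) = dird b (dird a f)" "dird a (dird c f) = dird c (dird a f)"
      by (intro ext dird_commute smooth)+
    then show ?thesis using dird_commute[OF smooth_dird[OF smooth], of c b a x] by simp
  qed
  have "dird c (dird a \<rho>) x *\<^sub>R dird b f x - dird b (dird a \<rho>) x *\<^sub>R dird c f x =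
     (dird c \<rho> x *\<^sub>R dird a (dird b f) x + \<rho> x *\<^sub>R dird c (dird a (dird b f)) x
     + dird c (dird a \<rho>) x *\<^sub>R dird b f x + dird a \<rho> x *\<^sub>R dird c (dird b f) x
     + dird c (dird b \<rho>) x *\<^sub>R dird a f x + dird b \<rho> x *\<^sub>R dird c (dird a f) x)
     - (dird b \<rho> x *\<^sub>R dird a (dird c f) x + \<rho> x *\<^sub>R dird b (dird a (dird c f)) x
     + dird b (dird a \<rho>) x *\<^sub>R dird c f x + dird a \<rho> x *\<^sub>R dird b (dird c f) x
     + dird b (dird c \<rho>) x *\<^sub>R dird a f x + dird c \<rho> x *\<^sub>R dird b (dird a f) x)"
    unfolding 1 dird_commute[OF smooth, of c b x] dird_commute[OF smooth_rho, of c b x]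
      dird_commute[OF smooth, of b a x] dird_commute[OF smooth, of c a x]
    by simp
  also have "\<dots> = 0"
    unfolding third_derivative_orthogonal[OF assms] third_derivative_orthogonal[OF c(2)] by simp
  finally have "(dird c (dird a \<rho>) x *\<^sub>R dird b f x - dird b (dird a \<rho>) x *\<^sub>R dird c f x) \<bullet> dird c f x = 0"
    by simp
  then have "dird b (dird a \<rho>) x * (\<mu> x * (c \<bullet> c)) = 0"
    by (simp add: inner_diff_left conf c)
  moreover have "\<mu> x * (c \<bullet> c) \<noteq> 0" using pos[of x] c(1) by (simp add: norm_eq_1 del: inner_eq_zero_iff)
  ultimately show ?thesis using dird_commute[OF smooth_rho, of a b x] by auto
qed

text \<open>Polarization: for orthogonal unit vectors also \<open>u + v\<close> and
  \<open>u - v\<close> are orthogonal, and the mixed derivative along these two is the difference of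
  the diagonal ones.\<close>

lemma hessian_diagonal_orthogonal:
  assumes "norm u = 1" "norm v = 1" "u \<bullet> v = 0"
  shows "dird u (dird u \<rho>) x = dird v (dird v \<rho>) x"
proof -
  have l: "linear (\<lambda>v. dird v g y)" if "smooth g" for g :: "'a \<Rightarrow> real" and y
    by (rule linear_dird[OF smooth_differentiable[OF that]])
  have "(u + v) \<bullet> (u - v) = 0" using assms inner_commute[of u v]
    by (simp add: inner_diff_right inner_add_left norm_eq_1)
  then have "0 = dird (u + v) (dird (u - v) \<rho>) x" by (simp add: hessian_orthogonal)
  also have "\<dots> = dird (u - v) (dird (u + v) \<rho>) x" by (rule dird_commute[OF smooth_rho])
  also have "dird (u + v) \<rho> = (\<lambda>y. dird u \<rho> y + dird v \<rho> y)"
    by (intro ext linear_add l smooth_rho)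
  also have "dird (u - v) (\<lambda>y. dird u \<rho> y + dird v \<rho> y) x
      = dird (u - v) (dird u \<rho>) x + dird (u - v) (dird v \<rho>) x"
    by (rule dird_eqI) (intro has_derivative_add smooth_has_derivative smooth_dird smooth_rho)
  also have "\<dots> = dird u (dird u \<rho>) x - dird v (dird u \<rho>) x + (dird u (dird v \<rho>) x - dird v (dird v \<rho>) x)"
    by (simp only: linear_diff[OF l[OF smooth_dird[OF smooth_rho]]])
  finally show ?thesis using assms(3) by (simp add: hessian_orthogonal inner_commute)
qed

lemma hessian_diagonal:
  assumes "norm u = 1" "norm v = 1"
  shows "dird u (dird u \<rho>) x = dird v (dird v \<rho>) x"
proof -
  obtain c :: 'a where c: "norm c = 1" "u \<bullet> c = 0" "v \<bullet> c = 0" by (rule orthogonal_exists)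
  show ?thesis
    using hessian_diagonal_orthogonal[OF assms(1) c(1,2)] hessian_diagonal_orthogonal[OF assms(2) c(1,3)] by simp
qed

text \<open>Orthogonally to \<open>u\<close>, interchanging derivatives produces a mixed derivative,
  which vanishes. Along \<open>u\<close>, the diagonal value is first rewritten with an orthogonal
  unit vector, and the same argument applies.\<close>

lemma hessian_constant:
  assumes u: "norm u = 1"
  shows "dird u (dird u \<rho>) x = dird u (dird u \<rho>) y"
proof -
  let ?s = "dird u (dird u \<rho>)"
  have sm: "smooth ?s" by (intro smooth_dird smooth_rho)
  have zero: "dird w (\<lambda>x. 0 :: real) x = 0" for w x :: 'a
    by (rule dird_eqI[where f'="\<lambda>_. 0"]) simp
  have orth: "dird w ?s x = 0" if "u \<bullet> w = 0" for w x
  proof -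
    have "dird w ?s x = dird u (dird w (dird u \<rho>)) x" by (rule dird_commute[OF smooth_dird[OF smooth_rho]])
    also have "dird w (dird u \<rho>) = (\<lambda>x. 0)" using that by (intro ext hessian_orthogonal) (simp add: inner_commute)
    finally show ?thesis by (simp add: zero)
  qed
  have par: "dird u ?s x = 0" for x
  proof -
    obtain v :: 'a where v: "norm v = 1" "u \<bullet> v = 0" by (rule orthogonal_exists)
    have "?s = dird v (dird v \<rho>)" by (intro ext hessian_diagonal u v)
    then have "dird u ?s x = dird u (dird v (dird v \<rho>)) x" by simp
    also have "\<dots> = dird v (dird u (dird v \<rho>)) x" by (rule dird_commute[OF smooth_dird[OF smooth_rho]])
    also have "dird u (dird v \<rho>) = (\<lambda>x. 0)" using v by (intro ext hessian_orthogonal) simp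
    finally show ?thesis by (simp add: zero)
  qed
  have "dird w ?s x = 0" for w x
  proof -
    have l: "linear (\<lambda>w. dird w ?s x)" by (rule linear_dird[OF smooth_differentiable[OF sm]])
    have "dird w ?s x = dird ((w \<bullet> u) *\<^sub>R u + (w - (w \<bullet> u) *\<^sub>R u)) ?s x" by simp
    also have "\<dots> = (w \<bullet> u) * dird u ?s x + dird (w - (w \<bullet> u) *\<^sub>R u) ?s x"
      by (simp only: linear_add[OF l] linear_cmul[OF l]) simp
    also have "\<dots> = 0"
      using u by (simp add: par) (rule orth, simp add: inner_diff_right inner_commute norm_eq_1)
    finally show ?thesis .
  qed
  then have "(?s has_derivative (\<lambda>v. 0)) (at x)" for x
    using smooth_has_derivative[OF sm, of x] by simp
  then have "\<exists>c. \<forall>x\<in>UNIV. ?s x = c" by (intro has_derivative_zero_constant) auto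
  then show ?thesis by auto
qed

lemma rho_quadratic:
  obtains s where "\<And>x v. \<rho> (x + v) = \<rho> x + dird v \<rho> x + s * (v \<bullet> v)"
proof -
  obtain u :: 'a where u: "norm u = 1" using norm_Basis nonempty_Basis by blast
  define s where "s = dird u (dird u \<rho>) 0"
  have hess: "dird v (dird v \<rho>) x = s * (v \<bullet> v)" for v x
  proof (cases "v = 0")
    case True
    then show ?thesis using linear_0[OF linear_dird[OF smooth_differentiable[OF smooth_dird[OF smooth_rho]]]] by simp
  next
    case False
    then have n: "norm (sgn v) = 1" by (simp add: norm_sgn)
    have v: "v = norm v *\<^sub>R sgn v" using False by (simp add: sgn_div_norm)
    have l: "linear (\<lambda>v. dird v g y)" if "smooth g" for g :: "'a \<Rightarrow> real" and y
      by (rule linear_dird[OF smooth_differentiable[OF that]])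
    have "dird v \<rho> = (\<lambda>y. norm v * dird (sgn v) \<rho> y)"
      by (rule ext, subst (1) v) (simp only: linear_cmul[OF l[OF smooth_rho]], simp)
    moreover have "dird w (\<lambda>y. norm v * dird (sgn v) \<rho> y) x = norm v * dird w (dird (sgn v) \<rho>) x" for w
      by (rule dird_eqI) (intro has_derivative_mult_right smooth_has_derivative smooth_dird smooth_rho)
    moreover have "dird v (dird (sgn v) \<rho>) x = norm v * dird (sgn v) (dird (sgn v) \<rho>) x"
      by (subst (1) v) (simp only: linear_cmul[OF l[OF smooth_dird[OF smooth_rho]]], simp)
    moreover have "dird (sgn v) (dird (sgn v) \<rho>) x = s"
      unfolding s_def using hessian_diagonal[OF n u, of x] hessian_constant[OF u, of x 0] by simp
    ultimately show ?thesis by (simp add: power2_norm_eq_inner[symmetric] power2_eq_square)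
  qed
  have "\<rho> (x + v) = \<rho> x + dird v \<rho> x + s / 2 * (v \<bullet> v)" for x v
  proof -
    \<comment> \<open>On each line the second derivative is constant, so the Taylor expansion of
      order two is exact; \<open>s\<close> is the eigenvalue of the Hessian, whence the coefficient
      \<open>s / 2\<close>.\<close>
    define F where "F t = \<rho> (x + t *\<^sub>R v)" for t :: real
    define F1 where "F1 t = dird v \<rho> (x + t *\<^sub>R v)" for t :: real
    have l: "dird (h *\<^sub>R v) g y = dird v g y * h" if "smooth g" for g :: "'a \<Rightarrow> real" and y h
      using linear_cmul[OF linear_dird[OF smooth_differentiable[OF that]], of h v] by simp
    have D: "((\<lambda>t. g (x + t *\<^sub>R v)) has_real_derivative dird v g (x + t *\<^sub>R v)) (at t)" if "smooth g" for g :: "'a \<Rightarrow> real" and t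
    proof -
      have "((\<lambda>t. g (x + t *\<^sub>R v)) has_derivative (\<lambda>h. dird (h *\<^sub>R v) g (x + t *\<^sub>R v))) (at t)"
        by (intro has_derivative_compose[OF _ smooth_has_derivative[OF that]]) (auto intro!: derivative_eq_intros)
      then show ?thesis unfolding has_field_derivative_def by (simp add: l[OF that])
    qed
    have D1: "(F1 has_real_derivative s * (v \<bullet> v)) (at t)" for t
      unfolding F1_def using D[OF smooth_dird[OF smooth_rho], of v t] by (simp add: hess)
    have "((\<lambda>t. F1 t - s * (v \<bullet> v) * t) has_real_derivative 0) (at t)" for t
      by (auto intro!: derivative_eq_intros D1)
    then have F1: "F1 t - s * (v \<bullet> v) * t = F1 0 - s * (v \<bullet> v) * 0" for t
      by (rule DERIV_isconst_all[rule_format, of "\<lambda>t. F1 t - s * (v \<bullet> v) * t"])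
    have "(F has_real_derivative F1 t) (at t)" for t
      unfolding F_def F1_def by (rule D[OF smooth_rho])
    moreover have "F1 t = F1 0 + s * (v \<bullet> v) * t" for t using F1[of t] by simp
    ultimately have D0: "(F has_real_derivative F1 0 + s * (v \<bullet> v) * t) (at t)" for t by metis
    have "((\<lambda>t. F t - F1 0 * t - s / 2 * (v \<bullet> v) * t ^ 2) has_real_derivative 0) (at t)" for t
      by (auto intro!: derivative_eq_intros D0)
    then have "F 1 - F1 0 * 1 - s / 2 * (v \<bullet> v) * 1 ^ 2 = F 0 - F1 0 * 0 - s / 2 * (v \<bullet> v) * 0 ^ 2"
      by (rule DERIV_isconst_all[rule_format, of "\<lambda>t. F t - F1 0 * t - s / 2 * (v \<bullet> v) * t ^ 2"])
    then show ?thesis by (simp add: F_def F1_def)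
  qed
  then show thesis by (rule that)
qed

text \<open>Positivity excludes a negative leading coefficient. For coefficient zero, it forces the
  linear part to vanish as well; for a positive one, completing the square exhibits a minimum, whose
  value is positive.\<close>

lemma rho_bounded_below:
  obtains m where "0 < m" "\<And>x. m \<le> \<rho> x"
proof -
  obtain s where s: "\<And>x v. \<rho> (x + v) = \<rho> x + dird v \<rho> x + s * (v \<bullet> v)" using rho_quadratic by blast
  have lin: "linear (\<lambda>v. dird v \<rho> x)" for x
    by (rule linear_dird[OF smooth_differentiable[OF smooth_rho]])
  have line: "\<rho> (x + t *\<^sub>R v) = \<rho> x + t * dird v \<rho> x + t * t * (s * (v \<bullet> v))" for x v t
    using s[of x "t *\<^sub>R v"] linear_cmul[OF lin, of t v x] by (simp add: algebra_simps)
  have "0 \<le> s"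
  proof (rule ccontr)
    assume neg: "\<not> 0 \<le> s"
    obtain u :: 'a where u: "norm u = 1" using norm_Basis nonempty_Basis by blast
    have "\<rho> (0 + t *\<^sub>R u) + \<rho> (0 + (-t) *\<^sub>R u) = 2 * \<rho> 0 + 2 * t * t * s" for t
      unfolding line using u by (simp add: norm_eq_1)
    then have "0 < 2 * \<rho> 0 + 2 * t * t * s" for t using rho_pos by (metis add_pos_pos)
    \<comment> \<open>At this parameter the values at opposite points would add up to zero.\<close>
    moreover have "sqrt (- \<rho> 0 / s) * sqrt (- \<rho> 0 / s) = - \<rho> 0 / s"
      using neg rho_pos[of 0] by (simp add: divide_nonneg_neg)
    then have "2 * sqrt (- \<rho> 0 / s) * sqrt (- \<rho> 0 / s) * s = 2 * (- \<rho> 0 / s) * s" by simp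
    ultimately have "0 < 2 * \<rho> 0 + 2 * (- \<rho> 0 / s) * s" by metis
    then show False using neg by simp
  qed
  show thesis
  proof (cases "s = 0")
    case True
    have "dird v \<rho> 0 = 0" for v
    proof (rule ccontr)
      assume "dird v \<rho> 0 \<noteq> 0"
      then show False using line[of 0 "- \<rho> 0 / dird v \<rho> 0" v] True rho_pos[of "0 + (- \<rho> 0 / dird v \<rho> 0) *\<^sub>R v"] by simp
    qed
    then have "\<rho> 0 \<le> \<rho> x" for x using s[of 0 x] True by simp
    then show thesis using that[of "\<rho> 0"] rho_pos by blast
  next
    case False
    then have s0: "0 < s" using \<open>0 \<le> s\<close> by simp
    \<comment> \<open>The vertex of the paraboloid; the adjoint applied to 1 is the gradient of
      \<rho> at 0.\<close>
    define p where "p = - (1 / (2 * s)) *\<^sub>R adjoint (\<lambda>v. dird v \<rho> 0) 1"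
    have p: "dird v \<rho> 0 = - 2 * s * (v \<bullet> p)" for v
    proof -
      have "v \<bullet> adjoint (\<lambda>v. dird v \<rho> 0) 1 = dird v \<rho> 0 \<bullet> 1"
        by (rule adjoint_works[OF lin])
      moreover have "- 2 * s * (v \<bullet> p) = v \<bullet> adjoint (\<lambda>v. dird v \<rho> 0) 1"
        unfolding p_def inner_scaleR_right using s0 by simp
      ultimately show ?thesis by simp
    qed
    have "\<rho> p \<le> \<rho> x" for x
    proof -
      have "\<rho> x - \<rho> p = s * ((x - p) \<bullet> (x - p))"
      proof -
        have "\<rho> x = \<rho> 0 + - 2 * s * (x \<bullet> p) + s * (x \<bullet> x)" using s[of 0 x] by (simp only: p add_0)
        moreover have "\<rho> p = \<rho> 0 + - 2 * s * (p \<bullet> p) + s * (p \<bullet> p)" using s[of 0 p] by (simp only: p add_0)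
        moreover have "(x - p) \<bullet> (x - p) = x \<bullet> x - 2 * (x \<bullet> p) + p \<bullet> p"
          by (simp add: inner_diff_left inner_diff_right inner_commute[of p x])
        ultimately show ?thesis by (simp add: algebra_simps)
      qed
      also have "\<dots> \<ge> 0" using s0 by simp
      finally show ?thesis by simp
    qed
    then show thesis using that[of "\<rho> p"] rho_pos by blast
  qed
qed

text \<open>On a line through \<open>y\<close>, a polynomial of degree at most two with values
  between 0 and \<open>B\<close> must lose first its quadratic and then its linear term.\<close>

lemma rho_constant:
  assumes bound: "\<And>x. \<rho> x \<le> B"
  shows "\<rho> x = \<rho> y"
proof -
  obtain s where s: "\<And>x v. \<rho> (x + v) = \<rho> x + dird v \<rho> x + s * (v \<bullet> v)" using rho_quadratic by blast
  have lin: "linear (\<lambda>v. dird v \<rho> x)" for x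
    by (rule linear_dird[OF smooth_differentiable[OF smooth_rho]])
  have line: "\<rho> (y + t *\<^sub>R v) = \<rho> y + t * dird v \<rho> y + t * t * (s * (v \<bullet> v))" for v t
    using s[of y "t *\<^sub>R v"] linear_cmul[OF lin, of t v y] by (simp add: algebra_simps)
  have B: "0 < B" using bound rho_pos less_le_trans by blast
  define v where "v = x - y"
  have b: "0 < \<rho> (y + t *\<^sub>R v)" "\<rho> (y + t *\<^sub>R v) \<le> B" for t using bound rho_pos by auto
  let ?q = "s * (v \<bullet> v)" and ?l = "dird v \<rho> y"
  have q: "?q = 0"
  proof (rule ccontr)
    assume q: "?q \<noteq> 0"
    \<comment> \<open>For this \<open>t\<close> the values at opposite points add up to
      \<open>2 * \<rho> y\<close> plus or minus \<open>4 * B\<close>, which lies outside the range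
      from 0 to \<open>2 * B\<close>.\<close>
    define t where "t = sqrt (2 * B / \<bar>?q\<bar>)"
    have t: "t * t = 2 * B / \<bar>?q\<bar>" using B by (simp add: t_def)
    have "\<rho> (y + t *\<^sub>R v) + \<rho> (y + (-t) *\<^sub>R v) = 2 * \<rho> y + 2 * (t * t * ?q)"
      unfolding line by (simp add: algebra_simps)
    moreover have "t * t * ?q = 2 * B \<or> t * t * ?q = - 2 * B" unfolding t using q by (auto simp: abs_if)
    ultimately show False using b[of t] b[of "-t"] rho_pos[of y] bound[of y] B by linarith
  qed
  have "?l = 0"
  proof (rule ccontr)
    assume l: "?l \<noteq> 0"
    have "\<rho> (y + (- \<rho> y / ?l) *\<^sub>R v) = 0" unfolding line q using l by simp
    then show False using rho_pos by (metis less_irrefl)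
  qed
  then show ?thesis using line[of 1 v] q by (simp add: v_def)
qed

end

text \<open>The dilatations of \<open>f\<close> and of its inverse \<open>g\<close> are reciprocal
  at corresponding points, so the lower bound on the quadratic function of \<open>g\<close> is an
  upper bound on that of \<open>f\<close>, which is therefore constant. Inversions are excluded in
  this way.\<close>

theorem conformal_bijection_similarity:
  fixes f g :: "'a::euclidean_space \<Rightarrow> 'a"
  assumes f: "smooth f" and g: "smooth g" and gf: "\<And>x. g (f x) = x" and fg: "\<And>y. f (g y) = y"
    and conf: "\<And>x v w. dird v f x \<bullet> dird w f x = \<mu> x * (v \<bullet> w)" and pos: "\<And>x. 0 < \<mu> x"
    and dim: "3 \<le> DIM('a)"
  obtains l A t where "0 < l" "orthogonal_transformation A" "\<And>x. f x = l *\<^sub>R A x + t"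
proof -
  interpret f: conformal_map f \<mu> by unfold_locales (fact f conf pos dim)+
  have chain: "dird (dird v g y) f (g y) = v" for v y
  proof -
    have "(f \<circ> g has_derivative (\<lambda>v. dird v f (g y)) \<circ> (\<lambda>v. dird v g y)) (at y)"
      by (intro diff_chain_at smooth_has_derivative f g)
    then have "dird v (f \<circ> g) y = dird (dird v g y) f (g y)" by (simp add: dird_eqI)
    moreover have "f \<circ> g = (\<lambda>x. x)" using fg by auto
    moreover have "dird v (\<lambda>x. x) y = v" by (rule dird_eqI[OF has_derivative_ident])
    ultimately show ?thesis by simp
  qed
  have gconf: "dird v g y \<bullet> dird w g y = inverse (\<mu> (g y)) * (v \<bullet> w)" for y v w
    using conf[of "dird v g y" "g y" "dird w g y"] pos[of "g y"] unfolding chain by (simp add: field_simps)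
  interpret g: conformal_map g "\<lambda>y. inverse (\<mu> (g y))"
    by unfold_locales (use g gconf pos dim in auto)
  obtain m where m: "0 < m" "\<And>y. m \<le> g.\<rho> y" using g.rho_bounded_below by blast
  have "f.\<rho> x \<le> 1 / m" for x
  proof -
    have "g.\<rho> (f x) * f.\<rho> x = 1" using pos[of x] by (simp add: g.\<rho>_def f.\<rho>_def gf real_sqrt_inverse)
    moreover have "m * f.\<rho> x \<le> g.\<rho> (f x) * f.\<rho> x" using m(2) f.rho_pos[of x] by (intro mult_right_mono) auto
    ultimately show ?thesis using m(1) by (simp add: field_simps)
  qed
  then have const: "f.\<rho> x = f.\<rho> 0" for x by (rule f.rho_constant)
  define l where "l = inverse (f.\<rho> 0)"
  have l: "0 < l" using f.rho_pos by (simp add: l_def)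
  have mu: "\<mu> x = l ^ 2" for x
    using const[of x] pos[of x] by (simp add: l_def f.\<rho>_def)
  have nf: "norm (dird v f x) = l * norm v" for v x
  proof -
    have "norm (dird v f x) ^ 2 = (l * norm v) ^ 2"
      using conf[of v x v] by (simp add: mu power_mult_distrib power2_norm_eq_inner)
    then show ?thesis using l by (simp add: power2_eq_iff_nonneg)
  qed
  have ng: "norm (dird v g y) = inverse l * norm v" for v y
    using nf[of "dird v g y" "g y"] l by (simp add: chain field_simps)
  \<comment> \<open>The mean value inequality for \<open>f\<close> and the one for \<open>g\<close>
    together give an exact scaling of distances.\<close>
  have "norm (f x - f y) \<le> l * norm (x - y)" for x y
    by (rule differentiable_bound[of UNIV f "\<lambda>x v. dird v f x"])
       (auto intro!: onorm_le smooth_has_derivative f simp: nf)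
  moreover have "norm (g x - g y) \<le> inverse l * norm (x - y)" for x y
    by (rule differentiable_bound[of UNIV g "\<lambda>x v. dird v g x"])
       (auto intro!: onorm_le smooth_has_derivative g simp: ng)
  from this[of "f _" "f _"] have "l * norm (x - y) \<le> norm (f x - f y)" for x y
    using l by (simp add: gf field_simps)
  ultimately have iso: "norm (f x - f y) = l * norm (x - y)" for x y by (simp add: antisym)
  define A where "A x = inverse l *\<^sub>R (f x - f 0)" for x
  have "dist (A x) (A y) = dist x y" for x y
  proof -
    have "A x - A y = inverse l *\<^sub>R (f x - f y)" by (simp add: A_def scaleR_diff_right)
    then show ?thesis using l by (simp add: dist_norm iso)
  qed
  then have "orthogonal_transformation A"
    unfolding orthogonal_transformation_isometry by (simp add: A_def)
  moreover have "f x = l *\<^sub>R A x + f 0" for x using l by (simp add: A_def)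
  ultimately show thesis using that l by blast
qed

subsection \<open>Stereographic projection and conformal transformations of the sphere\<close>

text \<open>Inverses of rotations appear throughout as \<open>transpose P *v x\<close>, which
  simplification would turn into a vector-matrix product.\<close>

declare transpose_matrix_vector [simp del]

lemma join_vec_inner: "join_vec a b \<bullet> join_vec c d = a \<bullet> c + b \<bullet> d"
proof -
  have "join_vec a b \<bullet> join_vec c d = (\<Sum>i\<in>UNIV <+> UNIV. join_vec a b $ i \<bullet> join_vec c d $ i)"
    by (simp add: inner_vec_def UNIV_Plus_UNIV)
  also have "\<dots> = a \<bullet> c + b \<bullet> d"
    by (subst sum.Plus) (simp_all add: inner_vec_def join_vec_def)
  finally show ?thesis .
qed

lemma join_vec_add: "join_vec a b + join_vec c d = join_vec (a + c) (b + d)"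
  and join_vec_scaleR: "r *\<^sub>R join_vec a b = join_vec (r *\<^sub>R a) (r *\<^sub>R b)"
  by (auto simp: vec_eq_iff join_vec_def split: sum.splits)

lemma join_vec_split:
  fixes x :: "real ^ ('n::finite + 1)"
  shows "x = join_vec (\<chi> i. x $ Inl i) (vec (x $ Inr 1))"
  by (auto simp: vec_eq_iff join_vec_def split: sum.splits)

lemma has_derivative_join_vec:
  assumes "(f has_derivative f') (at x within S)" "(g has_derivative g') (at x within S)"
  shows "((\<lambda>x. join_vec (f x) (g x)) has_derivative (\<lambda>v. join_vec (f' v) (g' v))) (at x within S)"
proof -
  have "linear (\<lambda>p :: (real ^ 'b) \<times> (real ^ 'c). join_vec (fst p) (snd p))"
    by (intro linearI) (simp_all add: join_vec_add join_vec_scaleR)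
  then have "bounded_linear (\<lambda>p :: (real ^ 'b) \<times> (real ^ 'c). join_vec (fst p) (snd p))"
    by (simp add: linear_conv_bounded_linear)
  from bounded_linear.has_derivative[OF this has_derivative_Pair[OF assms]] show ?thesis by simp
qed

definition north :: "real ^ ('n::finite + 1)" where
  "north = join_vec 0 (vec 1)"

definition inv_stereo :: "real ^ 'n \<Rightarrow> real ^ ('n::finite + 1)" where
  "inv_stereo y = join_vec ((2 / (1 + y \<bullet> y)) *\<^sub>R y) (vec (1 - 2 / (1 + y \<bullet> y)))"

lemma vec1_inner: "(vec a :: real ^ 1) \<bullet> vec b = a * b"
  by (simp add: inner_vec_def)

lemma vec1_inner_one: "(1 :: real ^ 1) \<bullet> 1 = 1" "vec a \<bullet> (1 :: real ^ 1) = a"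
  by (simp_all add: inner_vec_def)

lemma one_plus_inner_pos: "0 < 1 + y \<bullet> (y :: 'a::real_inner)"
  by (simp add: add_pos_nonneg)

text \<open>On the unit sphere the left side is half the squared chordal distance. The case
  \<open>x = y\<close> shows that the values of \<open>inv_stereo\<close> have norm 1.\<close>

lemma inv_stereo_inner:
  "1 - inv_stereo x \<bullet> inv_stereo y = 2 * ((x - y) \<bullet> (x - y)) / ((1 + x \<bullet> x) * (1 + y \<bullet> y))"
proof -
  have nz: "1 + x \<bullet> x \<noteq> 0" "1 + y \<bullet> y \<noteq> 0" using one_plus_inner_pos[of x] one_plus_inner_pos[of y] by auto
  have "1 - inv_stereo x \<bullet> inv_stereo y =
     1 - (2 / (1 + x \<bullet> x) * (2 / (1 + y \<bullet> y)) * (x \<bullet> y) + (1 - 2 / (1 + x \<bullet> x)) * (1 - 2 / (1 + y \<bullet> y)))"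
    by (simp add: inv_stereo_def join_vec_inner vec1_inner vec1_inner_one)
  also have "\<dots> = (2 * (1 + y \<bullet> y) + 2 * (1 + x \<bullet> x) - 4 - 4 * (x \<bullet> y)) / ((1 + x \<bullet> x) * (1 + y \<bullet> y))"
    using nz by (simp add: divide_simps) (simp add: algebra_simps)
  also have "2 * (1 + y \<bullet> y) + 2 * (1 + x \<bullet> x) - 4 - 4 * (x \<bullet> y) = 2 * ((x - y) \<bullet> (x - y))"
    by (simp add: inner_diff_left inner_diff_right inner_commute)
  finally show ?thesis .
qed

lemma inv_stereo_sphere: "inv_stereo y \<in> round_sphere"
  using inv_stereo_inner[of y y] by (simp add: norm_eq_1)

lemma inv_stereo_Inr: "inv_stereo y $ Inr 1 = 1 - 2 / (1 + y \<bullet> y)"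
  by (simp add: inv_stereo_def join_vec_def)

lemma inv_stereo_Inr_neq: "inv_stereo y $ Inr 1 \<noteq> 1"
  using one_plus_inner_pos[of y] by (simp add: inv_stereo_Inr)

lemma stereographic_inv_stereo: "stereographic (inv_stereo y) = y"
  using one_plus_inner_pos[of y] by (simp add: stereographic_def vec_eq_iff inv_stereo_def join_vec_def)

lemma north_sphere: "north \<in> round_sphere"
  by (simp add: north_def norm_eq_1 join_vec_inner vec1_inner vec1_inner_one)

lemma north_Inr: "north $ Inr 1 = 1"
  by (simp add: north_def join_vec_def)

lemma eq_north_iff:
  assumes "x \<in> round_sphere"
  shows "x = north \<longleftrightarrow> x $ Inr 1 = 1"
proof
  assume 1: "x $ Inr 1 = 1"
  let ?u = "\<chi> i. x $ Inl i"
  have "x \<bullet> x = 1" using assms by (simp add: norm_eq_1)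
  also have "x = join_vec ?u (vec 1)" using join_vec_split[of x] 1 by simp
  finally have "?u \<bullet> ?u = 0" by (simp add: join_vec_inner vec1_inner vec1_inner_one)
  then have "?u = 0" by simp
  then show "x = north" using \<open>x = join_vec ?u (vec 1)\<close> by (simp add: north_def)
qed (simp add: north_Inr)

lemma inv_stereo_stereographic:
  assumes x: "x \<in> round_sphere" "x $ Inr 1 \<noteq> 1"
  shows "inv_stereo (stereographic x) = x"
proof -
  define u where "u = (\<chi> i. x $ Inl i)"
  define t where "t = x $ Inr 1"
  have xs: "x = join_vec u (vec t)" unfolding u_def t_def by (rule join_vec_split)
  have t1: "t \<noteq> 1" using x by (simp add: t_def)
  have "x \<bullet> x = 1" using x by (simp add: norm_eq_1)
  then have uu: "u \<bullet> u = 1 - t * t" unfolding xs by (simp add: join_vec_inner vec1_inner vec1_inner_one)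
  have s: "stereographic x = (1 / (1 - t)) *\<^sub>R u" by (simp add: stereographic_def u_def t_def vec_eq_iff)
  have "stereographic x \<bullet> stereographic x = (1 / (1 - t)) * (1 / (1 - t)) * (1 - t * t)"
    unfolding s by (simp add: uu)
  also have "1 - t * t = (1 - t) * (1 + t)" by (simp add: algebra_simps)
  also have "1 / (1 - t) * (1 / (1 - t)) * ((1 - t) * (1 + t)) = (1 + t) / (1 - t)" using t1 by simp
  finally have "1 + stereographic x \<bullet> stereographic x = 2 / (1 - t)" using t1 by (simp add: field_simps)
  then have q: "2 / (1 + stereographic x \<bullet> stereographic x) = 1 - t" using t1 by simp
  have "inv_stereo (stereographic x) = join_vec ((1 - t) *\<^sub>R ((1 / (1 - t)) *\<^sub>R u)) (vec (1 - (1 - t)))"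
    unfolding inv_stereo_def q unfolding s ..
  also have "\<dots> = x" using t1 by (subst xs) simp
  finally show ?thesis .
qed

lemma sphere_cases:
  assumes "x \<in> round_sphere"
  obtains "x = north" | y where "x = inv_stereo y"
  using assms eq_north_iff inv_stereo_stereographic by metis

lemma inv_stereo_neq_north: "inv_stereo y \<noteq> north"
  using inv_stereo_Inr_neq north_Inr by metis

lemma inv_stereo_inject: "inv_stereo x = inv_stereo y \<longleftrightarrow> x = y"
  using stereographic_inv_stereo by metis

lemma sphere_dist: "x \<in> round_sphere \<Longrightarrow> y \<in> round_sphere \<Longrightarrow> (dist x y)\<^sup>2 = 2 * (1 - x \<bullet> y)"
  unfolding dist_norm power2_norm_eq_inner by (simp add: norm_eq_1 inner_diff_left inner_diff_right inner_commute)

lemma dist_inv_stereo: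
  "dist (inv_stereo x) (inv_stereo y) = 2 * dist x y / (sqrt (1 + x \<bullet> x) * sqrt (1 + y \<bullet> y))"
proof -
  have "(dist (inv_stereo x) (inv_stereo y))\<^sup>2 = (2 * dist x y / (sqrt (1 + x \<bullet> x) * sqrt (1 + y \<bullet> y)))\<^sup>2"
    unfolding sphere_dist[OF inv_stereo_sphere inv_stereo_sphere] inv_stereo_inner
    by (simp add: power_divide power_mult_distrib real_sqrt_pow2 add_nonneg_nonneg dist_norm power2_norm_eq_inner)
  then show ?thesis by (rule power2_eq_imp_eq) (auto intro!: divide_nonneg_nonneg)
qed

text \<open>Keeps one of the two denominators: the gain for large \<open>x\<close> compensates the
  linear growth of the difference of two similarities in \<open>similarity_close\<close>.\<close>

lemma dist_inv_stereo_le: "dist (inv_stereo x) (inv_stereo y) \<le> 2 * dist x y / sqrt (1 + x \<bullet> x)"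
proof -
  have "sqrt (1 + x \<bullet> x) * 1 \<le> sqrt (1 + x \<bullet> x) * sqrt (1 + y \<bullet> y)"
    by (intro mult_left_mono) auto
  then show ?thesis unfolding dist_inv_stereo
    using one_plus_inner_pos[of x] one_plus_inner_pos[of y]
    by (intro divide_left_mono) (auto intro!: mult_pos_pos)
qed

lemma dist_inv_stereo_le_two: "dist (inv_stereo x) (inv_stereo y) \<le> 2 * dist x y"
proof -
  have "2 * dist x y / sqrt (1 + x \<bullet> x) \<le> 2 * dist x y / 1"
    using one_plus_inner_pos[of x] by (intro divide_left_mono) auto
  then show ?thesis using dist_inv_stereo_le[of x y] by simp
qed

lemma dist_inv_stereo_north: "dist (inv_stereo y) north = 2 / sqrt (1 + y \<bullet> y)"
proof -
  have "inv_stereo y \<bullet> north = 1 - 2 / (1 + y \<bullet> y)"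
    by (simp add: inv_stereo_def north_def join_vec_inner vec1_inner vec1_inner_one)
  then have "(dist (inv_stereo y) north)\<^sup>2 = (2 / sqrt (1 + y \<bullet> y))\<^sup>2"
    unfolding sphere_dist[OF inv_stereo_sphere north_sphere]
    by (simp add: power_divide add_nonneg_nonneg)
  then show ?thesis by (rule power2_eq_imp_eq) auto
qed

lemma inv_stereo_has_derivative:
  "(inv_stereo has_derivative (\<lambda>v. join_vec ((2 / (1 + y \<bullet> y)) *\<^sub>R v - (4 * (y \<bullet> v) / (1 + y \<bullet> y)\<^sup>2) *\<^sub>R y)
      (vec (4 * (y \<bullet> v) / (1 + y \<bullet> y)\<^sup>2)))) (at y)"
proof -
  have nz: "1 + y \<bullet> y \<noteq> 0" using one_plus_inner_pos[of y] by simp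
  have d: "((\<lambda>y. 2 / (1 + y \<bullet> y)) has_derivative (\<lambda>v. - (4 * (y \<bullet> v) / (1 + y \<bullet> y)\<^sup>2))) (at y)"
    by (rule has_derivative_eq_rhs, rule has_derivative_divide, rule has_derivative_const,
        rule has_derivative_add, rule has_derivative_const, rule has_derivative_inner)
       (use nz in \<open>auto intro!: derivative_eq_intros simp: fun_eq_iff power2_eq_square inner_commute divide_simps\<close>)
  have e: "((\<lambda>y. vec (1 - 2 / (1 + y \<bullet> y)) :: real ^ 1) has_derivative (\<lambda>v. vec (4 * (y \<bullet> v) / (1 + y \<bullet> y)\<^sup>2))) (at y)"
  proof -
    have "bounded_linear (vec :: real \<Rightarrow> real ^ 1)"
      by (simp add: linear_conv_bounded_linear[symmetric])
    moreover have "((\<lambda>y. 1 - 2 / (1 + y \<bullet> y)) has_derivative (\<lambda>v. 4 * (y \<bullet> v) / (1 + y \<bullet> y)\<^sup>2)) (at y)"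
      using has_derivative_diff[OF has_derivative_const d, of 1] by simp
    ultimately show ?thesis by (rule bounded_linear.has_derivative)
  qed
  have "((\<lambda>y. (2 / (1 + y \<bullet> y)) *\<^sub>R y) has_derivative
      (\<lambda>v. (2 / (1 + y \<bullet> y)) *\<^sub>R v - (4 * (y \<bullet> v) / (1 + y \<bullet> y)\<^sup>2) *\<^sub>R y)) (at y)"
    using has_derivative_scaleR[OF d has_derivative_ident] by simp
  from has_derivative_join_vec[OF this e] show ?thesis
    by (simp add: inv_stereo_def[abs_def])
qed

section \<open>Rotated stereographic charts of the sphere\<close>

lemma rotation_matrix_transpose:
  fixes P :: "real ^ 'n ^ 'n"
  shows "rotation_matrix P \<Longrightarrow> rotation_matrix (transpose P)"
  by (simp add: rotation_matrix_def orthogonal_matrix_transpose det_transpose)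

lemma rotation_matrix_cancel:
  fixes P :: "real ^ 'n ^ 'n"
  assumes "rotation_matrix P"
  shows "transpose P *v (P *v x) = x" "P *v (transpose P *v x) = x"
  using assms unfolding rotation_matrix_def orthogonal_matrix_def
  by (simp_all add: matrix_vector_mul_assoc matrix_vector_mul_lid)

lemma rotation_matrix_inner:
  fixes P :: "real ^ 'n ^ 'n"
  assumes P: "rotation_matrix P"
  shows "(P *v x) \<bullet> (P *v y) = x \<bullet> y"
proof -
  have "(P *v x) \<bullet> (P *v y) = ((P *v x) v* P) \<bullet> y" by (rule dot_lmul_matrix[symmetric])
  also have "(P *v x) v* P = x"
    using rotation_matrix_cancel(1)[OF P, of x] by (simp only: transpose_matrix_vector)
  finally show ?thesis .
qed

lemma rotation_matrix_norm:
  fixes P :: "real ^ 'n ^ 'n"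
  shows "rotation_matrix P \<Longrightarrow> norm (P *v x) = norm x"
  by (simp add: norm_eq_sqrt_inner rotation_matrix_inner)

lemma rotation_matrix_sphere:
  fixes P :: "real ^ 'n ^ 'n"
  shows "rotation_matrix P \<Longrightarrow> P *v x \<in> sphere 0 1 \<longleftrightarrow> x \<in> sphere 0 1"
  by (simp add: rotation_matrix_norm)

definition sphere_chart :: "real ^ ('n + 1) ^ ('n + 1) \<Rightarrow> (real ^ ('n::finite + 1), 'n) chart" where
  "sphere_chart P = ({x \<in> round_sphere. (P *v x) $ Inr 1 \<noteq> 1}, \<lambda>x. stereographic (P *v x))"

lemma sphere_chart_atlas: "rotation_matrix P \<Longrightarrow> sphere_chart P \<in> sphere_atlas"
  by (auto simp: sphere_chart_def sphere_atlas_def)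

lemma inv_sphere_chart:
  assumes "rotation_matrix P"
  shows "inv_into (fst (sphere_chart P)) (snd (sphere_chart P)) = (\<lambda>y. transpose P *v inv_stereo y)"
proof
  fix y
  have "inj_on (snd (sphere_chart P)) (fst (sphere_chart P))"
  proof (rule inj_on_inverseI[where g="\<lambda>y. transpose P *v inv_stereo y"])
    fix x assume "x \<in> fst (sphere_chart P)"
    then have "P *v x \<in> round_sphere" "(P *v x) $ Inr 1 \<noteq> 1"
      using rotation_matrix_sphere[OF assms] by (auto simp: sphere_chart_def)
    then show "transpose P *v inv_stereo (snd (sphere_chart P) x) = x"
      by (simp add: sphere_chart_def inv_stereo_stereographic rotation_matrix_cancel[OF assms])
  qed
  then show "inv_into (fst (sphere_chart P)) (snd (sphere_chart P)) y = transpose P *v inv_stereo y"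
    using rotation_matrix_sphere[OF rotation_matrix_transpose[OF assms], of "inv_stereo y"]
    by (intro inv_into_f_eq)
       (auto simp: sphere_chart_def rotation_matrix_cancel[OF assms] inv_stereo_Inr_neq
         stereographic_inv_stereo inv_stereo_sphere[simplified])
qed

text \<open>The differential of \<open>inv_stereo\<close> is a multiple of an isometric embedding:
  in the inner product the contributions along \<open>y\<close> cancel against those of the last
  coordinate.\<close>

lemma round_metric_chart:
  fixes P :: "real ^ ('n + 1) ^ ('n::finite + 1)"
  assumes "rotation_matrix P" and y: "snd (sphere_chart P) x = y"
  shows "round_metric (sphere_chart P) x v w = (2 / (1 + y \<bullet> y))\<^sup>2 * (v \<bullet> w)"
proof -
  define L where "L v = join_vec ((2 / (1 + y \<bullet> y)) *\<^sub>R v - (4 * (y \<bullet> v) / (1 + y \<bullet> y)\<^sup>2) *\<^sub>R y)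
      (vec (4 * (y \<bullet> v) / (1 + y \<bullet> y)\<^sup>2) :: real ^ 1)" for v
  have d: "((\<lambda>y. transpose P *v inv_stereo y) has_derivative (\<lambda>v. transpose P *v L v)) (at y)"
    unfolding L_def
    by (rule bounded_linear.has_derivative[OF matrix_vector_mul_bounded_linear inv_stereo_has_derivative])
  have "round_metric (sphere_chart P) x v w = L v \<bullet> L w"
    unfolding round_metric_def inv_sphere_chart[OF assms(1)] y
    by (simp add: Let_def rotation_matrix_inner rotation_matrix_transpose assms(1) frechet_derivative_at[OF d, symmetric])
  also have "\<dots> = (2 / (1 + y \<bullet> y))\<^sup>2 * (v \<bullet> w)"
  proof -
    define s where "s = 1 + y \<bullet> y"
    have s: "s \<noteq> 0" "y \<bullet> y = s - 1" using one_plus_inner_pos[of y] by (auto simp: s_def)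
    have "L v \<bullet> L w = (2 / s) * (2 / s) * (v \<bullet> w) - (2 / s) * (4 * (y \<bullet> w) / s\<^sup>2) * (y \<bullet> v)
        - (4 * (y \<bullet> v) / s\<^sup>2) * (2 / s) * (y \<bullet> w) + (4 * (y \<bullet> v) / s\<^sup>2) * (4 * (y \<bullet> w) / s\<^sup>2) * (s - 1)
        + (4 * (y \<bullet> v) / s\<^sup>2) * (4 * (y \<bullet> w) / s\<^sup>2)"
    proof -
      have "(\<alpha> *\<^sub>R v - \<beta> *\<^sub>R y) \<bullet> (\<alpha> *\<^sub>R w - \<gamma> *\<^sub>R y) = \<alpha> * \<alpha> * (v \<bullet> w) - \<alpha> * \<gamma> * (y \<bullet> v) - \<beta> * \<alpha> * (y \<bullet> w) + \<beta> * \<gamma> * (s - 1)"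
        for \<alpha> \<beta> \<gamma>
        by (simp add: inner_diff_left inner_diff_right s(2) inner_commute[of v y] algebra_simps)
      then show ?thesis unfolding L_def join_vec_inner vec1_inner s_def[symmetric] by simp
    qed
    also have "\<dots> = (2 / s)\<^sup>2 * (v \<bullet> w)"
      using s(1) by (simp add: divide_simps power2_eq_square) (simp add: algebra_simps)
    finally show ?thesis by (simp add: s_def)
  qed
  finally show ?thesis .
qed

text \<open>The source chart is indexed by \<open>transpose Q\<close> so that its inverse is
  \<open>inv_stereo\<close> followed by \<open>Q\<close>.\<close>

lemma local_rep_sphere:
  assumes "rotation_matrix Q"
  shows "local_rep (sphere_chart (transpose Q)) (sphere_chart P) a
     = (\<lambda>y. stereographic (P *v a (Q *v inv_stereo y)))"
  unfolding local_rep_def inv_sphere_chart[OF rotation_matrix_transpose[OF assms]]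
  by (simp add: sphere_chart_def comp_def transpose_transpose)

text \<open>By \<open>N\<close>, the point missing from the source chart goes to the point missing
  from the target chart. Hence the coordinate expression of \<open>a\<close> lives on all of
  Euclidean space, as the global form of Liouville's theorem requires.\<close>

lemma chart_domain:
  fixes a :: "real ^ ('n::finite + 1) \<Rightarrow> real ^ ('n + 1)"
  assumes P: "rotation_matrix P" and Q: "rotation_matrix Q"
    and a: "bij_betw a round_sphere round_sphere" and N: "P *v a (Q *v north) = north"
  shows "a (Q *v inv_stereo y) \<in> round_sphere" "(P *v a (Q *v inv_stereo y)) $ Inr 1 \<noteq> 1"
    "Q *v inv_stereo y \<in> {x \<in> round_sphere \<inter> fst (sphere_chart (transpose Q)). a x \<in> fst (sphere_chart P)}"
    "snd (sphere_chart (transpose Q)) (Q *v inv_stereo y) = y"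
proof -
  have S: "Q *v inv_stereo y \<in> round_sphere" "Q *v north \<in> round_sphere"
    using rotation_matrix_sphere[OF Q] inv_stereo_sphere north_sphere by blast+
  show aS: "a (Q *v inv_stereo y) \<in> round_sphere" using a S by (metis bij_betwE)
  show nP: "(P *v a (Q *v inv_stereo y)) $ Inr 1 \<noteq> 1"
  proof
    assume "(P *v a (Q *v inv_stereo y)) $ Inr 1 = 1"
    then have "P *v a (Q *v inv_stereo y) = P *v a (Q *v north)"
      using eq_north_iff[of "P *v a (Q *v inv_stereo y)"] aS rotation_matrix_sphere[OF P] N by metis
    then have "a (Q *v inv_stereo y) = a (Q *v north)" using rotation_matrix_cancel[OF P] by metis
    then have "Q *v inv_stereo y = Q *v north" using a S by (meson bij_betw_def inj_onD)
    then have "inv_stereo y = north" using rotation_matrix_cancel[OF Q] by metis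
    then show False using inv_stereo_neq_north by blast
  qed
  show "Q *v inv_stereo y \<in> {x \<in> round_sphere \<inter> fst (sphere_chart (transpose Q)). a x \<in> fst (sphere_chart P)}"
    using S aS nP by (simp add: sphere_chart_def rotation_matrix_cancel[OF Q] inv_stereo_Inr_neq)
  show "snd (sphere_chart (transpose Q)) (Q *v inv_stereo y) = y"
    by (simp add: sphere_chart_def rotation_matrix_cancel[OF Q] stereographic_inv_stereo)
qed

text \<open>In the two charts \<open>a\<close> and its inverse become mutually inverse smooth maps
  \<open>F\<close> and \<open>G\<close> of Euclidean space, to which
  \<open>conformal_bijection_similarity\<close> applies. Separate rotations before and after allow
  infinity to be placed at any point and at its image.\<close>

proposition Conf_plus_similarity:
  fixes a :: "real ^ ('n::finite + 1) \<Rightarrow> real ^ ('n + 1)"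
  assumes a: "a \<in> carrier Conf_plus" and P: "rotation_matrix P" and Q: "rotation_matrix Q"
    and N: "P *v a (Q *v north) = north" and dim: "3 \<le> CARD('n)"
  obtains l A t where "0 < l" "orthogonal_transformation A"
    "\<And>y. P *v a (Q *v inv_stereo y) = inv_stereo (l *\<^sub>R A y + t)"
proof -
  let ?S = "round_sphere :: (real ^ ('n + 1)) set"
  let ?b = "inv_into ?S a" and ?c = "sphere_chart (transpose Q)" and ?d = "sphere_chart P"
  note P' = rotation_matrix_transpose[OF P] and Q' = rotation_matrix_transpose[OF Q]
  have diffeo: "conformal_diffeo ?S sphere_atlas round_metric ?S sphere_atlas round_metric a"
    using a by (simp add: Conf_plus_def)
  then have bij: "bij_betw a ?S ?S" and smap: "smooth_map_on ?S sphere_atlas sphere_atlas a"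
    and smap': "smooth_map_on ?S sphere_atlas sphere_atlas ?b"
    and conf: "conformal_on ?S sphere_atlas round_metric sphere_atlas round_metric a"
    by (auto simp: conformal_diffeo_def)
  have bij': "bij_betw ?b ?S ?S" using bij by (rule bij_betw_inv_into)
  have N': "transpose Q *v ?b (transpose P *v north) = north"
  proof -
    have "a (Q *v north) = transpose P *v north" using N rotation_matrix_cancel[OF P] by metis
    moreover have "Q *v north \<in> ?S" using rotation_matrix_sphere[OF Q] north_sphere by blast
    ultimately have "?b (transpose P *v north) = Q *v north"
      using bij by (metis bij_betw_inv_into_left)
    then show ?thesis using rotation_matrix_cancel[OF Q] by metis
  qed
  define F where "F y = stereographic (P *v a (Q *v inv_stereo y))" for y
  define G where "G y = stereographic (transpose Q *v ?b (transpose P *v inv_stereo y))" for y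
  have F: "local_rep ?c ?d a = F" unfolding F_def[abs_def] by (rule local_rep_sphere[OF Q])
  have G: "local_rep ?d ?c ?b = G" unfolding G_def[abs_def]
    using local_rep_sphere[OF P', of "transpose Q" ?b] by simp
  have "snd ?c ` {x \<in> ?S \<inter> fst ?c. a x \<in> fst ?d} = UNIV"
    using chart_domain(3,4)[OF P Q bij N] by (metis (no_types, lifting) UNIV_eq_I image_eqI)
  moreover have "smooth_on (local_rep ?c ?d a) (snd ?c ` {x \<in> ?S \<inter> fst ?c. a x \<in> fst ?d})"
    using smap sphere_chart_atlas[OF Q'] sphere_chart_atlas[OF P] unfolding smooth_map_on_def by blast
  ultimately have sF: "smooth F" by (simp only: F)
  have "snd ?d ` {x \<in> ?S \<inter> fst ?d. ?b x \<in> fst ?c} = UNIV"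
    using chart_domain(3,4)[OF Q' P' bij' N'] unfolding transpose_transpose
    by (metis (no_types, lifting) UNIV_eq_I image_eqI)
  moreover have "smooth_on (local_rep ?d ?c ?b) (snd ?d ` {x \<in> ?S \<inter> fst ?d. ?b x \<in> fst ?c})"
    using smap' sphere_chart_atlas[OF Q'] sphere_chart_atlas[OF P] unfolding smooth_map_on_def by blast
  ultimately have sG: "smooth G" by (simp only: G)
  have Feq: "P *v a (Q *v inv_stereo y) = inv_stereo (F y)" for y
    unfolding F_def using chart_domain(1,2)[OF P Q bij N, of y] rotation_matrix_sphere[OF P]
    by (metis inv_stereo_stereographic)
  have Geq: "transpose Q *v ?b (transpose P *v inv_stereo y) = inv_stereo (G y)" for y
    unfolding G_def using chart_domain(1,2)[OF Q' P' bij' N', of y] rotation_matrix_sphere[OF Q']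
    by (metis inv_stereo_stereographic)
  have SQ: "Q *v inv_stereo y \<in> ?S" "transpose P *v inv_stereo y \<in> ?S" for y
    using rotation_matrix_sphere[OF Q] rotation_matrix_sphere[OF P'] inv_stereo_sphere by blast+
  have GF: "G (F y) = y" for y
  proof -
    have "inv_stereo (G (F y)) = transpose Q *v ?b (a (Q *v inv_stereo y))"
      unfolding Geq[symmetric] Feq[symmetric] rotation_matrix_cancel[OF P] ..
    also have "\<dots> = inv_stereo y"
      using bij_betw_inv_into_left[OF bij SQ(1)] rotation_matrix_cancel[OF Q] by simp
    finally show ?thesis by (simp add: inv_stereo_inject)
  qed
  have FG: "F (G y) = y" for y
  proof -
    have "inv_stereo (F (G y)) = P *v a (?b (transpose P *v inv_stereo y))"
      unfolding Feq[symmetric] Geq[symmetric] rotation_matrix_cancel[OF Q] ..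
    also have "\<dots> = inv_stereo y"
      using bij_betw_inv_into_right[OF bij SQ(2)] rotation_matrix_cancel[OF P] by simp
    finally show ?thesis by (simp add: inv_stereo_inject)
  qed
  obtain \<mu> where \<mu>: "\<forall>x\<in>?S. 0 < \<mu> x \<and> (\<forall>c\<in>sphere_atlas. \<forall>d\<in>sphere_atlas. x \<in> fst c \<and> a x \<in> fst d \<longrightarrow>
     (\<forall>v w. round_metric d (a x) (local_deriv c d a x v) (local_deriv c d a x w) = \<mu> x * round_metric c x v w))"
    using conf unfolding conformal_on_def by blast
  \<comment> \<open>The factor \<mu> is relative to the round metric; it is corrected by the
    conformal factors of the source chart at \<open>y\<close> and of the target chart at
    \<open>F y\<close>.\<close>
  define \<nu> where "\<nu> y = \<mu> (Q *v inv_stereo y) * (2 / (1 + y \<bullet> y))\<^sup>2 / (2 / (1 + F y \<bullet> F y))\<^sup>2" for y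
  have \<nu>pos: "0 < \<nu> y" for y
    using \<mu> SQ(1)[of y] one_plus_inner_pos[of y] one_plus_inner_pos[of "F y"] by (simp add: \<nu>_def)
  have Fconf: "dird v F y \<bullet> dird w F y = \<nu> y * (v \<bullet> w)" for y v w
  proof -
    let ?x = "Q *v inv_stereo y"
    have x: "?x \<in> ?S" "?x \<in> fst ?c" "a ?x \<in> fst ?d" "snd ?c ?x = y"
      using chart_domain(3,4)[OF P Q bij N, of y] by auto
    have ld: "local_deriv ?c ?d a ?x v = dird v F y" for v
      by (simp add: local_deriv_def F x(4) dird_def)
    have Fy: "snd ?d (a ?x) = F y" by (simp add: sphere_chart_def F_def)
    have "round_metric ?d (a ?x) (local_deriv ?c ?d a ?x v) (local_deriv ?c ?d a ?x w) = \<mu> ?x * round_metric ?c ?x v w"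
      using \<mu> x sphere_chart_atlas[OF Q'] sphere_chart_atlas[OF P] by blast
    then have "(2 / (1 + F y \<bullet> F y))\<^sup>2 * (dird v F y \<bullet> dird w F y) = \<mu> ?x * ((2 / (1 + y \<bullet> y))\<^sup>2 * (v \<bullet> w))"
      unfolding ld round_metric_chart[OF P Fy] round_metric_chart[OF Q' x(4)] .
    moreover have "(2 / (1 + F y \<bullet> F y))\<^sup>2 \<noteq> 0" using one_plus_inner_pos[of "F y"] by simp
    ultimately show ?thesis unfolding \<nu>_def
      by (metis (no_types, lifting) mult.assoc nonzero_mult_div_cancel_left times_divide_eq_left)
  qed
  have "3 \<le> DIM(real ^ 'n)" using dim by simp
  from conformal_bijection_similarity[OF sF sG GF FG Fconf \<nu>pos this]
  obtain l A t where "0 < l" "orthogonal_transformation A" "\<And>x. F x = l *\<^sub>R A x + t" by metis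
  then show thesis using that Feq by metis
qed

subsection \<open>Lifting to covering spaces\<close>

text \<open>
  The lifting lemmas of the library require normed spaces; here all spaces are topological.
\<close>

lemma covering_space_sheets:
  assumes "covering_space C p S" and "y \<in> S"
  obtains V \<V> where "y \<in> V" "openin (top_of_set S) V" "\<Union>\<V> = C \<inter> p -` V"
    "\<forall>u\<in>\<V>. openin (top_of_set C) u" "pairwise disjnt \<V>"
    "\<forall>u\<in>\<V>. \<exists>q. homeomorphism u V p q"
proof -
  have "\<exists>V. y \<in> V \<and> openin (top_of_set S) V \<and>
      (\<exists>\<V>. \<Union>\<V> = C \<inter> p -` V \<and> (\<forall>u\<in>\<V>. openin (top_of_set C) u) \<and>
        pairwise disjnt \<V> \<and> (\<forall>u\<in>\<V>. \<exists>q. homeomorphism u V p q))"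
    using assms by (simp add: covering_space_def)
  then show thesis using that by (elim exE conjE) (rule that; blast)
qed

text \<open>The set of agreement is open because \<open>p\<close> is injective on a sheet, and
  closed because different sheets are disjoint.\<close>

lemma covering_lift_unique:
  fixes f1 f2 :: "'u::topological_space \<Rightarrow> 'c::topological_space"
    and p :: "'c \<Rightarrow> 'b::topological_space"
  assumes cov: "covering_space C p S" and T: "connected T"
    and f1: "continuous_on T f1" "f1 ` T \<subseteq> C" and f2: "continuous_on T f2" "f2 ` T \<subseteq> C"
    and eq: "\<And>x. x \<in> T \<Longrightarrow> p (f1 x) = p (f2 x)"
    and a: "a \<in> T" "f1 a = f2 a" and x: "x \<in> T"
  shows "f1 x = f2 x"
proof -
  define E where "E = {x \<in> T. f1 x = f2 x}"
  have loc: "\<exists>W. openin (top_of_set T) W \<and> x \<in> W \<and> (f1 x = f2 x \<longrightarrow> W \<subseteq> E) \<and> (f1 x \<noteq> f2 x \<longrightarrow> W \<subseteq> T - E)"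
    if "x \<in> T" for x
  proof -
    have "p (f1 x) \<in> S" using that f1(2) cov covering_space_imp_surjective by blast
    then obtain V \<V> where V: "p (f1 x) \<in> V" "openin (top_of_set S) V" "\<Union>\<V> = C \<inter> p -` V"
      "\<forall>u\<in>\<V>. openin (top_of_set C) u" "pairwise disjnt \<V>"
      "\<forall>u\<in>\<V>. \<exists>q. homeomorphism u V p q"
      by (rule covering_space_sheets[OF cov])
    have "f1 x \<in> \<Union>\<V>" "f2 x \<in> \<Union>\<V>" using V(1,3) that f1(2) f2(2) eq[OF that] by auto
    then obtain u1 u2 where u: "u1 \<in> \<V>" "u2 \<in> \<V>" "f1 x \<in> u1" "f2 x \<in> u2" by blast
    define W where "W = (T \<inter> f1 -` u1) \<inter> (T \<inter> f2 -` u2)"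
    have W: "openin (top_of_set T) W" unfolding W_def
      by (intro openin_Int continuous_openin_preimage[where T=C] f1 f2 bspec[OF V(4)] u(1,2))
         (use f1(2) f2(2) in auto)
    have xW: "x \<in> W" using that u by (auto simp: W_def)
    show ?thesis
    proof (cases "u1 = u2")
      case True
      obtain q where "homeomorphism u1 V p q" using V(6) u by blast
      then have "inj_on p u1" by (metis homeomorphism_def inj_on_inverseI)
      then have "W \<subseteq> E" using eq True by (auto simp: W_def E_def inj_on_def)
      moreover have "f1 x = f2 x" using \<open>W \<subseteq> E\<close> xW by (auto simp: E_def)
      ultimately show ?thesis using W xW by auto
    next
      case False
      then have "u1 \<inter> u2 = {}" using V(5) u by (auto simp: pairwise_def disjnt_def)
      then have "W \<subseteq> T - E" by (auto simp: W_def E_def)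
      moreover have "f1 x \<noteq> f2 x" using \<open>W \<subseteq> T - E\<close> xW that by (auto simp: E_def)
      ultimately show ?thesis using W xW by auto
    qed
  qed
  have "\<exists>W. openin (top_of_set T) W \<and> x \<in> W \<and> W \<subseteq> E" if "x \<in> E" for x
  proof -
    have "x \<in> T" "f1 x = f2 x" using that by (auto simp: E_def)
    then show ?thesis using loc[of x] by simp
  qed
  then have "openin (top_of_set T) E" by (subst openin_subopen) blast
  moreover have "\<exists>W. openin (top_of_set T) W \<and> x \<in> W \<and> W \<subseteq> T - E" if "x \<in> T - E" for x
  proof -
    have "x \<in> T" "f1 x \<noteq> f2 x" using that by (auto simp: E_def)
    then show ?thesis using loc[of x] by simp
  qed
  then have "openin (top_of_set T) (T - E)" by (subst openin_subopen) blast
  then have "closedin (top_of_set T) E"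
    by (simp add: closedin_def) (auto simp: E_def)
  ultimately have "E = {} \<or> E = T" using T connected_clopen by blast
  then show ?thesis using a x by (auto simp: E_def)
qed

text \<open>The base point \<open>z\<close> and the point \<open>e\<close> over it are arbitrary, so
  that a lift on one piece can be continued on another from any common point.\<close>

definition liftable :: "'c::topological_space set \<Rightarrow> ('c \<Rightarrow> 'b) \<Rightarrow> ('u::topological_space \<Rightarrow> 'b) \<Rightarrow> 'u set \<Rightarrow> bool" where
  "liftable C p h R \<longleftrightarrow> (\<forall>z\<in>R. \<forall>e\<in>C. p e = h z \<longrightarrow>
     (\<exists>k. continuous_on R k \<and> k ` R \<subseteq> C \<and> k z = e \<and> (\<forall>y\<in>R. p (k y) = h y)))"

text \<open>Two lifts agreeing at one point of the overlap agree on all of it, by connectedness, and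
  are pasted along closed sets.\<close>

lemma liftable_Un:
  fixes h :: "'u::topological_space \<Rightarrow> 'b::topological_space"
  assumes cov: "covering_space C p S" and l: "liftable C p h R1" "liftable C p h R2"
    and cl: "closed R1" "closed R2" and con: "connected (R1 \<inter> R2)" and ne: "R1 \<inter> R2 \<noteq> {}"
  shows "liftable C p h (R1 \<union> R2)"
proof -
  have *: "\<exists>k. continuous_on (A \<union> B) k \<and> k ` (A \<union> B) \<subseteq> C \<and> k z = e \<and> (\<forall>y\<in>A \<union> B. p (k y) = h y)"
    if l: "liftable C p h A" "liftable C p h B" and cl: "closed A" "closed B"
      and con: "connected (A \<inter> B)" and w: "w \<in> A \<inter> B" and z: "z \<in> A" "e \<in> C" "p e = h z" for A B z e w
  proof -
    obtain k1 where k1: "continuous_on A k1" "k1 ` A \<subseteq> C" "k1 z = e" "\<forall>y\<in>A. p (k1 y) = h y"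
      using l(1) z unfolding liftable_def by blast
    have "k1 w \<in> C" "p (k1 w) = h w" using k1 w by auto
    then obtain k2 where k2: "continuous_on B k2" "k2 ` B \<subseteq> C" "k2 w = k1 w" "\<forall>y\<in>B. p (k2 y) = h y"
      using l(2) w unfolding liftable_def by blast
    have eq: "k1 y = k2 y" if "y \<in> A \<inter> B" for y
      by (rule covering_lift_unique[OF cov con, where a=w])
         (use k1 k2 w that in \<open>auto intro: continuous_on_subset\<close>)
    let ?k = "\<lambda>y. if y \<in> A then k1 y else k2 y"
    have "continuous_on (A \<union> B) ?k"
      by (rule continuous_on_If) (use cl k1 k2 eq in auto)
    moreover have "?k ` (A \<union> B) \<subseteq> C" "?k z = e" "\<forall>y\<in>A \<union> B. p (?k y) = h y"
      using k1 k2 z by auto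
    ultimately show ?thesis by blast
  qed
  obtain w where w: "w \<in> R1 \<inter> R2" using ne by blast
  show ?thesis unfolding liftable_def
  proof (intro ballI impI)
    fix z e assume z: "z \<in> R1 \<union> R2" "e \<in> C" "p e = h z"
    show "\<exists>k. continuous_on (R1 \<union> R2) k \<and> k ` (R1 \<union> R2) \<subseteq> C \<and> k z = e \<and> (\<forall>y\<in>R1 \<union> R2. p (k y) = h y)"
    proof (cases "z \<in> R1")
      case True then show ?thesis using *[OF l cl con w True z(2,3)] by simp
    next
      case False
      then have "z \<in> R2" using z by blast
      from *[OF l(2,1) cl(2,1) _ _ this z(2,3)] con w show ?thesis by (simp add: Int_commute Un_commute)
    qed
  qed
qed

lemma liftable_local:
  fixes h :: "'u::topological_space \<Rightarrow> 'b::topological_space"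
  assumes cov: "covering_space C p S" and h: "continuous_on UNIV h" "range h \<subseteq> S"
  obtains O' where "open O'" "z \<in> O'" "\<And>R. R \<subseteq> O' \<Longrightarrow> liftable C p h R"
proof -
  have "h z \<in> S" using h(2) by blast
  then obtain V \<V> where V: "h z \<in> V" "openin (top_of_set S) V" "\<Union>\<V> = C \<inter> p -` V"
      "\<forall>u\<in>\<V>. openin (top_of_set C) u" "pairwise disjnt \<V>"
      "\<forall>u\<in>\<V>. \<exists>q. homeomorphism u V p q"
    by (rule covering_space_sheets[OF cov])
  have op: "open (h -` V)"
    using continuous_openin_preimage[OF h(1), of S V] V(2) h(2) by auto
  show thesis
  proof (rule that[OF op])
    show "z \<in> h -` V" using V by auto
    fix R assume R: "R \<subseteq> h -` V"
    show "liftable C p h R" unfolding liftable_def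
    proof (intro ballI impI)
      fix z e assume z: "z \<in> R" "e \<in> C" "p e = h z"
      then have "e \<in> \<Union>\<V>" using V R by auto
      then obtain u where u: "u \<in> \<V>" "e \<in> u" by blast
      then obtain q where q: "homeomorphism u V p q" using V by blast
      have "continuous_on R (q \<circ> h)"
        by (rule continuous_on_compose)
           (use h q R in \<open>auto simp: homeomorphism_def intro: continuous_on_subset\<close>)
      moreover have "(q \<circ> h) ` R \<subseteq> C" using q R V(3) u(1) by (force simp: homeomorphism_def)
      moreover have "(q \<circ> h) z = e" using q u z by (metis comp_apply homeomorphism_apply1)
      moreover have "\<forall>y\<in>R. p ((q \<circ> h) y) = h y" using q R by (auto simp: homeomorphism_def)
      ultimately show "\<exists>k. continuous_on R k \<and> k ` R \<subseteq> C \<and> k z = e \<and> (\<forall>y\<in>R. p (k y) = h y)" by blast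
    qed
  qed
qed

text \<open>Bisection in each coordinate takes the place of a Lebesgue number: first the pieces of a
  thin horizontal strip are glued, then the strips.\<close>

lemma liftable_square:
  fixes h :: "real \<times> real \<Rightarrow> 'b::topological_space"
  assumes cov: "covering_space C p S" and h: "continuous_on UNIV h" "range h \<subseteq> S"
  shows "liftable C p h ({0..1} \<times> {0..1})"
proof -
  \<comment> \<open>The admissible height \<delta> may depend on the interval; gluing two neighbours
    takes the smaller height. Requiring the strip to contain the level \<open>y\<close> keeps the
    overlaps nonempty.\<close>
  define Q where "Q y a b \<longleftrightarrow> (\<exists>\<delta>>0. \<forall>c d. c \<le> y \<and> y \<le> d \<and> d - c < \<delta> \<longrightarrow>
     liftable C p h ({a..b} \<times> {c..d}))" for y a b
  have Q: "Q y 0 1" for y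
  proof (rule Bolzano[where P="Q y"])
    fix a b c :: real assume "Q y a b" "Q y b c" and abc: "a \<le> b" "b \<le> c"
    then obtain \<delta>1 \<delta>2 where d: "\<delta>1 > 0" "\<delta>2 > 0"
      "\<forall>s t. s \<le> y \<and> y \<le> t \<and> t - s < \<delta>1 \<longrightarrow> liftable C p h ({a..b} \<times> {s..t})"
      "\<forall>s t. s \<le> y \<and> y \<le> t \<and> t - s < \<delta>2 \<longrightarrow> liftable C p h ({b..c} \<times> {s..t})"
      unfolding Q_def by blast
    have "liftable C p h ({a..c} \<times> {s..t})" if st: "s \<le> y" "y \<le> t" "t - s < min \<delta>1 \<delta>2" for s t
    proof -
      have int: "({a..b} \<times> {s..t}) \<inter> ({b..c} \<times> {s..t}) = {b} \<times> {s..t}" using abc by auto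
      have un: "({a..b} \<times> {s..t}) \<union> ({b..c} \<times> {s..t}) = {a..c} \<times> {s..t}" using abc by auto
      have "liftable C p h (({a..b} \<times> {s..t}) \<union> ({b..c} \<times> {s..t}))"
        by (rule liftable_Un[OF cov]) (use st d in \<open>auto simp: int closed_Times intro!: connected_Times\<close>)
      then show ?thesis by (simp only: un)
    qed
    then show "Q y a c" unfolding Q_def using d(1,2) by (intro exI[of _ "min \<delta>1 \<delta>2"]) auto
  next
    fix x :: real
    obtain O' where O': "open O'" "(x,y) \<in> O'" "\<And>R. R \<subseteq> O' \<Longrightarrow> liftable C p h R"
      using liftable_local[OF cov h, of "(x, y)"] by metis
    then obtain A B where AB: "open A" "open B" "x \<in> A" "y \<in> B" "A \<times> B \<subseteq> O'"
      by (metis open_prod_elim mem_Times_iff fst_conv snd_conv)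
    obtain e1 e2 where e: "e1 > 0" "ball x e1 \<subseteq> A" "e2 > 0" "ball y e2 \<subseteq> B"
      using AB by (meson open_contains_ball)
    have "Q y a b" if "a \<le> x" "x \<le> b" "b - a < e1" for a b
      unfolding Q_def
    proof (intro exI[of _ e2] conjI allI impI)
      fix c d assume cd: "c \<le> y \<and> y \<le> d \<and> d - c < e2"
      have "{a..b} \<subseteq> ball x e1" "{c..d} \<subseteq> ball y e2" using that cd by (auto simp: dist_real_def)
      then show "liftable C p h ({a..b} \<times> {c..d})" using O'(3) AB(5) e by (meson Sigma_mono subset_trans)
    qed (use e in auto)
    then show "\<exists>d>0. \<forall>a b. a \<le> x \<and> x \<le> b \<and> b - a < d \<longrightarrow> Q y a b" using e(1) by blast
  qed auto
  show ?thesis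
  proof (rule Bolzano[where P="\<lambda>c d. liftable C p h ({0..1} \<times> {c..d})"])
    fix a b c :: real assume *: "liftable C p h ({0..1} \<times> {a..b})" "liftable C p h ({0..1} \<times> {b..c})" and abc: "a \<le> b" "b \<le> c"
    have int: "({0..1::real} \<times> {a..b}) \<inter> ({0..1} \<times> {b..c}) = {0..1} \<times> {b}" using abc by auto
    have un: "({0..1::real} \<times> {a..b}) \<union> ({0..1} \<times> {b..c}) = {0..1} \<times> {a..c}" using abc by auto
    have "liftable C p h (({0..1} \<times> {a..b}) \<union> ({0..1} \<times> {b..c}))"
      by (rule liftable_Un[OF cov]) (use * in \<open>auto simp: int closed_Times intro!: connected_Times\<close>)
    then show "liftable C p h ({0..1} \<times> {a..c})" by (simp only: un)
  next
    fix y :: real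
    show "\<exists>d>0. \<forall>a b. a \<le> y \<and> y \<le> b \<and> b - a < d \<longrightarrow> liftable C p h ({0..1} \<times> {a..b})"
      using Q[of y] unfolding Q_def by blast
  qed auto
qed

lemma covering_lift_square:
  fixes h :: "real \<times> real \<Rightarrow> 'b::topological_space"
  assumes cov: "covering_space C p S" and h: "continuous_on ({0..1} \<times> {0..1}) h" "h ` ({0..1} \<times> {0..1}) \<subseteq> S"
    and e: "e \<in> C" "p e = h (0, 0)"
  obtains k where "continuous_on ({0..1} \<times> {0..1}) k" "k ` ({0..1} \<times> {0..1}) \<subseteq> C" "k (0, 0) = e"
    "\<forall>s\<in>{0..1}. \<forall>t\<in>{0..1}. p (k (s, t)) = h (s, t)"
proof -
  \<comment> \<open>Clamping retracts the plane onto the square and so extends \<open>h\<close> to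
    the whole plane, as \<open>liftable_square\<close> demands.\<close>
  define c :: "real \<Rightarrow> real" where "c t = max 0 (min 1 t)" for t
  define h' where "h' z = h (c (fst z), c (snd z))" for z
  have c: "c t \<in> {0..1}" for t by (auto simp: c_def)
  have c_id: "c t = t" if "t \<in> {0..1}" for t using that by (auto simp: c_def)
  have "continuous_on UNIV (\<lambda>z :: real \<times> real. (c (fst z), c (snd z)))"
    unfolding c_def by (intro continuous_intros)
  then have "continuous_on UNIV h'" unfolding h'_def
    by (rule continuous_on_compose2[OF h(1)]) (use c in auto)
  moreover have "range h' \<subseteq> S" using h(2) c by (auto simp: h'_def)
  ultimately have "liftable C p h' ({0..1} \<times> {0..1})" by (rule liftable_square[OF cov])
  moreover have "(0,0) \<in> {0..1::real} \<times> {0..1::real}" "p e = h' (0,0)" using e c_id by (auto simp: h'_def)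
  ultimately obtain k where "continuous_on ({0..1} \<times> {0..1}) k" "k ` ({0..1} \<times> {0..1}) \<subseteq> C" "k (0, 0) = e"
    "\<forall>y\<in>{0..1} \<times> {0..1}. p (k y) = h' y"
    using e(1) unfolding liftable_def by blast
  then show thesis by (intro that[of k]) (auto simp: h'_def c_id)
qed

section \<open>Lifting paths, loops and maps on simply connected spaces\<close>

lemma covering_lift_path:
  fixes g :: "real \<Rightarrow> 'b::topological_space"
  assumes cov: "covering_space C p S" and g: "path g" "path_image g \<subseteq> S" and e: "e \<in> C" "p e = pathstart g"
  obtains l where "path l" "path_image l \<subseteq> C" "pathstart l = e" "\<forall>t\<in>{0..1}. p (l t) = g t"
proof -
  have 1: "continuous_on ({0..1} \<times> {0..1::real}) (\<lambda>z. g (fst z))"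
    by (rule continuous_on_compose2[OF g(1)[unfolded path_def]]) (auto intro!: continuous_intros)
  have 2: "(\<lambda>z. g (fst z)) ` ({0..1} \<times> {0..1::real}) \<subseteq> S" using g(2) by (auto simp: path_image_def)
  have 3: "p e = (\<lambda>z. g (fst z)) (0, 0::real)" using e by (simp add: pathstart_def)
  obtain k where k: "continuous_on ({0..1} \<times> {0..1}) k" "k ` ({0..1} \<times> {0..1}) \<subseteq> C" "k (0, 0::real) = e"
    "\<forall>s\<in>{0..1}. \<forall>t\<in>{0..1}. p (k (s, t)) = g (fst (s, t))"
    by (rule covering_lift_square[OF cov 1 2 e(1) 3])
  show thesis
  proof (rule that[of "\<lambda>t. k (t, 0)"])
    show "path (\<lambda>t. k (t, 0))" unfolding path_def
      by (rule continuous_on_compose2[OF k(1)]) (auto intro!: continuous_intros)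
  qed (use k in \<open>auto simp: path_image_def pathstart_def\<close>)
qed

lemma covering_path_lift_unique:
  assumes cov: "covering_space C p S" and l: "path l1" "path_image l1 \<subseteq> C" "path l2" "path_image l2 \<subseteq> C"
    and eq: "\<And>t. t \<in> {0..1} \<Longrightarrow> p (l1 t) = p (l2 t)" and a: "a \<in> {0..1}" "l1 a = l2 a" and t: "t \<in> {0..1}"
  shows "l1 t = l2 t"
proof -
  have "continuous_on {0..1} l1" "l1 ` {0..1} \<subseteq> C" "continuous_on {0..1} l2" "l2 ` {0..1} \<subseteq> C"
    using l by (simp_all add: path_def path_image_def)
  then show ?thesis
    by (rule covering_lift_unique[OF cov connected_Icc]) (fact eq a t)+
qed

text \<open>Lift a free homotopy from the loop to a constant one. The tracks of the two ends of the
  loop lie over the same path and agree at the final time, where the lift is constant; so they agree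
  at time 0 as well.\<close>

lemma covering_lift_loop_closed:
  fixes f :: "'u::topological_space \<Rightarrow> 'b::topological_space"
  assumes cov: "covering_space C p S" and U: "simply_connected U"
    and f: "continuous_on U f" "f ` U \<subseteq> S"
    and r: "path r" "path_image r \<subseteq> U" "pathfinish r = pathstart r"
    and l: "path l" "path_image l \<subseteq> C" "\<And>t. t \<in> {0..1} \<Longrightarrow> p (l t) = f (r t)"
  shows "pathfinish l = pathstart l"
proof -
  have r0: "r 0 \<in> U" using r(2) by (auto simp: path_image_def)
  have "homotopic_loops U r (\<lambda>_. r 0)"
    using U[unfolded simply_connected_def, rule_format, of r "\<lambda>_. r 0"] r r0
    by (auto simp: path_def path_image_def pathstart_def pathfinish_def)
  then obtain H :: "real \<times> real \<Rightarrow> _" where H: "continuous_on ({0..1} \<times> {0..1}) H" "H ` ({0..1} \<times> {0..1}) \<subseteq> U"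
     "\<And>x. x \<in> {0..1} \<Longrightarrow> H (0, x) = r x" "\<And>x. x \<in> {0..1} \<Longrightarrow> H (1, x) = r 0"
     "\<And>t. t \<in> {0..1} \<Longrightarrow> H (t, 1) = H (t, 0)"
    unfolding homotopic_loops by (auto simp: pathstart_def pathfinish_def Pi_iff image_subset_iff)
  have "continuous_on ({0..1} \<times> {0..1}) (f \<circ> H)"
    by (intro continuous_on_compose H(1) continuous_on_subset[OF f(1) H(2)])
  moreover have "(f \<circ> H) ` ({0..1} \<times> {0..1}) \<subseteq> S" using H(2) f(2) by (simp only: image_comp[symmetric]) blast
  moreover have "l 0 \<in> C" "p (l 0) = (f \<circ> H) (0,0)" using l H by (auto simp: path_image_def)
  ultimately obtain k where k: "continuous_on ({0..1} \<times> {0..1}) k" "k ` ({0..1} \<times> {0..1}) \<subseteq> C" "k (0, 0) = l 0"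
    "\<forall>s\<in>{0..1}. \<forall>t\<in>{0..1}. p (k (s, t)) = (f \<circ> H) (s, t)"
    by (rule covering_lift_square[OF cov])
  have pk: "path (\<lambda>t. k (s, t))" "path (\<lambda>t. k (t, s))" if "s \<in> {0..1}" for s
    unfolding path_def using that
    by (auto intro!: continuous_on_compose2[OF k(1)] continuous_intros)
  have ik: "path_image (\<lambda>t. k (s, t)) \<subseteq> C" "path_image (\<lambda>t. k (t, s)) \<subseteq> C" if "s \<in> {0..1}" for s
    using that k(2) by (auto simp: path_image_def)
  have e0: "l t = k (0, t)" if "t \<in> {0..1}" for t
    by (rule covering_path_lift_unique[OF cov l(1,2) pk(1) ik(1), where a=0])
       (use l k H that in auto)
  have e1: "k (1, t) = k (1, 0)" if "t \<in> {0..1}" for t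
    by (rule covering_path_lift_unique[OF cov pk(1) ik(1), where a=0 and ?l2.0="\<lambda>_. k (1,0)"])
       (use k H that in \<open>auto simp: path_def path_image_def\<close>)
  have "k (t, 0) = k (t, 1)" if "t \<in> {0..1}" for t
    by (rule covering_path_lift_unique[OF cov pk(2) ik(2) pk(2) ik(2), where a=1])
       (use k(4) H(5) e1[of 1] that in auto)
  then show ?thesis using e0 by (simp add: pathstart_def pathfinish_def)
qed

text \<open>The value at a point is the end of a lifted path leading there. Independence of the path
  is the closing up of lifts of loops, and continuity follows from local path connectedness.\<close>

proposition covering_lift_simply_connected:
  fixes f :: "'u::topological_space \<Rightarrow> 'b::topological_space"
  assumes cov: "covering_space C p S" and U: "simply_connected U" "path_connected U" "locally path_connected U"
    and f: "continuous_on U f" "f ` U \<subseteq> S" and z: "z \<in> U" and e: "e \<in> C" "p e = f z"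
  obtains g where "continuous_on U g" "g ` U \<subseteq> C" "g z = e" "\<And>x. x \<in> U \<Longrightarrow> p (g x) = f x"
proof -
  define is_lift where "is_lift r l \<longleftrightarrow> path r \<and> path_image r \<subseteq> U \<and> pathstart r = z \<and>
     path l \<and> path_image l \<subseteq> C \<and> pathstart l = e \<and> (\<forall>t\<in>{0..1}. p (l t) = f (r t))" for r l
  have ex_lift: "\<exists>l. is_lift r l" if r: "path r" "path_image r \<subseteq> U" "pathstart r = z" for r
  proof -
    have 1: "path (f \<circ> r)" "path_image (f \<circ> r) \<subseteq> S"
      using r f by (auto intro: path_continuous_image continuous_on_subset simp: path_image_compose)
    have "p e = pathstart (f \<circ> r)" using e r by (simp add: pathstart_compose)
    from covering_lift_path[OF cov 1 e(1) this] show ?thesis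
      using r unfolding is_lift_def by (metis comp_apply)
  qed
  have ends: "pathfinish l1 = pathfinish l2"
    if "is_lift r1 l1" "is_lift r2 l2" "pathfinish r1 = pathfinish r2" for r1 r2 l1 l2
  proof -
    note L = that[unfolded is_lift_def]
    have i: "path_image (reversepath r2) \<subseteq> U" using L by simp
    have "path (f \<circ> reversepath r2)" "path_image (f \<circ> reversepath r2) \<subseteq> S"
      using L f i by (auto intro!: path_continuous_image simp: path_image_compose intro: continuous_on_subset)
    moreover have "pathfinish l1 \<in> C" using L by (meson pathfinish_in_path_image subsetD)
    moreover have "p (pathfinish l1) = pathstart (f \<circ> reversepath r2)"
      using L by (simp add: pathstart_compose) (simp add: pathfinish_def)
    ultimately obtain m where m: "path m" "path_image m \<subseteq> C" "pathstart m = pathfinish l1"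
       "\<forall>t\<in>{0..1}. p (m t) = (f \<circ> reversepath r2) t"
      by (rule covering_lift_path[OF cov])
    have "pathfinish (l1 +++ m) = pathstart (l1 +++ m)"
    proof (rule covering_lift_loop_closed[OF cov U(1) f, where r="r1 +++ reversepath r2"])
      show "path_image (r1 +++ reversepath r2) \<subseteq> U" using L i by (simp add: path_image_join)
      show "path_image (l1 +++ m) \<subseteq> C" using L m by (simp add: path_image_join)
      show "\<And>t. t \<in> {0..1} \<Longrightarrow> p ((l1 +++ m) t) = f ((r1 +++ reversepath r2) t)"
        using L m(4) by (auto simp: joinpaths_def)
    qed (use L m in \<open>auto\<close>)
    then have mf: "pathfinish m = e" using L by simp
    \<comment> \<open>Run backwards, \<open>m\<close> is a lift of \<open>r2\<close> starting at
      \<open>e\<close>, so uniqueness identifies it with \<open>l2\<close>.\<close>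
    have "reversepath m t = l2 t" if "t \<in> {0..1}" for t
    proof (rule covering_path_lift_unique[OF cov _ _ _ _ _ _ _ that, where a=0])
      show "p (reversepath m t) = p (l2 t)" if "t \<in> {0..1}" for t
        using m(4)[rule_format, of "1 - t"] L that by (simp add: reversepath_def)
      show "reversepath m 0 = l2 0" using mf L by (simp add: reversepath_def pathfinish_def pathstart_def)
    qed (use L m in auto)
    from this[of 1] have "pathstart m = pathfinish l2" by (simp add: reversepath_def pathstart_def pathfinish_def)
    then show ?thesis using m by simp
  qed
  have ex: "\<exists>r l. is_lift r l \<and> pathfinish r = x" if "x \<in> U" for x
    using U(2) z that ex_lift unfolding path_connected_def by meson
  define g where "g x = (SOME y. \<exists>r l. is_lift r l \<and> pathfinish r = x \<and> pathfinish l = y)" for x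
  have g: "g (pathfinish r) = pathfinish l" if "is_lift r l" for r l
  proof -
    have "\<exists>r' l'. is_lift r' l' \<and> pathfinish r' = pathfinish r \<and> pathfinish l' = g (pathfinish r)"
      unfolding g_def by (rule someI) (use that in blast)
    then show ?thesis using ends that by metis
  qed
  have gC: "g x \<in> C" "p (g x) = f x" if xU: "x \<in> U" for x
  proof -
    obtain r l where rl: "is_lift r l" "pathfinish r = x" using ex xU by blast
    then have "g x = pathfinish l" using g by blast
    then show "g x \<in> C" "p (g x) = f x" using rl unfolding is_lift_def
      by (auto simp: pathfinish_def path_image_def)
  qed
  have gz: "g z = e"
  proof -
    have "is_lift (\<lambda>_. z) (\<lambda>_. e)" using z e
      by (auto simp: is_lift_def path_def path_image_def pathstart_def)
    from g[OF this] show ?thesis by (simp add: pathfinish_def)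
  qed
  have cont: "\<exists>W. openin (top_of_set U) W \<and> x \<in> W \<and> continuous_on W g" if x: "x \<in> U" for x
  proof -
    have "f x \<in> S" using f x by blast
    then obtain V \<V> where V: "f x \<in> V" "openin (top_of_set S) V" "\<Union>\<V> = C \<inter> p -` V"
      "\<forall>u\<in>\<V>. openin (top_of_set C) u" "pairwise disjnt \<V>"
      "\<forall>u\<in>\<V>. \<exists>q. homeomorphism u V p q"
      by (rule covering_space_sheets[OF cov])
    have "g x \<in> \<Union>\<V>" using V gC[OF x] by auto
    then obtain u q where u: "u \<in> \<V>" "g x \<in> u" and q: "homeomorphism u V p q" using V(6) by blast
    have "openin (top_of_set U) (U \<inter> f -` V)"
      using continuous_openin_preimage[OF f(1) _ V(2)] f(2) by auto
    moreover have "x \<in> U \<inter> f -` V" using x V by auto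
    ultimately obtain W N where W: "openin (top_of_set U) W" "path_connected N" "x \<in> W" "W \<subseteq> N" "N \<subseteq> U \<inter> f -` V"
      using U(3)[unfolded locally_def, rule_format, of "U \<inter> f -` V" x] by blast
    \<comment> \<open>A path to \<open>x\<close> is prolonged inside \<open>N\<close>; over the
      prolongation the lift stays in one sheet and is given by the local inverse
      \<open>q\<close>.\<close>
    have "g y = q (f y)" if y: "y \<in> W" for y
    proof -
      obtain r l where rl: "is_lift r l" "pathfinish r = x" using ex x by blast
      then have gx: "g x = pathfinish l" using g by blast
      have "x \<in> N" "y \<in> N" using W(3,4) y by auto
      then obtain s where s: "path s" "path_image s \<subseteq> N" "pathstart s = x" "pathfinish s = y"
        using W(2)[unfolded path_connected_def] by blast
      define m where "m = q \<circ> f \<circ> s"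
      have fs: "f (s t) \<in> V" if "t \<in> {0..1}" for t
        using s(2) W(5) that unfolding path_image_def by blast
      have "continuous_on {0..1} (f \<circ> s)" 
        using path_continuous_image[OF s(1), of f] continuous_on_subset[OF f(1)] s(2) W(5)
        by (auto simp: path_def)
      moreover have "continuous_on V q" using q by (simp add: homeomorphism_def)
      ultimately have "continuous_on {0..1} (\<lambda>t. q ((f \<circ> s) t))"
        by (intro continuous_on_compose2[where f="f \<circ> s" and g=q]) (use fs in auto)
      then have m1: "path m" by (simp add: m_def path_def comp_def)
      have "q ` V = u" using q by (simp add: homeomorphism_def)
      then have m2: "path_image m \<subseteq> C" using fs Union_upper[OF u(1)] unfolding V(3) m_def path_image_def by auto
      have m3: "pathstart m = pathfinish l"
        using s(3) gx gC[OF x] u(2) q by (auto simp: m_def pathstart_def dest: homeomorphism_apply1)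
      have m4: "p (m t) = f (s t)" if "t \<in> {0..1}" for t
        using fs[OF that] q by (auto simp: m_def homeomorphism_def)
      note L = rl(1)[unfolded is_lift_def]
      have NU: "N \<subseteq> U" using W by blast
      have "path (r +++ s)" "path_image (r +++ s) \<subseteq> U" "pathstart (r +++ s) = z"
        using L s rl(2) NU by (auto simp: path_image_join)
      moreover have "path (l +++ m)" "path_image (l +++ m) \<subseteq> C" "pathstart (l +++ m) = e"
        using L m1 m2 m3 by (auto simp: path_image_join)
      moreover have "\<forall>t\<in>{0..1}. p ((l +++ m) t) = f ((r +++ s) t)"
        using L m4 by (auto simp: joinpaths_def)
      ultimately have "is_lift (r +++ s) (l +++ m)" unfolding is_lift_def by blast
      from g[OF this] have "g (pathfinish s) = pathfinish m" by simp
      then show ?thesis unfolding s(4) using s(4) by (simp add: m_def pathfinish_def)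
    qed
    moreover have "continuous_on W (\<lambda>y. q (f y))"
    proof (rule continuous_on_compose2[of V q])
      show "continuous_on V q" using q by (simp add: homeomorphism_def)
      show "continuous_on W f" "f ` W \<subseteq> V" using W continuous_on_subset[OF f(1)] by auto
    qed
    ultimately have "continuous_on W g" using continuous_on_cong[OF refl, of W g "\<lambda>y. q (f y)"] by simp
    then show ?thesis using W by blast
  qed
  have "continuous_on U g"
    unfolding continuous_on_def
  proof
    fix x assume "x \<in> U"
    then obtain W where W: "openin (top_of_set U) W" "x \<in> W" "continuous_on W g" using cont by blast
    then have "(g \<longlongrightarrow> g x) (at x within W)" by (simp add: continuous_on_def)
    moreover have "at x within W = at x within U"
    proof -
      obtain T where "open T" "W = U \<inter> T" using W(1) by (auto simp: openin_open)
      then show ?thesis using W(2) by (intro at_within_nhd[of x T]) auto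
    qed
    ultimately show "(g \<longlongrightarrow> g x) (at x within U)" by simp
  qed
  then show thesis using that gC gz by blast
qed

text \<open>Simple connectedness is the free homotopy of any two loops; for two constant loops, the
  track of one parameter is a path between the points.\<close>

lemma simply_connected_imp_path_connected_top:
  fixes U :: "'a::topological_space set"
  assumes "simply_connected U"
  shows "path_connected U"
  unfolding path_connected_def
proof (intro ballI)
  fix x y assume xy: "x \<in> U" "y \<in> U"
  then have "homotopic_loops U (\<lambda>_. x) (\<lambda>_. y)"
    using assms[unfolded simply_connected_def, rule_format, of "\<lambda>_. x" "\<lambda>_. y"]
    by (auto simp: path_def path_image_def pathstart_def pathfinish_def)
  then obtain H :: "real \<times> real \<Rightarrow> _" where H: "continuous_on ({0..1} \<times> {0..1}) H" "H ` ({0..1} \<times> {0..1}) \<subseteq> U"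
     "\<And>t. t \<in> {0..1} \<Longrightarrow> H (0, t) = x" "\<And>t. t \<in> {0..1} \<Longrightarrow> H (1, t) = y"
    unfolding homotopic_loops by (auto simp: Pi_iff image_subset_iff)
  have "path (\<lambda>t. H (t, 0))" unfolding path_def
    by (rule continuous_on_compose2[OF H(1)]) (auto intro!: continuous_intros)
  then show "\<exists>g. path g \<and> path_image g \<subseteq> U \<and> pathstart g = x \<and> pathfinish g = y"
    using H by (intro exI[of _ "\<lambda>t. H (t, 0)"]) (auto simp: path_image_def pathstart_def pathfinish_def)
qed

subsection \<open>Loops and dual circle maps on a surface\<close>

text \<open>
  Along the sides \<open>4k\<close>, \<open>4k + 1\<close>, \<open>4k + 2\<close> the function \<open>tent\<close> rises from 0 to 1, stays, and falls back
  to 0, so its exponential \<open>side_map g k\<close> respects the pairing of the sides and winds once around the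
  circle along side \<open>4k\<close>.
\<close>

definition tent :: "real \<Rightarrow> real" where
  "tent t = max 0 (min 1 (min t (3 - t)))"

text \<open>At integers these are the corners of the polygon; side number \<open>m\<close> is run
  through as \<open>t\<close> goes from \<open>m\<close> to \<open>m + 1\<close>.\<close>

definition vertex :: "nat \<Rightarrow> real \<Rightarrow> complex" where
  "vertex g t = cis (2 * pi * t / (4 * real g))"

definition side_map :: "nat \<Rightarrow> nat \<Rightarrow> complex \<Rightarrow> complex" where
  "side_map g k z = cis (2 * pi * (norm z * tent (4 * real g * Arg2pi z / (2 * pi) - 4 * real k)))"

lemma side_map_polar:
  assumes k: "k < g" and r: "0 \<le> r" and t: "0 \<le> t" "t \<le> 4 * real g"
  shows "side_map g k (of_real r * vertex g t) = cis (2 * pi * (r * tent (t - 4 * real k)))"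
proof (cases "r = 0")
  case True
  then show ?thesis by (simp add: side_map_def)
next
  case False
  then have r: "0 < r" using r by simp
  have g: "0 < real g" using k by simp
  have n: "norm (of_real r * vertex g t) = r" using r by (simp add: vertex_def norm_mult)
  show ?thesis
  \<comment> \<open>At the end of the circuit \<open>Arg2pi\<close> has jumped back to 0, which does
    no harm because \<open>tent\<close> vanishes at both parameters.\<close>
  proof (cases "t = 4 * real g")
    case True
    then have "vertex g t = 1" using g by (simp add: vertex_def)
    then have "Arg2pi (of_real r * vertex g t) = 0" using r by (simp add: Arg2pi_eq_0)
    moreover have "tent (0 - 4 * real k) = tent (t - 4 * real k)" using True k by (auto simp: tent_def)
    ultimately show ?thesis unfolding side_map_def n by simp
  next
    case False
    have "Arg2pi (of_real r * vertex g t) = 2 * pi * t / (4 * real g)"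
    proof (rule Arg2pi_unique[of r])
      show "2 * pi * t / (4 * real g) < 2 * pi" using False t g by (simp add: field_simps)
    qed (use r t g in \<open>auto simp: vertex_def cis_conv_exp\<close>)
    then have "4 * real g * Arg2pi (of_real r * vertex g t) / (2 * pi) = t" using g by simp
    then show ?thesis unfolding side_map_def n by simp
  qed
qed

lemma side_map_pairing:
  assumes k: "k < g" and xy: "(x, y) \<in> side_pairing g"
  shows "side_map g k x = side_map g k y"
proof -
  obtain i j t where ij: "i < g" "j < (2::nat)" "0 \<le> t" "t \<le> 1"
    and x: "x = vertex g (4 * real i + real j + t)" and y: "y = vertex g (4 * real i + real j + 3 - t)"
    using xy by (auto simp: side_pairing_def vertex_def)
  have j: "j = 0 \<or> j = 1" using ij by auto
  have ig: "4 * real i + 4 \<le> 4 * real g" using ij by simp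
  have "side_map g k x = cis (2 * pi * tent (4 * real i + real j + t - 4 * real k))"
    using side_map_polar[OF k, of 1 "4 * real i + real j + t"] ij j ig x by auto
  moreover have "side_map g k y = cis (2 * pi * tent (4 * real i + real j + 3 - t - 4 * real k))"
    using side_map_polar[OF k, of 1 "4 * real i + real j + 3 - t"] ij j ig y by auto
  moreover consider "i < k" | "i = k" | "k < i" by linarith
  then have "cis (2 * pi * tent (4 * real i + real j + t - 4 * real k))
      = cis (2 * pi * tent (4 * real i + real j + 3 - t - 4 * real k))"
  proof cases
    case 1
    then have "4 * real i + 4 \<le> 4 * real k" by simp
    then have "tent (4 * real i + real j + t - 4 * real k) = 0" "tent (4 * real i + real j + 3 - t - 4 * real k) = 0"
      using ij j by (auto simp: tent_def)
    then show ?thesis by simp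
  next
    case 2
    from j show ?thesis
    proof
      assume "j = 0"
      then have "tent (4 * real i + real j + t - 4 * real k) = t" "tent (4 * real i + real j + 3 - t - 4 * real k) = t"
        using 2 ij by (auto simp: tent_def)
      then show ?thesis by simp
    next
      \<comment> \<open>On the paired sides \<open>4k + 1\<close> and \<open>4k + 3\<close> the
        values of \<open>tent\<close> are 1 and 0. They differ, but by an integer.\<close>
      assume "j = 1"
      then have "tent (4 * real i + real j + t - 4 * real k) = 1" "tent (4 * real i + real j + 3 - t - 4 * real k) = 0"
        using 2 ij by (auto simp: tent_def)
      then show ?thesis by simp
    qed
  next
    case 3
    then have "4 * real k + 4 \<le> 4 * real i" by simp
    then have "tent (4 * real i + real j + t - 4 * real k) = 0" "tent (4 * real i + real j + 3 - t - 4 * real k) = 0"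
      using ij j by (auto simp: tent_def)
    then show ?thesis by simp
  qed
  ultimately show ?thesis by simp
qed

lemma polar_disc:
  assumes "0 < g"
  shows "(\<lambda>(r, t). of_real r * vertex g t) ` ({0..1} \<times> {0..4 * real g}) = cball 0 1"
proof
  show "(\<lambda>(r, t). of_real r * vertex g t) ` ({0..1} \<times> {0..4 * real g}) \<subseteq> cball 0 1"
    by (auto simp: norm_mult vertex_def)
  show "cball 0 1 \<subseteq> (\<lambda>(r, t). of_real r * vertex g t) ` ({0..1} \<times> {0..4 * real g})"
  proof
    fix z :: complex assume "z \<in> cball 0 1"
    then have n: "norm z \<le> 1" by simp
    let ?t = "4 * real g * Arg2pi z / (2 * pi)"
    have "2 * pi * ?t / (4 * real g) = Arg2pi z" using assms by simp
    then have "z = of_real (norm z) * vertex g ?t"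
      unfolding vertex_def using Arg2pi_eq[of z] by (simp add: cis_conv_exp)
    moreover have "0 \<le> ?t" "?t \<le> 4 * real g"
      using Arg2pi_ge_0[of z] Arg2pi_lt_2pi[of z] assms by (auto simp: field_simps)
    ultimately show "z \<in> (\<lambda>(r, t). of_real r * vertex g t) ` ({0..1} \<times> {0..4 * real g})"
      using n by (intro image_eqI[of _ _ "(norm z, ?t)"]) auto
  qed
qed

text \<open>\<open>u k\<close> is dual to the loop \<open>\<alpha> k\<close> given by side number \<open>4k\<close> of the polygon.\<close>

lemma surface_circle_maps:
  fixes S :: "'a::topological_space set"
  assumes S: "has_genus S g" and g: "0 < g"
  obtains base u \<alpha> where "base \<in> S"
    "\<forall>k<g. continuous_on S (u k)"
    "\<forall>k<g. \<forall>x\<in>S. norm (u k x :: complex) = 1"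
    "\<forall>k<g. \<forall>l<g. \<forall>x\<in>S. k \<noteq> l \<longrightarrow> u k x = 1 \<or> u l x = 1"
    "\<forall>k<g. path (\<alpha> k) \<and> path_image (\<alpha> k) \<subseteq> S \<and> pathstart (\<alpha> k) = base \<and> pathfinish (\<alpha> k) = base"
    "\<forall>k<g. \<forall>l<g. \<forall>t\<in>{0..1}. u k (\<alpha> l t) = (if k = l then cis (2 * pi * t) else 1)"
proof -
  obtain q where q: "quotient_map (top_of_set (cball 0 1)) (top_of_set S) q"
    and qeq: "\<And>x y. x \<in> cball 0 1 \<Longrightarrow> y \<in> cball 0 1 \<Longrightarrow>
           q x = q y \<longleftrightarrow> (x, y) \<in> (side_pairing g \<union> (side_pairing g)\<inverse>)\<^sup>*"
    using S unfolding has_genus_def by blast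
  let ?K = "{0..1::real} \<times> {0..4 * real g}" and ?P = "\<lambda>(r, t). complex_of_real r * vertex g t"
  have qS: "q ` cball 0 1 = S" using q by (auto simp: quotient_map_def)
  have qc: "continuous_on (cball 0 1) q"
    using quotient_imp_continuous_map[OF q] by simp
  have Pc: "continuous_on A ?P" for A
    unfolding case_prod_unfold vertex_def cis_conv_exp using g by (intro continuous_intros) auto
  \<comment> \<open>Polar coordinates present the disc as a quotient of a rectangle. Descending from
    the rectangle reduces continuity of \<open>u k\<close> to that of the explicit function
    \<open>H k\<close> and avoids the jump of \<open>Arg2pi\<close>.\<close>
  have Pq: "quotient_map (top_of_set ?K) (top_of_set (cball 0 1)) ?P"
  proof (rule continuous_imp_quotient_map)
    show "continuous_map (top_of_set ?K) (top_of_set (cball 0 1)) ?P"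
      using polar_disc[OF g] Pc by (auto simp: continuous_map_subtopology_eu)
    show "compact_space (top_of_set ?K)"
      by (intro compact_space_subtopology) (simp, intro compact_Times compact_Icc)
    show "Hausdorff_space (top_of_set (cball 0 (1::real) :: complex set))"
      by (simp add: Hausdorff_space_subtopology)
  qed (use polar_disc[OF g] in simp)
  note quo = quotient_map_compose[OF Pq q]
  define H where "H k = (\<lambda>(r, t). cis (2 * pi * (r * tent (t - 4 * real k))))" for k
  have Hc: "continuous_map (top_of_set ?K) euclidean (H k)" for k
    unfolding H_def case_prod_unfold tent_def cis_conv_exp
    by simp (intro continuous_intros)
  have side: "side_map g k x = side_map g k y" if "(x, y) \<in> (side_pairing g \<union> (side_pairing g)\<inverse>)\<^sup>*" "k < g" for k x y
    using that(1) by (induction rule: rtrancl_induct) (use side_map_pairing[OF that(2)] in auto)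
  have Hside: "H k x = side_map g k (?P x)" if "k < g" "x \<in> ?K" for k x
    using that side_map_polar[OF that(1), of "fst x" "snd x"] by (auto simp: H_def case_prod_unfold)
  have "\<exists>u. continuous_on S u \<and> (\<forall>x\<in>?K. u (q (?P x)) = H k x)" if k: "k < g" for k
  proof -
    have "H k x = H k y" if "x \<in> topspace (top_of_set ?K)" "y \<in> topspace (top_of_set ?K)" "(q \<circ> ?P) x = (q \<circ> ?P) y" for x y
    proof -
      have xy: "x \<in> ?K" "y \<in> ?K" using that by auto
      have "?P x \<in> cball 0 1" "?P y \<in> cball 0 1" using xy polar_disc[OF g] by blast+
      then have "(?P x, ?P y) \<in> (side_pairing g \<union> (side_pairing g)\<inverse>)\<^sup>*" using qeq that(3) by simp
      from side[OF this k] show ?thesis using Hside[OF k] xy by simp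
    qed
    then show ?thesis
    proof (rule quotient_map_lift_exists[OF quo Hc[of k]])
      fix u
      assume u: "continuous_map (top_of_set S) euclidean u"
        and uH: "\<And>x. x \<in> topspace (top_of_set ?K) \<Longrightarrow> u ((q \<circ> ?P) x) = H k x"
      have "u (q (?P x)) = H k x" if "x \<in> ?K" for x
        using uH[of x] that by (simp only: topspace_euclidean_subtopology comp_apply)
      then show ?thesis using u by (intro exI[of _ u]) auto
    qed
  qed
  then obtain u where u: "\<And>k. k < g \<Longrightarrow> continuous_on S (u k)"
    and uH: "\<And>k x. k < g \<Longrightarrow> x \<in> ?K \<Longrightarrow> u k (q (?P x)) = H k x" by metis
  have S_cases: "\<exists>r t. (r, t) \<in> ?K \<and> x = q (?P (r, t))" if "x \<in> S" for x
  proof -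
    obtain z where "z \<in> ?K" "x = q (?P z)" using \<open>x \<in> S\<close> unfolding qS[symmetric] polar_disc[OF g, symmetric] by blast
    then show ?thesis by (metis surj_pair)
  qed
  define \<alpha> where "\<alpha> k t = q (vertex g (4 * real k + t))" for k t
  have pair: "q (vertex g (4 * real i + real j + t)) = q (vertex g (4 * real i + real j + 3 - t))"
    if "i < g" "j < 2" "0 \<le> t" "t \<le> 1" for i j t
  proof -
    have "(vertex g (4 * real i + real j + t), vertex g (4 * real i + real j + 3 - t)) \<in> side_pairing g"
      unfolding side_pairing_def vertex_def using that by blast
    then show ?thesis by (subst qeq) (auto simp: vertex_def)
  qed
  \<comment> \<open>The end points of the two side pairings of a handle identify all its five
    corners; consecutive handles share a corner, so by induction all corners have the same image
    \<open>q 1\<close>.\<close>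
  have corner: "q (vertex g (4 * real k + 1)) = q (vertex g (4 * real k))"
    "q (vertex g (4 * real k + 4)) = q (vertex g (4 * real k))" if "k < g" for k
    using pair[OF that, of 0 0] pair[OF that, of 0 1] pair[OF that, of 1 0] pair[OF that, of 1 1]
    by (auto simp: add_ac)
  have base: "q (vertex g (4 * real k)) = q 1" if "k < g" for k
    using that
  proof (induction k)
    case 0 then show ?case by (simp add: vertex_def)
  next
    case (Suc k)
    then show ?case using corner(2)[of k] by (simp add: algebra_simps)
  qed
  have c1: "q 1 \<in> S" unfolding qS[symmetric] by auto
  have c2: "norm (u k x) = 1" if "k < g" "x \<in> S" for k x
    using S_cases[OF that(2)] uH[OF that(1)] by (auto simp: H_def)
  have c3: "u k x = 1 \<or> u l x = 1" if kl: "k < g" "l < g" "k \<noteq> l" "x \<in> S" for k l x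
  proof -
    obtain r t where rt: "(r, t) \<in> ?K" "x = q (?P (r, t))" using S_cases[OF kl(4)] by blast
    have "4 * real k + 4 \<le> 4 * real l \<or> 4 * real l + 4 \<le> 4 * real k" using kl(3) by linarith
    then have "tent (t - 4 * real k) = 0 \<or> tent (t - 4 * real l) = 0" by (auto simp: tent_def)
    then show ?thesis using uH[OF kl(1) rt(1)] uH[OF kl(2) rt(1)] rt(2) by (auto simp: H_def)
  qed
  have c4: "path (\<alpha> k) \<and> path_image (\<alpha> k) \<subseteq> S \<and> pathstart (\<alpha> k) = q 1 \<and> pathfinish (\<alpha> k) = q 1" if k: "k < g" for k
  proof (intro conjI)
    have "continuous_on {0..1} (\<lambda>t. vertex g (4 * real k + t))"
      unfolding vertex_def cis_conv_exp using g by (intro continuous_intros) auto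
    then show "path (\<alpha> k)" unfolding path_def \<alpha>_def
      by (rule continuous_on_compose2[OF qc]) (auto simp: vertex_def)
    show "path_image (\<alpha> k) \<subseteq> S" unfolding path_image_def qS[symmetric] by (auto simp: \<alpha>_def vertex_def)
    show "pathstart (\<alpha> k) = q 1" using base[OF k] by (simp add: \<alpha>_def pathstart_def)
    show "pathfinish (\<alpha> k) = q 1" using base[OF k] corner(1)[OF k] by (simp add: \<alpha>_def pathfinish_def)
  qed
  have c5: "u k (\<alpha> l t) = (if k = l then cis (2 * pi * t) else 1)" if kl: "k < g" "l < g" "t \<in> {0..1}" for k l t
  proof -
    have "real l + 1 \<le> real g" using kl(2) by simp
    then have "(1, 4 * real l + t) \<in> ?K" using kl(3) by auto
    from uH[OF kl(1) this] have "u k (\<alpha> l t) = cis (2 * pi * tent (4 * real l + t - 4 * real k))"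
      by (simp add: H_def \<alpha>_def)
    moreover have "tent (4 * real l + t - 4 * real k) = (if k = l then t else 0)"
    proof (cases "k = l")
      case True then show ?thesis using kl(3) by (auto simp: tent_def)
    next
      case False
      then have "4 * real k + 4 \<le> 4 * real l \<or> 4 * real l + 4 \<le> 4 * real k" by linarith
      then show ?thesis using kl(3) False by (auto simp: tent_def)
    qed
    ultimately show ?thesis by simp
  qed
  show thesis
  proof (rule that[of "q 1" u \<alpha>])
    show "q 1 \<in> S" by (rule c1)
    show "\<forall>k<g. continuous_on S (u k)" by (intro allI impI u)
    show "\<forall>k<g. \<forall>x\<in>S. norm (u k x) = 1" by (intro allI impI ballI c2)
    show "\<forall>k<g. \<forall>l<g. \<forall>x\<in>S. k \<noteq> l \<longrightarrow> u k x = 1 \<or> u l x = 1" by (intro allI impI ballI c3)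
    show "\<forall>k<g. path (\<alpha> k) \<and> path_image (\<alpha> k) \<subseteq> S \<and> pathstart (\<alpha> k) = q 1 \<and> pathfinish (\<alpha> k) = q 1"
      by (intro allI impI c4)
    show "\<forall>k<g. \<forall>l<g. \<forall>t\<in>{0..1}. u k (\<alpha> l t) = (if k = l then cis (2 * pi * t) else 1)"
      by (intro allI impI ballI c5)
  qed
qed

section \<open>Local path connectedness of surfaces, products and covers\<close>

lemma locally_path_connected_charts:
  fixes S :: "'a::topological_space set" and A :: "('a, 'n::finite) chart set"
  assumes "\<And>c. c \<in> A \<Longrightarrow> chart_on S c" and "(\<Union>c\<in>A. fst c) = S"
  shows "locally path_connected S"
  unfolding locally_def
proof (intro allI impI)
  fix W x assume W: "openin (top_of_set S) W \<and> x \<in> W"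
  then have "x \<in> S" using openin_imp_subset by blast
  then obtain c where c: "c \<in> A" "x \<in> fst c" using assms(2) by blast
  have o: "openin (top_of_set S) (fst c)" "open (snd c ` fst c)" using assms(1)[OF c(1)] by (auto simp: chart_on_def)
  obtain \<psi> where h: "homeomorphism (fst c) (snd c ` fst c) (snd c) \<psi>"
    using assms(1)[OF c(1)] by (auto simp: chart_on_def)
  have h': "homeomorphism (snd c ` fst c) (fst c) \<psi> (snd c)" using h by (rule homeomorphism_symD)
  have "openin (top_of_set (fst c)) (W \<inter> fst c)"
    using W o by (meson Int_lower2 openin_Int openin_subset_trans openin_imp_subset)
  then have "openin (top_of_set (snd c ` fst c)) (snd c ` (W \<inter> fst c))"
    by (rule homeomorphism_imp_open_map[OF h])
  then have "open (snd c ` (W \<inter> fst c))" using o(2) openin_open_trans by blast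
  moreover have "snd c x \<in> snd c ` (W \<inter> fst c)" using W c by blast
  ultimately obtain e where e: "e > 0" "ball (snd c x) e \<subseteq> snd c ` (W \<inter> fst c)"
    by (meson openE)
  let ?B = "ball (snd c x) e"
  have sub: "?B \<subseteq> snd c ` fst c" using e by blast
  have "openin (top_of_set (snd c ` fst c)) ?B" using sub by (simp add: open_subset)
  then have "openin (top_of_set (fst c)) (\<psi> ` ?B)" by (rule homeomorphism_imp_open_map[OF h'])
  then have op: "openin (top_of_set S) (\<psi> ` ?B)" using o(1) openin_trans by blast
  have pc: "path_connected (\<psi> ` ?B)"
    by (rule path_connected_continuous_image)
       (use h' sub in \<open>auto simp: homeomorphism_def intro: continuous_on_subset convex_imp_path_connected\<close>)
  have "x \<in> \<psi> ` ?B" using e(1) c(2) h by (metis centre_in_ball homeomorphism_apply1 image_eqI)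
  moreover have "\<psi> ` ?B \<subseteq> W"
  proof
    fix y assume "y \<in> \<psi> ` ?B"
    then obtain w where "w \<in> W \<inter> fst c" "y = \<psi> (snd c w)" using e(2) by blast
    then show "y \<in> W" using homeomorphism_apply1[OF h] by simp
  qed
  ultimately show "\<exists>U V. openin (top_of_set S) U \<and> path_connected V \<and> x \<in> U \<and> U \<subseteq> V \<and> V \<subseteq> W"
    using op pc by blast
qed

lemma path_connected_Times_top:
  fixes S :: "'a::topological_space set" and T :: "'b::topological_space set"
  assumes "path_connected S" "path_connected T"
  shows "path_connected (S \<times> T)"
  unfolding path_connected_def
proof (intro ballI)
  fix x y assume x: "x \<in> S \<times> T" and y: "y \<in> S \<times> T"
  obtain f where f: "path f" "path_image f \<subseteq> S" "pathstart f = fst x" "pathfinish f = fst y"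
    using assms(1) x y unfolding path_connected_def by force
  obtain k where k: "path k" "path_image k \<subseteq> T" "pathstart k = snd x" "pathfinish k = snd y"
    using assms(2) x y unfolding path_connected_def by force
  have "path (\<lambda>t. (f t, k t))" using f k by (auto simp: path_def intro: continuous_on_Pair)
  then show "\<exists>p. path p \<and> path_image p \<subseteq> S \<times> T \<and> pathstart p = x \<and> pathfinish p = y"
    using f k by (intro exI[of _ "\<lambda>t. (f t, k t)"]) (auto simp: path_image_def pathstart_def pathfinish_def)
qed

lemma locally_path_connected_Times:
  fixes S :: "'a::topological_space set" and T :: "'b::topological_space set"
  assumes S: "locally path_connected S" and T: "locally path_connected T"
  shows "locally path_connected (S \<times> T)"
  unfolding locally_def
proof (intro allI impI)
  fix W x assume W: "openin (top_of_set (S \<times> T)) W \<and> x \<in> W"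
  then obtain O' where O': "open O'" "W = (S \<times> T) \<inter> O'" by (auto simp: openin_open)
  obtain a b where x: "x = (a, b)" by force
  have "(a, b) \<in> O'" using W O' x by auto
  then obtain A B where AB: "open A" "open B" "a \<in> A" "b \<in> B" "A \<times> B \<subseteq> O'"
    by (metis O'(1) open_prod_elim mem_Times_iff fst_conv snd_conv)
  have ab: "a \<in> S \<inter> A" "b \<in> T \<inter> B" using W O' x AB by auto
  obtain U1 V1 where 1: "openin (top_of_set S) U1" "path_connected V1" "a \<in> U1" "U1 \<subseteq> V1" "V1 \<subseteq> S \<inter> A"
    using S[unfolded locally_def, rule_format, of "S \<inter> A" a] ab AB(1) openin_open_Int by blast
  obtain U2 V2 where 2: "openin (top_of_set T) U2" "path_connected V2" "b \<in> U2" "U2 \<subseteq> V2" "V2 \<subseteq> T \<inter> B"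
    using T[unfolded locally_def, rule_format, of "T \<inter> B" b] ab AB(2) openin_open_Int by blast
  have "openin (top_of_set (S \<times> T)) (U1 \<times> U2)" using 1 2 by (intro openin_Times)
  moreover have "path_connected (V1 \<times> V2)" using 1 2 by (intro path_connected_Times_top)
  moreover have "x \<in> U1 \<times> U2" "U1 \<times> U2 \<subseteq> V1 \<times> V2" "V1 \<times> V2 \<subseteq> W"
    using 1 2 AB O' x by auto
  ultimately show "\<exists>U V. openin (top_of_set (S \<times> T)) U \<and> path_connected V \<and> x \<in> U \<and> U \<subseteq> V \<and> V \<subseteq> W" by blast
qed

lemma locally_path_connected_cover:
  fixes p :: "'c::topological_space \<Rightarrow> 'b::topological_space"
  assumes cov: "covering_space C p S" and S: "locally path_connected S"
  shows "locally path_connected C"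
  unfolding locally_def
proof (intro allI impI)
  fix W x assume W: "openin (top_of_set C) W \<and> x \<in> W"
  then have x: "x \<in> C" using openin_imp_subset by blast
  obtain T V q where T: "x \<in> T" "openin (top_of_set C) T" "p x \<in> V" "openin (top_of_set S) V" "homeomorphism T V p q"
    by (rule covering_space_local_homeomorphism[OF cov x])
  have h': "homeomorphism V T q p" using T(5) by (rule homeomorphism_symD)
  have "openin (top_of_set T) (W \<inter> T)"
    using W T(2) by (meson Int_lower2 openin_Int openin_subset_trans openin_imp_subset)
  then have "openin (top_of_set V) (p ` (W \<inter> T))" by (rule homeomorphism_imp_open_map[OF T(5)])
  then have "openin (top_of_set S) (p ` (W \<inter> T))" using T(4) openin_trans by blast
  moreover have "p x \<in> p ` (W \<inter> T)" using W T by blast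
  ultimately obtain U N where U: "openin (top_of_set S) U" "path_connected N" "p x \<in> U" "U \<subseteq> N" "N \<subseteq> p ` (W \<inter> T)"
    using S[unfolded locally_def, rule_format, of "p ` (W \<inter> T)" "p x"] by blast
  have NV: "N \<subseteq> V" using U(5) T(5) by (auto simp: homeomorphism_def)
  have "openin (top_of_set V) U"
    using U NV T(4) by (meson openin_subset_trans openin_imp_subset subset_trans)
  then have "openin (top_of_set T) (q ` U)" by (rule homeomorphism_imp_open_map[OF h'])
  then have "openin (top_of_set C) (q ` U)" using T(2) openin_trans by blast
  moreover have "path_connected (q ` N)"
    by (rule path_connected_continuous_image)
       (use U(2) NV T(5) in \<open>auto simp: homeomorphism_def intro: continuous_on_subset\<close>)
  moreover have "x \<in> q ` U" using U(3) T(1,5) by (metis homeomorphism_apply1 image_eqI)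
  moreover have "q ` U \<subseteq> q ` N" using U by blast
  moreover have "q ` N \<subseteq> W"
  proof
    fix y assume "y \<in> q ` N"
    then obtain w where "w \<in> W \<inter> T" "y = q (p w)" using U(5) by blast
    then show "y \<in> W" using homeomorphism_apply1[OF T(5)] by simp
  qed
  ultimately show "\<exists>U V. openin (top_of_set C) U \<and> path_connected V \<and> x \<in> U \<and> U \<subseteq> V \<and> V \<subseteq> W" by blast
qed

subsection \<open>The deck group\<close>

lemma deck_group_carrier:
  "T \<in> carrier (deck_group C p) \<longleftrightarrow> T \<in> Bij C \<and> (\<exists>T'. homeomorphism C C T T') \<and> (\<forall>x\<in>C. p (T x) = p x)"
  by (simp add: deck_group_def)

lemma deck_group_mult:
  assumes "T \<in> carrier (deck_group C p)" "S \<in> carrier (deck_group C p)"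
  shows "T \<otimes>\<^bsub>deck_group C p\<^esub> S = compose C T S"
  using assms by (simp add: deck_group_def BijGroup_def)

lemma deck_group_apply:
  assumes "T \<in> carrier (deck_group C p)" "S \<in> carrier (deck_group C p)" "x \<in> C"
  shows "(T \<otimes>\<^bsub>deck_group C p\<^esub> S) x = T (S x)"
  using assms by (simp add: deck_group_mult compose_def)

lemma group_deck_group: "group (deck_group C p)"
proof -
  let ?H = "{T \<in> Bij C. (\<exists>T'. homeomorphism C C T T') \<and> (\<forall>x\<in>C. p (T x) = p x)}"
  interpret B: group "BijGroup C" by (rule group_BijGroup)
  have "subgroup ?H (BijGroup C)"
  proof (rule B.subgroupI)
    show "?H \<subseteq> carrier (BijGroup C)" by (auto simp: BijGroup_def)
    have "(\<lambda>x\<in>C. x) \<in> ?H"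
    proof -
      have "homeomorphism C C (\<lambda>x\<in>C. x) (\<lambda>x\<in>C. x)"
        by (auto simp: homeomorphism_def cong: continuous_on_cong)
      then show ?thesis using id_Bij[of C] by auto
    qed
    then show "?H \<noteq> {}" by blast
  next
    fix T assume T: "T \<in> ?H"
    then obtain T' where T': "homeomorphism C C T T'" by blast
    have inv: "inv_into C T y = T' y" if "y \<in> C" for y
      using T that T' homeomorphism_apply2[OF T' that]
      by (intro inv_into_f_eq) (auto simp: Bij_def bij_betw_def homeomorphism_def)
    let ?I = "\<lambda>x\<in>C. inv_into C T x"
    have I: "?I \<in> Bij C" using T by (intro restrict_inv_into_Bij) simp
    have "homeomorphism C C ?I T"
    proof -
      have "continuous_on C ?I" using T' inv by (auto simp: homeomorphism_def cong: continuous_on_cong)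
      then show ?thesis using T' inv unfolding homeomorphism_def by (auto simp: image_iff)
    qed
    moreover have "p (?I x) = p x" if "x \<in> C" for x
    proof -
      have "T' x \<in> C" using T' that by (auto simp: homeomorphism_def)
      then show ?thesis using T that inv homeomorphism_apply2[OF T' that] by auto
    qed
    ultimately show "inv\<^bsub>BijGroup C\<^esub> T \<in> ?H" using T I inv_BijGroup[of T C] by auto
  next
    fix T S assume TS: "T \<in> ?H" "S \<in> ?H"
    then obtain T' S' where h: "homeomorphism C C T T'" "homeomorphism C C S S'" by blast
    have "homeomorphism C C (T \<circ> S) (S' \<circ> T')" using h by (intro homeomorphism_compose)
    then have "homeomorphism C C (compose C T S) (S' \<circ> T')"
      by (rule homeomorphism_cong) (auto simp: compose_def)
    moreover have "p (compose C T S x) = p x" if "x \<in> C" for x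
    proof -
      have "S x \<in> C" using h(2) that by (auto simp: homeomorphism_def)
      then show ?thesis using TS that by (simp add: compose_def)
    qed
    moreover have "compose C T S \<in> Bij C" using TS compose_Bij by auto
    ultimately show "T \<otimes>\<^bsub>BijGroup C\<^esub> S \<in> ?H" using TS by (auto simp: BijGroup_def)
  qed
  from subgroup.subgroup_is_group[OF this group_BijGroup] show ?thesis
    by (simp add: deck_group_def)
qed

lemma deck_group_one: "\<one>\<^bsub>deck_group C p\<^esub> = (\<lambda>x\<in>C. x)"
  by (simp add: deck_group_def BijGroup_def)

lemma deck_continuous:
  assumes "T \<in> carrier (deck_group C p)"
  shows "continuous_on C T" "T ` C = C" "x \<in> C \<Longrightarrow> p (T x) = p x" "x \<in> C \<Longrightarrow> T x \<in> C"
  using assms unfolding deck_group_carrier homeomorphism_def by auto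

section \<open>Deck transformations as lifts of the covering map\<close>

locale cover =
  fixes C :: "'c::topological_space set" and p :: "'c \<Rightarrow> 'm::topological_space" and M and x0
  assumes cov: "covering_space C p M" and sc: "simply_connected C"
    and lpc: "locally path_connected C" and x0: "x0 \<in> C"
begin

abbreviation "G \<equiv> deck_group C p"

sublocale group G by (rule group_deck_group)

lemma pc: "path_connected C"
  using sc by (rule simply_connected_imp_path_connected_top)

lemma con: "connected C"
  using pc by (rule path_connected_imp_connected)

text \<open>Deck transformations are lifts of \<open>p\<close> through itself, so one value
  determines them. This allows the group to be studied through the points
  \<open>S x0\<close>.\<close>

lemma deck_eqI:
  assumes "T \<in> carrier G" "S \<in> carrier G" "T x0 = S x0"
  shows "T = S"
proof (rule extensionalityI[of _ C])
  show "T \<in> extensional C" "S \<in> extensional C" using assms by (auto simp: deck_group_carrier Bij_def)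
  show "T x = S x" if "x \<in> C" for x
    by (rule covering_lift_unique[where ?f1.0=T and ?f2.0=S and a=x0 and p=p, OF cov con _ _ _ _ _ x0 assms(3) that])
       (use deck_continuous[OF assms(1)] deck_continuous[OF assms(2)] in auto)
qed

lemma self_lift:
  assumes "x \<in> C" "y \<in> C" "p x = p y"
  obtains g where "continuous_on C g" "g ` C \<subseteq> C" "g x = y" "\<forall>z\<in>C. p (g z) = p z"
proof -
  have "continuous_on C p" "p ` C \<subseteq> M"
    using cov covering_space_imp_continuous covering_space_imp_surjective by blast+
  then show thesis
  proof (rule covering_lift_simply_connected[where f=p and p=p and z=x and e=y, OF cov sc pc lpc _ _ assms(1,2) assms(3)[symmetric]])
    fix k assume "continuous_on C k" "k ` C \<subseteq> C" "k x = y" "\<And>z. z \<in> C \<Longrightarrow> p (k z) = p z"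
    then show thesis by (intro that[of k]) auto
  qed
qed

lemma self_lift_inverse:
  assumes "continuous_on C g" "g ` C \<subseteq> C" "\<forall>z\<in>C. p (g z) = p z"
    and "continuous_on C k" "k ` C \<subseteq> C" "\<forall>z\<in>C. p (k z) = p z"
    and "x \<in> C" "k (g x) = x" "z \<in> C"
  shows "k (g z) = z"
proof (rule covering_lift_unique[OF cov con, of "\<lambda>z. k (g z)" "\<lambda>z. z" x])
  show "continuous_on C (\<lambda>z. k (g z))" by (rule continuous_on_compose2[OF assms(4,1,2)])
qed (use assms in auto)

text \<open>Lifts of \<open>p\<close> taking \<open>x\<close> to \<open>y\<close> and
  \<open>y\<close> to \<open>x\<close> are mutually inverse, since the composites and the identity
  are lifts that agree at one point.\<close>

lemma deck_exists:
  assumes xy: "x \<in> C" "y \<in> C" "p x = p y"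
  obtains T where "T \<in> carrier G" "T x = y"
proof -
  obtain g where g: "continuous_on C g" "g ` C \<subseteq> C" "g x = y" "\<forall>z\<in>C. p (g z) = p z"
    by (rule self_lift[OF xy])
  obtain k where k: "continuous_on C k" "k ` C \<subseteq> C" "k y = x" "\<forall>z\<in>C. p (k z) = p z"
    by (rule self_lift[OF xy(2,1) xy(3)[symmetric]])
  have kg: "k (g z) = z" and gk: "g (k z) = z" if "z \<in> C" for z
    using self_lift_inverse[OF g(1,2,4) k(1,2,4) xy(1) _ that] self_lift_inverse[OF k(1,2,4) g(1,2,4) xy(2) _ that] g(3) k(3)
    by auto
  have im: "g ` C = C" "k ` C = C"
  proof -
    show "g ` C = C"
    proof (rule antisym[OF g(2)], rule subsetI)
      fix z assume z: "z \<in> C"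
      then have "k z \<in> C" using k(2) by blast
      then show "z \<in> g ` C" using gk[OF z] by (metis image_eqI)
    qed
    show "k ` C = C"
    proof (rule antisym[OF k(2)], rule subsetI)
      fix z assume z: "z \<in> C"
      then have "g z \<in> C" using g(2) by blast
      then show "z \<in> k ` C" using kg[OF z] by (metis image_eqI)
    qed
  qed
  have "homeomorphism C C g k" using g k im kg gk by (auto simp: homeomorphism_def)
  \<comment> \<open>Members of \<open>Bij C\<close> are undefined outside \<open>C\<close>, hence
    the restriction.\<close>
  then have "homeomorphism C C (restrict g C) k" by (rule homeomorphism_cong) auto
  moreover have "restrict g C \<in> Bij C"
  proof -
    have "inj_on g C" using kg by (rule inj_on_inverseI)
    then show ?thesis using im by (simp add: Bij_def bij_betw_def)
  qed
  ultimately have "restrict g C \<in> carrier G" using g(4) by (auto simp: deck_group_carrier)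
  then show thesis using that[of "restrict g C"] g(3) xy(1) by simp
qed

text \<open>If \<open>l\<close> lifts the loop from \<open>x0\<close> to \<open>T x0\<close>, its
  translate by \<open>S\<close> leads from \<open>S x0\<close> to the point of the product. Having a
  lift for every \<open>S\<close> shows how right multiplication by \<open>T\<close> changes
  functions of \<open>S x0\<close>.\<close>

lemma deck_of_loop:
  assumes "path \<delta>" "path_image \<delta> \<subseteq> M" "pathstart \<delta> = p x0" "pathfinish \<delta> = p x0"
  obtains T where "T \<in> carrier G"
    "\<forall>S\<in>carrier G. \<exists>\<eta>. path \<eta> \<and> path_image \<eta> \<subseteq> C \<and> pathstart \<eta> = S x0 \<and>
       pathfinish \<eta> = (S \<otimes>\<^bsub>G\<^esub> T) x0 \<and> (\<forall>t\<in>{0..1}. p (\<eta> t) = \<delta> t)"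
proof -
  obtain l where l: "path l" "path_image l \<subseteq> C" "pathstart l = x0" "\<forall>t\<in>{0..1}. p (l t) = \<delta> t"
    by (rule covering_lift_path[OF cov assms(1,2) x0 assms(3)[symmetric]])
  have f: "pathfinish l \<in> C" "p x0 = p (pathfinish l)"
    using l assms(4) by (auto simp: path_image_def pathfinish_def)
  obtain T where T: "T \<in> carrier G" "T x0 = pathfinish l" by (rule deck_exists[OF x0 f])
  show thesis
  proof (rule that[OF T(1)], intro ballI)
    fix S assume S: "S \<in> carrier G"
    have "path (S \<circ> l)" using l(1,2) deck_continuous(1)[OF S] by (auto intro: path_continuous_image continuous_on_subset)
    moreover have "path_image (S \<circ> l) \<subseteq> C" using l(2) deck_continuous(4)[OF S] by (auto simp: path_image_def)
    moreover have "pathstart (S \<circ> l) = S x0" using l(3) by (simp add: pathstart_compose)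
    moreover have "pathfinish (S \<circ> l) = (S \<otimes>\<^bsub>G\<^esub> T) x0"
      by (simp add: pathfinish_compose deck_group_apply[OF S T(1) x0] T(2))
    moreover have "\<forall>t\<in>{0..1}. p ((S \<circ> l) t) = \<delta> t"
      using l(2,4) deck_continuous(3)[OF S] by (auto simp: path_image_def)
    ultimately show "\<exists>\<eta>. path \<eta> \<and> path_image \<eta> \<subseteq> C \<and> pathstart \<eta> = S x0 \<and>
       pathfinish \<eta> = (S \<otimes>\<^bsub>G\<^esub> T) x0 \<and> (\<forall>t\<in>{0..1}. p (\<eta> t) = \<delta> t)" by blast
  qed
qed

text \<open>The exponential covers the punctured plane; norm 1 makes the logarithm imaginary, so
  dividing its imaginary part by \<open>2 * pi\<close> gives a real lift.\<close>

lemma circle_lift: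
  assumes f: "continuous_on C f" "\<And>x. x \<in> C \<Longrightarrow> norm (f x :: complex) = 1" "f x0 = 1"
  obtains \<theta> where "continuous_on C \<theta>" "\<theta> x0 = (0 :: real)" "\<forall>x\<in>C. f x = cis (2 * pi * \<theta> x)"
proof -
  have "f ` C \<subseteq> - {0}" using f(2) by force
  then obtain l where l: "continuous_on C l" "l x0 = 0" "\<And>x. x \<in> C \<Longrightarrow> exp (l x) = f x"
    using covering_lift_simply_connected[OF covering_space_exp_punctured_plane sc pc lpc f(1) _ x0, of 0] f(3)
    by auto
  have "f x = cis (2 * pi * (Im (l x) / (2 * pi)))" if "x \<in> C" for x
  proof -
    have "exp (Re (l x)) = 1" using l(3)[OF that] f(2)[OF that] norm_exp_eq_Re[of "l x"] by simp
    then have "Re (l x) = 0" by simp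
    then have "l x = \<i> * complex_of_real (Im (l x))" by (simp add: complex_eq_iff)
    then show ?thesis using l(3)[OF that] by (simp add: cis_conv_exp)
  qed
  moreover have "continuous_on C (\<lambda>x. Im (l x) / (2 * pi))" using l(1) by (intro continuous_intros) auto
  ultimately show thesis using that[of "\<lambda>x. Im (l x) / (2 * pi)"] l(2) by simp
qed

end

section \<open>Winding of circle-valued maps along lifted paths\<close>

lemma cis_eq_one_iff: "cis (2 * pi * t) = 1 \<longleftrightarrow> t \<in> \<int>"
proof
  assume "cis (2 * pi * t) = 1"
  then have "cos (2 * pi * t) = 1" by (simp add: complex_eq_iff)
  then obtain n :: int where "2 * pi * t = real_of_int n * 2 * pi" using cos_one_2pi_int by blast
  then have "t = of_int n" by simp
  then show "t \<in> \<int>" by simp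
qed simp

lemma integer_valued_constant:
  fixes f :: "real \<Rightarrow> real"
  assumes f: "continuous_on {0..1} f" "\<And>t. t \<in> {0..1} \<Longrightarrow> f t \<in> \<int>" and t: "t \<in> {0..1}"
  shows "f t = f 0"
proof -
  have "f constant_on {0..1}"
  proof (rule continuous_discrete_range_constant[OF connected_Icc f(1)])
    fix x :: real assume x: "x \<in> {0..1}"
    have "1 \<le> norm (f y - f x)" if "y \<in> {0..1}" "f y \<noteq> f x" for y
      using Ints_nonzero_abs_ge1[of "f y - f x"] f(2) x that by auto
    then show "\<exists>e>0. \<forall>y. y \<in> {0..1} \<and> f y \<noteq> f x \<longrightarrow> e \<le> norm (f y - f x)"
      by (intro exI[of _ 1]) auto
  qed
  then show ?thesis using t unfolding constant_on_def by force
qed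

text \<open>The difference between \<open>f (l t)\<close> and \<open>c * t\<close> is continuous and
  integer-valued, hence constant. Equations on the circle thus become exact increments.\<close>

lemma winding_lift:
  fixes f :: "'c::topological_space \<Rightarrow> real"
  assumes f: "continuous_on C f" and l: "path l" "path_image l \<subseteq> C"
    and eq: "\<And>t. t \<in> {0..1} \<Longrightarrow> cis (2 * pi * f (l t)) = cis (2 * pi * (c * t))" and t: "t \<in> {0..1}"
  shows "f (l t) = f (l 0) + c * t"
proof -
  have "continuous_on {0..1} (\<lambda>t. f (l t) - c * t)"
    using l by (intro continuous_intros continuous_on_compose2[OF f]) (auto simp: path_def path_image_def)
  moreover have "f (l t) - c * t \<in> \<int>" if "t \<in> {0..1}" for t
  proof -
    have "cis (2 * pi * (f (l t) - c * t)) = cis (2 * pi * f (l t)) / cis (2 * pi * (c * t))"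
      by (simp add: cis_divide algebra_simps)
    also have "\<dots> = 1" using eq[OF that] by simp
    finally show ?thesis by (simp add: cis_eq_one_iff)
  qed
  ultimately have "f (l t) - c * t = f (l 0) - c * 0" using integer_valued_constant[OF _ _ t] by blast
  then show ?thesis by simp
qed

lemma winding_const:
  fixes f :: "'c::topological_space \<Rightarrow> real"
  assumes "continuous_on C f" "path l" "path_image l \<subseteq> C"
    and "\<And>t. t \<in> {0..1} \<Longrightarrow> cis (2 * pi * f (l t)) = 1" and "t \<in> {0..1}"
  shows "f (l t) = f (l 0)"
  using winding_lift[OF assms(1-3), of 0 t] assms(4,5) by simp

text \<open>
  The powers of 2 are cut off below at 1 to make the value at every integer an integer: then
  \<open>cis (2 * pi * (weight \<theta> * \<psi>))\<close> is 1 wherever \<open>\<theta>\<close> and \<open>\<psi>\<close> are both integers.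
\<close>

definition weight :: "real \<Rightarrow> real" where
  "weight t = max 1 (2 powr t)"

lemma weight_integer: "n \<in> \<int> \<Longrightarrow> weight n \<in> \<int>"
proof (cases "0 \<le> n")
  case True
  assume "n \<in> \<int>"
  then obtain k where "n = of_int k" by (auto elim: Ints_cases)
  then have "n = real (nat k)" using True by simp
  then have "2 powr n = 2 ^ nat k" by (simp add: powr_realpow)
  then show ?thesis using True by (simp add: weight_def max_def)
next
  case False
  then have "2 powr n \<le> 1" using powr_mono[of n 0 2] by simp
  then show ?thesis by (simp add: weight_def max_def)
qed

lemma continuous_weight: "continuous_on A weight"
  unfolding weight_def by (intro continuous_intros) auto

context cover
begin

text \<open>
  For \<open>u\<close>, \<open>v\<close> with lifts \<open>\<theta>\<close>, \<open>\<psi>\<close>, the function \<open>\<phi>\<close> integrates the closed form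
  \<open>weight \<theta> d\<psi>\<close>: it increases by \<open>weight \<theta>\<close> along a loop on which \<open>v\<close> winds once.  It exists because \<open>\<theta>\<close> is
  an integer wherever \<open>\<psi>\<close> is not one.
\<close>

lemma weighted_winding:
  assumes u: "continuous_on C u" "\<And>x. x \<in> C \<Longrightarrow> norm (u x :: complex) = 1" "u x0 = 1"
    and v: "continuous_on C v" "\<And>x. x \<in> C \<Longrightarrow> norm (v x :: complex) = 1" "v x0 = 1"
    and uv: "\<And>x. x \<in> C \<Longrightarrow> u x = 1 \<or> v x = 1"
  obtains \<theta> \<phi> :: "'c \<Rightarrow> real" where "\<theta> x0 = 0"
    "\<forall>l. path l \<and> path_image l \<subseteq> C \<and> (\<forall>t\<in>{0..1}. u (l t) = cis (2 * pi * t) \<and> v (l t) = 1) \<longrightarrow>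
       \<theta> (l 1) = \<theta> (l 0) + 1 \<and> \<phi> (l 1) = \<phi> (l 0)"
    "\<forall>l. path l \<and> path_image l \<subseteq> C \<and> (\<forall>t\<in>{0..1}. u (l t) = 1 \<and> v (l t) = cis (2 * pi * t)) \<longrightarrow>
       \<theta> (l 1) = \<theta> (l 0) \<and> \<phi> (l 1) = \<phi> (l 0) + weight (\<theta> (l 0))"
proof -
  obtain \<theta> where \<theta>: "continuous_on C \<theta>" "\<theta> x0 = 0" "\<forall>x\<in>C. u x = cis (2 * pi * \<theta> x)"
    by (rule circle_lift[OF u])
  obtain \<psi> where \<psi>: "continuous_on C \<psi>" "\<psi> x0 = 0" "\<forall>x\<in>C. v x = cis (2 * pi * \<psi> x)"
    by (rule circle_lift[OF v])
  \<comment> \<open>The exponential of the intended \<phi>. On \<open>A\<close> it is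
    \<open>v\<close> raised to the integer power \<open>weight (\<theta> x)\<close>, on
    \<open>B\<close> it is 1, and the two closed sets cover \<open>C\<close>.\<close>
  define Q where "Q x = (if u x = 1 then cis (2 * pi * (weight (\<theta> x) * \<psi> x)) else 1)" for x
  define A where "A = {x \<in> C. u x = 1}"
  define B where "B = {x \<in> C. v x = 1}"
  have AB: "A \<union> B = C" using uv by (auto simp: A_def B_def)
  have cl: "closedin (top_of_set C) A" "closedin (top_of_set C) B"
    unfolding A_def B_def using u(1) v(1)
    by (auto intro!: continuous_closedin_preimage_constant)
  have QB: "Q x = 1" if "x \<in> C" "v x = 1" for x
  proof -
    have "\<psi> x \<in> \<int>" using \<psi>(3) that by (metis cis_eq_one_iff)
    moreover have "weight (\<theta> x) \<in> \<int>" if "u x = 1"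
      using \<theta>(3) that \<open>x \<in> C\<close> by (intro weight_integer) (metis cis_eq_one_iff)
    ultimately show ?thesis by (auto simp: Q_def)
  qed
  have wc: "continuous_on A (\<lambda>x. weight (\<theta> x))"
    by (rule continuous_on_compose2[OF continuous_weight[of UNIV]])
       (use \<theta>(1) AB in \<open>auto intro: continuous_on_subset\<close>)
  have "continuous_on (A \<union> B) (\<lambda>x. if u x = 1 then cis (2 * pi * (weight (\<theta> x) * \<psi> x)) else 1)"
  proof (rule continuous_on_cases_local)
    show "continuous_on A (\<lambda>x. cis (2 * pi * (weight (\<theta> x) * \<psi> x)))"
      unfolding cis_conv_exp
      by (intro continuous_intros wc continuous_on_subset[OF \<psi>(1)]) (use AB in auto)
    show "cis (2 * pi * (weight (\<theta> x) * \<psi> x)) = 1" if "x \<in> A \<and> u x \<noteq> 1 \<or> x \<in> B \<and> u x = 1" for x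
      using that QB[of x] by (auto simp: A_def B_def Q_def)
  qed (use cl AB in auto)
  then have Qc: "continuous_on C Q" unfolding AB Q_def[abs_def] .
  have "norm (Q x) = 1" for x by (simp add: Q_def)
  moreover have "Q x0 = 1" using QB x0 v(3) by simp
  ultimately obtain \<phi> where \<phi>: "continuous_on C \<phi>" "\<phi> x0 = 0" "\<forall>x\<in>C. Q x = cis (2 * pi * \<phi> x)"
    using circle_lift[OF Qc] by metis
  have inC: "l t \<in> C" if "path_image l \<subseteq> C" "t \<in> {0..1}" for l and t :: real
    using that by (auto simp: path_image_def)
  show thesis
  proof (rule that[of \<theta> \<phi>, OF \<theta>(2)]; intro allI impI)
    fix l assume l: "path l \<and> path_image l \<subseteq> C \<and> (\<forall>t\<in>{0..1}. u (l t) = cis (2 * pi * t) \<and> v (l t) = 1)"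
    have "cis (2 * pi * \<theta> (l t)) = cis (2 * pi * (1 * t))" if "t \<in> {0..1}" for t
      using l \<theta>(3) inC that by (metis mult_1)
    then have "\<theta> (l 1) = \<theta> (l 0) + 1 * 1" using l by (intro winding_lift[OF \<theta>(1)]) auto
    moreover have "cis (2 * pi * \<phi> (l t)) = 1" if "t \<in> {0..1}" for t
      using l \<phi>(3) inC that QB by metis
    then have "\<phi> (l 1) = \<phi> (l 0)" using l by (intro winding_const[OF \<phi>(1)]) auto
    ultimately show "\<theta> (l 1) = \<theta> (l 0) + 1 \<and> \<phi> (l 1) = \<phi> (l 0)" by simp
  next
    fix l assume l: "path l \<and> path_image l \<subseteq> C \<and> (\<forall>t\<in>{0..1}. u (l t) = 1 \<and> v (l t) = cis (2 * pi * t))"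
    have th: "\<theta> (l t) = \<theta> (l 0)" if "t \<in> {0..1}" for t
      by (rule winding_const[OF \<theta>(1) _ _ _ that]) (use l \<theta>(3) inC in metis)+
    have "cis (2 * pi * \<psi> (l t)) = cis (2 * pi * (1 * t))" if "t \<in> {0..1}" for t
      using l \<psi>(3) inC that by (metis mult_1)
    then have ps: "\<psi> (l t) = \<psi> (l 0) + 1 * t" if "t \<in> {0..1}" for t
      using l that by (intro winding_lift[OF \<psi>(1)]) auto
    have "\<theta> (l 0) \<in> \<int>" "\<psi> (l 0) \<in> \<int>"
      using l \<theta>(3) \<psi>(3) inC[of l 0] by (auto simp flip: cis_eq_one_iff)
    then have int: "weight (\<theta> (l 0)) * \<psi> (l 0) \<in> \<int>" using weight_integer by auto
    have "cis (2 * pi * \<phi> (l t)) = cis (2 * pi * (weight (\<theta> (l 0)) * t))" if "t \<in> {0..1}" for t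
    proof -
      have "cis (2 * pi * \<phi> (l t)) = Q (l t)" using \<phi>(3) inC l that by metis
      also have "\<dots> = cis (2 * pi * (weight (\<theta> (l 0)) * \<psi> (l 0)) + 2 * pi * (weight (\<theta> (l 0)) * t))"
        using l that ps[OF that] th[OF that] by (simp add: Q_def algebra_simps)
      also have "\<dots> = cis (2 * pi * (weight (\<theta> (l 0)) * t))"
        using int by (simp add: cis_mult[symmetric])
      finally show ?thesis .
    qed
    then have "\<phi> (l 1) = \<phi> (l 0) + weight (\<theta> (l 0)) * 1" using l by (intro winding_lift[OF \<phi>(1)]) auto
    then show "\<theta> (l 1) = \<theta> (l 0) \<and> \<phi> (l 1) = \<phi> (l 0) + weight (\<theta> (l 0))" using th[of 1] by simp
  qed
qed

end

text \<open>The product of the two loops is a map of the square into \<open>S1 \<times> S2\<close>.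
  Its lift starting at \<open>x0\<close> reaches the opposite corner along either pair of edges,
  which gives the two products applied to \<open>x0\<close>.\<close>

lemma deck_commute:
  fixes C :: "'c::topological_space set" and p :: "'c \<Rightarrow> 'a::topological_space \<times> 'b::topological_space"
  assumes cover: "cover C p (S1 \<times> S2) x0" and px0: "p x0 = (b1, b2)"
    and \<alpha>: "path \<alpha>" "path_image \<alpha> \<subseteq> S1" "pathstart \<alpha> = b1" "pathfinish \<alpha> = b1"
    and \<gamma>: "path \<gamma>" "path_image \<gamma> \<subseteq> S2" "pathstart \<gamma> = b2" "pathfinish \<gamma> = b2"
    and T: "T \<in> carrier (deck_group C p)"
      "\<forall>S\<in>carrier (deck_group C p). \<exists>\<eta>. path \<eta> \<and> path_image \<eta> \<subseteq> C \<and> pathstart \<eta> = S x0 \<and>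
       pathfinish \<eta> = (S \<otimes>\<^bsub>deck_group C p\<^esub> T) x0 \<and> (\<forall>t\<in>{0..1}. p (\<eta> t) = (\<alpha> t, b2))"
    and R: "R \<in> carrier (deck_group C p)"
      "\<forall>S\<in>carrier (deck_group C p). \<exists>\<eta>. path \<eta> \<and> path_image \<eta> \<subseteq> C \<and> pathstart \<eta> = S x0 \<and>
       pathfinish \<eta> = (S \<otimes>\<^bsub>deck_group C p\<^esub> R) x0 \<and> (\<forall>t\<in>{0..1}. p (\<eta> t) = (b1, \<gamma> t))"
  shows "T \<otimes>\<^bsub>deck_group C p\<^esub> R = R \<otimes>\<^bsub>deck_group C p\<^esub> T"
proof -
  interpret cover C p "S1 \<times> S2" x0 by (rule cover)
  let ?h = "\<lambda>z. (\<alpha> (fst z), \<gamma> (snd z))"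
  have h1: "continuous_on ({0..1} \<times> {0..1}) ?h"
  proof (rule continuous_on_Pair)
    show "continuous_on ({0..1} \<times> {0..1::real}) (\<lambda>z. \<alpha> (fst z))"
      by (rule continuous_on_compose2[OF \<alpha>(1)[unfolded path_def]]) (auto intro!: continuous_intros)
    show "continuous_on ({0..1::real} \<times> {0..1}) (\<lambda>z. \<gamma> (snd z))"
      by (rule continuous_on_compose2[OF \<gamma>(1)[unfolded path_def]]) (auto intro!: continuous_intros)
  qed
  have h2: "?h ` ({0..1} \<times> {0..1}) \<subseteq> S1 \<times> S2" using \<alpha>(2) \<gamma>(2) by (auto simp: path_image_def)
  have h3: "p x0 = ?h (0, 0)" using px0 \<alpha>(3) \<gamma>(3) by (simp add: pathstart_def)
  obtain k where k: "continuous_on ({0..1} \<times> {0..1}) k" "k ` ({0..1} \<times> {0..1}) \<subseteq> C" "k (0, 0) = x0"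
    "\<forall>s\<in>{0..1}. \<forall>t\<in>{0..1}. p (k (s, t)) = ?h (s, t)"
    by (rule covering_lift_square[OF cov h1 h2 x0 h3])
  have pk: "path (\<lambda>t. k (s, t))" "path (\<lambda>t. k (t, s))" if "s \<in> {0..1}" for s
    unfolding path_def using that by (auto intro!: continuous_on_compose2[OF k(1)] continuous_intros)
  have ik: "path_image (\<lambda>t. k (s, t)) \<subseteq> C" "path_image (\<lambda>t. k (t, s)) \<subseteq> C" if "s \<in> {0..1}" for s
    using that k(2) by (auto simp: path_image_def)
  have edge: "l 1 = pathfinish \<eta>"
    if "path l" "path_image l \<subseteq> C" "path \<eta>" "path_image \<eta> \<subseteq> C" "l 0 = pathstart \<eta>"
      "\<And>t. t \<in> {0..1} \<Longrightarrow> p (l t) = p (\<eta> t)" for l \<eta>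
    unfolding pathfinish_def
    by (rule covering_path_lift_unique[OF cov that(1-4), where a=0]) (use that in \<open>auto simp: pathstart_def\<close>)
  have ends: "\<alpha> 0 = b1" "\<alpha> 1 = b1" "\<gamma> 0 = b2" "\<gamma> 1 = b2"
    using \<alpha> \<gamma> by (auto simp: pathstart_def pathfinish_def)
  have one: "\<one>\<^bsub>G\<^esub> x0 = x0" using x0 by (simp add: deck_group_one)
  have "k (1, 0) = T x0"
  proof -
    obtain \<eta> where \<eta>: "path \<eta>" "path_image \<eta> \<subseteq> C" "pathstart \<eta> = \<one>\<^bsub>G\<^esub> x0"
       "pathfinish \<eta> = (\<one>\<^bsub>G\<^esub> \<otimes>\<^bsub>G\<^esub> T) x0" "\<forall>t\<in>{0..1}. p (\<eta> t) = (\<alpha> t, b2)"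
      using T(2) one_closed by blast
    have "k (1, 0) = pathfinish \<eta>"
      by (rule edge[of "\<lambda>t. k (t, 0)"]) (use \<eta> pk ik k one ends in auto)
    then show ?thesis using \<eta>(4) T(1) by simp
  qed
  moreover have "k (0, 1) = R x0"
  proof -
    obtain \<eta> where \<eta>: "path \<eta>" "path_image \<eta> \<subseteq> C" "pathstart \<eta> = \<one>\<^bsub>G\<^esub> x0"
       "pathfinish \<eta> = (\<one>\<^bsub>G\<^esub> \<otimes>\<^bsub>G\<^esub> R) x0" "\<forall>t\<in>{0..1}. p (\<eta> t) = (b1, \<gamma> t)"
      using R(2) one_closed by blast
    have "k (0, 1) = pathfinish \<eta>"
      by (rule edge[of "\<lambda>t. k (0, t)"]) (use \<eta> pk ik k one ends in auto)
    then show ?thesis using \<eta>(4) R(1) by simp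
  qed
  moreover have "k (1, 1) = (T \<otimes>\<^bsub>G\<^esub> R) x0" if "k (1, 0) = T x0"
  proof -
    obtain \<eta> where \<eta>: "path \<eta>" "path_image \<eta> \<subseteq> C" "pathstart \<eta> = T x0"
       "pathfinish \<eta> = (T \<otimes>\<^bsub>G\<^esub> R) x0" "\<forall>t\<in>{0..1}. p (\<eta> t) = (b1, \<gamma> t)"
      using R(2) T(1) by blast
    have "k (1, 1) = pathfinish \<eta>"
      by (rule edge[of "\<lambda>t. k (1, t)"]) (use \<eta> pk ik k that ends in auto)
    then show ?thesis using \<eta>(4) by simp
  qed
  moreover have "k (1, 1) = (R \<otimes>\<^bsub>G\<^esub> T) x0" if "k (0, 1) = R x0"
  proof -
    obtain \<eta> where \<eta>: "path \<eta>" "path_image \<eta> \<subseteq> C" "pathstart \<eta> = R x0"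
       "pathfinish \<eta> = (R \<otimes>\<^bsub>G\<^esub> T) x0" "\<forall>t\<in>{0..1}. p (\<eta> t) = (\<alpha> t, b2)"
      using T(2) R(1) by blast
    have "k (1, 1) = pathfinish \<eta>"
      by (rule edge[of "\<lambda>t. k (t, 1)"]) (use \<eta> pk ik k that ends in auto)
    then show ?thesis using \<eta>(4) by simp
  qed
  ultimately have "(T \<otimes>\<^bsub>G\<^esub> R) x0 = (R \<otimes>\<^bsub>G\<^esub> T) x0" by simp
  then show ?thesis using T(1) R(1) by (intro deck_eqI) auto
qed

text \<open>Here \<open>a\<close> and \<open>b\<close> come from one loop in each of the first two
  handles of the first surface, and \<open>c\<close> from a loop in the second. The values \<theta>,
  \<phi>, \<kappa> at \<open>S\<close> are those of functions on the cover at \<open>S x0\<close>;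
  \<kappa> counts windings of \<open>c\<close> and shows that its order is infinite.\<close>

theorem surface_product_deck_group:
  fixes S1 :: "'a::topological_space set" and A1 :: "('a, 2) chart set"
    and S2 :: "'b::topological_space set" and A2 :: "('b, 2) chart set"
    and C :: "'c::topological_space set" and p :: "'c \<Rightarrow> 'a \<times> 'b"
  assumes g: "g \<ge> 2" and h: "h \<ge> 1"
    and S1: "closed_oriented_surface g S1 A1" and S2: "closed_oriented_surface h S2 A2"
    and cover: "universal_cover C p (S1 \<times> S2)"
  obtains a b c \<theta> \<phi> \<kappa> where "a \<in> carrier (deck_group C p)" "b \<in> carrier (deck_group C p)" "c \<in> carrier (deck_group C p)"
    "a \<otimes>\<^bsub>deck_group C p\<^esub> c = c \<otimes>\<^bsub>deck_group C p\<^esub> a" "b \<otimes>\<^bsub>deck_group C p\<^esub> c = c \<otimes>\<^bsub>deck_group C p\<^esub> b"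
    "\<theta> \<one>\<^bsub>deck_group C p\<^esub> = (0 :: real)"
    "\<forall>S\<in>carrier (deck_group C p). \<theta> (S \<otimes>\<^bsub>deck_group C p\<^esub> a) = \<theta> S + 1 \<and> \<phi> (S \<otimes>\<^bsub>deck_group C p\<^esub> a) = (\<phi> S :: real)"
    "\<forall>S\<in>carrier (deck_group C p). \<theta> (S \<otimes>\<^bsub>deck_group C p\<^esub> b) = \<theta> S \<and> \<phi> (S \<otimes>\<^bsub>deck_group C p\<^esub> b) = \<phi> S + weight (\<theta> S)"
    "\<forall>S\<in>carrier (deck_group C p). \<kappa> (S \<otimes>\<^bsub>deck_group C p\<^esub> c) = (\<kappa> S + 1 :: real)"
proof -
  have cov: "covering_space C p (S1 \<times> S2)" and sc: "simply_connected C"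
    using cover by (auto simp: universal_cover_def)
  have gen: "has_genus S1 g" "has_genus S2 h" using S1 S2 by (auto simp: closed_oriented_surface_def)
  have "locally path_connected S1" "locally path_connected S2"
    using S1 S2 locally_path_connected_charts[of A1 S1] locally_path_connected_charts[of A2 S2]
    unfolding closed_oriented_surface_def oriented_manifold_def by blast+
  then have lpc: "locally path_connected C"
    using locally_path_connected_cover[OF cov] locally_path_connected_Times by blast
  have g01: "0 < g" "1 < g" "0 < h" using g h by auto
  obtain b1 u \<alpha> where b1: "b1 \<in> S1"
    and u: "\<forall>k<g. continuous_on S1 (u k)" "\<forall>k<g. \<forall>x\<in>S1. norm (u k x :: complex) = 1"
      "\<forall>k<g. \<forall>l<g. \<forall>x\<in>S1. k \<noteq> l \<longrightarrow> u k x = 1 \<or> u l x = 1"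
    and \<alpha>: "\<forall>k<g. path (\<alpha> k) \<and> path_image (\<alpha> k) \<subseteq> S1 \<and> pathstart (\<alpha> k) = b1 \<and> pathfinish (\<alpha> k) = b1"
      "\<forall>k<g. \<forall>l<g. \<forall>t\<in>{0..1}. u k (\<alpha> l t) = (if k = l then cis (2 * pi * t) else 1)"
    by (rule surface_circle_maps[OF gen(1) g01(1)])
  obtain b2 w \<beta> where b2: "b2 \<in> S2"
    and w: "\<forall>k<h. continuous_on S2 (w k)" "\<forall>k<h. \<forall>x\<in>S2. norm (w k x :: complex) = 1"
      "\<forall>k<h. \<forall>l<h. \<forall>x\<in>S2. k \<noteq> l \<longrightarrow> w k x = 1 \<or> w l x = 1"
    and \<beta>: "\<forall>k<h. path (\<beta> k) \<and> path_image (\<beta> k) \<subseteq> S2 \<and> pathstart (\<beta> k) = b2 \<and> pathfinish (\<beta> k) = b2"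
      "\<forall>k<h. \<forall>l<h. \<forall>t\<in>{0..1}. w k (\<beta> l t) = (if k = l then cis (2 * pi * t) else 1)"
    by (rule surface_circle_maps[OF gen(2) g01(3)])
  note u = u[rule_format] and \<alpha> = \<alpha>[rule_format] and w = w[rule_format] and \<beta> = \<beta>[rule_format]
  have "(b1, b2) \<in> p ` C" using b1 b2 covering_space_imp_surjective[OF cov] by simp
  then obtain x0 where bx: "x0 \<in> C" "p x0 = (b1, b2)" by auto
  interpret cover C p "S1 \<times> S2" x0 by unfold_locales (fact cov sc lpc bx)+
  have pS: "fst (p x) \<in> S1" "snd (p x) \<in> S2" if "x \<in> C" for x
  proof -
    have "p x \<in> S1 \<times> S2" using covering_space_imp_surjective[OF cov] that by blast
    then show "fst (p x) \<in> S1" "snd (p x) \<in> S2" by auto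
  qed
  have cp: "continuous_on C (\<lambda>x. fst (p x))" "continuous_on C (\<lambda>x. snd (p x))"
    using covering_space_imp_continuous[OF cov] by (auto intro: continuous_intros)
  define U where "U k x = u k (fst (p x))" for k x
  define W where "W x = w 0 (snd (p x))" for x
  have Uc: "continuous_on C (U k)" if "k < g" for k
    unfolding U_def by (rule continuous_on_compose2[OF u(1)[OF that] cp(1)]) (use pS in auto)
  have Wc: "continuous_on C W"
    unfolding W_def by (rule continuous_on_compose2[OF w(1)[OF g01(3)] cp(2)]) (use pS in auto)
  have start: "\<alpha> k 0 = b1" "\<beta> l 0 = b2" if "k < g" "l < h" for k l
    using \<alpha>(1)[OF that(1)] \<beta>(1)[OF that(2)] by (auto simp: pathstart_def)
  have U1: "U k x0 = 1" if "k < g" for k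
    using \<alpha>(2)[OF that g01(1), of 0] start[OF g01(1,3)] bx(2) by (auto simp: U_def split: if_splits)
  have W1: "W x0 = 1"
    using \<beta>(2)[OF g01(3) g01(3), of 0] start[OF g01(1,3)] bx(2) by (auto simp: W_def)
  obtain \<theta> \<phi> :: "'c \<Rightarrow> real" where \<theta>0: "\<theta> x0 = 0"
    and A: "\<forall>l. path l \<and> path_image l \<subseteq> C \<and> (\<forall>t\<in>{0..1}. U 0 (l t) = cis (2 * pi * t) \<and> U 1 (l t) = 1) \<longrightarrow>
       \<theta> (l 1) = \<theta> (l 0) + 1 \<and> \<phi> (l 1) = \<phi> (l 0)"
    and B: "\<forall>l. path l \<and> path_image l \<subseteq> C \<and> (\<forall>t\<in>{0..1}. U 0 (l t) = 1 \<and> U 1 (l t) = cis (2 * pi * t)) \<longrightarrow>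
       \<theta> (l 1) = \<theta> (l 0) \<and> \<phi> (l 1) = \<phi> (l 0) + weight (\<theta> (l 0))"
  proof (rule weighted_winding[of "U 0" "U 1"])
    show "U 0 x = 1 \<or> U 1 x = 1" if "x \<in> C" for x
      using u(3)[OF g01(1,2)] pS(1)[OF that] by (simp add: U_def)
  qed (use Uc U1 g01 u(2) pS in \<open>auto simp: U_def\<close>)
  obtain \<kappa> where \<kappa>: "continuous_on C \<kappa>" "\<kappa> x0 = (0 :: real)" "\<forall>x\<in>C. W x = cis (2 * pi * \<kappa> x)"
    by (rule circle_lift[OF Wc]) (use w(2) g01 pS W1 in \<open>auto simp: W_def\<close>)
  have loop1: "path (\<lambda>t. (\<alpha> k t, b2))" "path_image (\<lambda>t. (\<alpha> k t, b2)) \<subseteq> S1 \<times> S2"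
    "pathstart (\<lambda>t. (\<alpha> k t, b2)) = p x0" "pathfinish (\<lambda>t. (\<alpha> k t, b2)) = p x0" if "k < g" for k
    using \<alpha>(1)[OF that] b2 bx by (auto simp: path_def path_image_def pathstart_def pathfinish_def intro!: continuous_intros)
  have loop2: "path (\<lambda>t. (b1, \<beta> 0 t))" "path_image (\<lambda>t. (b1, \<beta> 0 t)) \<subseteq> S1 \<times> S2"
    "pathstart (\<lambda>t. (b1, \<beta> 0 t)) = p x0" "pathfinish (\<lambda>t. (b1, \<beta> 0 t)) = p x0"
    using \<beta>(1)[OF g01(3)] b1 bx by (auto simp: path_def path_image_def pathstart_def pathfinish_def intro!: continuous_intros)
  obtain a where a: "a \<in> carrier G" "\<forall>S\<in>carrier G. \<exists>\<eta>. path \<eta> \<and> path_image \<eta> \<subseteq> C \<and> pathstart \<eta> = S x0 \<and>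
       pathfinish \<eta> = (S \<otimes>\<^bsub>G\<^esub> a) x0 \<and> (\<forall>t\<in>{0..1}. p (\<eta> t) = (\<alpha> 0 t, b2))"
    by (rule deck_of_loop[OF loop1[OF g01(1)]])
  obtain b where b: "b \<in> carrier G" "\<forall>S\<in>carrier G. \<exists>\<eta>. path \<eta> \<and> path_image \<eta> \<subseteq> C \<and> pathstart \<eta> = S x0 \<and>
       pathfinish \<eta> = (S \<otimes>\<^bsub>G\<^esub> b) x0 \<and> (\<forall>t\<in>{0..1}. p (\<eta> t) = (\<alpha> 1 t, b2))"
    by (rule deck_of_loop[OF loop1[OF g01(2)]])
  obtain c where c: "c \<in> carrier G" "\<forall>S\<in>carrier G. \<exists>\<eta>. path \<eta> \<and> path_image \<eta> \<subseteq> C \<and> pathstart \<eta> = S x0 \<and>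
       pathfinish \<eta> = (S \<otimes>\<^bsub>G\<^esub> c) x0 \<and> (\<forall>t\<in>{0..1}. p (\<eta> t) = (b1, \<beta> 0 t))"
    by (rule deck_of_loop[OF loop2])
  have "cover C p (S1 \<times> S2) x0" by unfold_locales
  note comm = deck_commute[OF this bx(2)]
  show thesis
  proof (rule that[of a b c "\<lambda>S. \<theta> (S x0)" "\<lambda>S. \<phi> (S x0)" "\<lambda>S. \<kappa> (S x0)"])
    show "a \<otimes>\<^bsub>G\<^esub> c = c \<otimes>\<^bsub>G\<^esub> a" by (rule comm[OF _ _ _ _ _ _ _ _ a c]) (use \<alpha>(1)[OF g01(1)] \<beta>(1)[OF g01(3)] in auto)
    show "b \<otimes>\<^bsub>G\<^esub> c = c \<otimes>\<^bsub>G\<^esub> b" by (rule comm[OF _ _ _ _ _ _ _ _ b c]) (use \<alpha>(1)[OF g01(2)] \<beta>(1)[OF g01(3)] in auto)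
    show "\<theta> (\<one>\<^bsub>G\<^esub> x0) = 0" using \<theta>0 bx(1) by (simp add: deck_group_one)
    show "\<forall>S\<in>carrier G. \<theta> ((S \<otimes>\<^bsub>G\<^esub> a) x0) = \<theta> (S x0) + 1 \<and> \<phi> ((S \<otimes>\<^bsub>G\<^esub> a) x0) = \<phi> (S x0)"
    proof
      fix S assume "S \<in> carrier G"
      then obtain \<eta> where \<eta>: "path \<eta>" "path_image \<eta> \<subseteq> C" "pathstart \<eta> = S x0"
       "pathfinish \<eta> = (S \<otimes>\<^bsub>G\<^esub> a) x0" "\<forall>t\<in>{0..1}. p (\<eta> t) = (\<alpha> 0 t, b2)" using a(2) by blast
      have "\<forall>t\<in>{0..1}. U 0 (\<eta> t) = cis (2 * pi * t) \<and> U 1 (\<eta> t) = 1"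
        using \<eta>(5) \<alpha>(2)[OF g01(1) g01(1)] \<alpha>(2)[OF g01(2) g01(1)] by (simp add: U_def)
      then show "\<theta> ((S \<otimes>\<^bsub>G\<^esub> a) x0) = \<theta> (S x0) + 1 \<and> \<phi> ((S \<otimes>\<^bsub>G\<^esub> a) x0) = \<phi> (S x0)"
        using A[rule_format, of \<eta>] \<eta>(1-4) by (simp add: pathstart_def pathfinish_def)
    qed
    show "\<forall>S\<in>carrier G. \<theta> ((S \<otimes>\<^bsub>G\<^esub> b) x0) = \<theta> (S x0) \<and> \<phi> ((S \<otimes>\<^bsub>G\<^esub> b) x0) = \<phi> (S x0) + weight (\<theta> (S x0))"
    proof
      fix S assume "S \<in> carrier G"
      then obtain \<eta> where \<eta>: "path \<eta>" "path_image \<eta> \<subseteq> C" "pathstart \<eta> = S x0"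
       "pathfinish \<eta> = (S \<otimes>\<^bsub>G\<^esub> b) x0" "\<forall>t\<in>{0..1}. p (\<eta> t) = (\<alpha> 1 t, b2)" using b(2) by blast
      have "\<forall>t\<in>{0..1}. U 0 (\<eta> t) = 1 \<and> U 1 (\<eta> t) = cis (2 * pi * t)"
        using \<eta>(5) \<alpha>(2)[OF g01(1) g01(2)] \<alpha>(2)[OF g01(2) g01(2)] by (simp add: U_def)
      then show "\<theta> ((S \<otimes>\<^bsub>G\<^esub> b) x0) = \<theta> (S x0) \<and> \<phi> ((S \<otimes>\<^bsub>G\<^esub> b) x0) = \<phi> (S x0) + weight (\<theta> (S x0))"
        using B[rule_format, of \<eta>] \<eta>(1-4) by (simp add: pathstart_def pathfinish_def)
    qed
    show "\<forall>S\<in>carrier G. \<kappa> ((S \<otimes>\<^bsub>G\<^esub> c) x0) = \<kappa> (S x0) + 1"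
    proof
      fix S assume "S \<in> carrier G"
      then obtain \<eta> where \<eta>: "path \<eta>" "path_image \<eta> \<subseteq> C" "pathstart \<eta> = S x0"
       "pathfinish \<eta> = (S \<otimes>\<^bsub>G\<^esub> c) x0" "\<forall>t\<in>{0..1}. p (\<eta> t) = (b1, \<beta> 0 t)" using c(2) by blast
      have "cis (2 * pi * \<kappa> (\<eta> t)) = cis (2 * pi * (1 * t))" if "t \<in> {0..1}" for t
      proof -
        have "\<eta> t \<in> C" using \<eta>(2) that by (auto simp: path_image_def)
        then have "cis (2 * pi * \<kappa> (\<eta> t)) = W (\<eta> t)" using \<kappa>(3) by simp
        then show ?thesis using \<eta>(5) that \<beta>(2)[OF g01(3) g01(3) that] by (simp add: W_def)
      qed
      then have "\<kappa> (\<eta> 1) = \<kappa> (\<eta> 0) + 1 * 1" by (intro winding_lift[OF \<kappa>(1) \<eta>(1,2)]) auto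
      then show "\<kappa> ((S \<otimes>\<^bsub>G\<^esub> c) x0) = \<kappa> (S x0) + 1" using \<eta>(3,4) by (simp add: pathstart_def pathfinish_def)
    qed
  qed (use a b c in auto)
qed

subsection \<open>Commutators in the deck group\<close>

definition commutator :: "('g, 'm) monoid_scheme \<Rightarrow> 'g \<Rightarrow> 'g \<Rightarrow> 'g" where
  "commutator G x y = x \<otimes>\<^bsub>G\<^esub> y \<otimes>\<^bsub>G\<^esub> inv\<^bsub>G\<^esub> x \<otimes>\<^bsub>G\<^esub> inv\<^bsub>G\<^esub> y"

text \<open>Nesting with the same outer \<open>x\<close> gives elements that are eventually trivial
  in any nilpotent group, and to which the contraction estimate for commutators applies at each
  step.\<close>

primrec iterated_commutator :: "('g, 'm) monoid_scheme \<Rightarrow> 'g \<Rightarrow> 'g \<Rightarrow> nat \<Rightarrow> 'g" where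
  "iterated_commutator G x y 0 = y"
| "iterated_commutator G x y (Suc k) = commutator G x (iterated_commutator G x y k)"

lemma (in group) commutator_closed [simp]:
  "x \<in> carrier G \<Longrightarrow> y \<in> carrier G \<Longrightarrow> commutator G x y \<in> carrier G"
  by (simp add: commutator_def)

text \<open>A form without inverses, suited to comparing affine maps.\<close>

lemma (in group) commutator_mult:
  assumes "x \<in> carrier G" "y \<in> carrier G"
  shows "commutator G x y \<otimes> (y \<otimes> x) = x \<otimes> y"
  using assms by (simp add: commutator_def m_assoc inv_solve_left' flip: m_assoc)
    (simp add: m_assoc)

text \<open>With \<open>weight t\<close> read as \<open>2 powr t\<close>, these are the rules of
  right multiplication in the affine group, by doubling and by the unit translation. \<theta> and
  \<phi> are mere functions on the group; the cut-off weight obeys the affine rule for nonnegative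
  \<theta>.\<close>

locale weighted_counting = group G for G (structure) +
  fixes a b :: 'a and \<theta> \<phi> :: "'a \<Rightarrow> real"
  assumes a: "a \<in> carrier G" and b: "b \<in> carrier G" and \<theta>_one: "\<theta> \<one> = 0"
    and act_a: "S \<in> carrier G \<Longrightarrow> \<theta> (S \<otimes> a) = \<theta> S + 1 \<and> \<phi> (S \<otimes> a) = \<phi> S"
    and act_b: "S \<in> carrier G \<Longrightarrow> \<theta> (S \<otimes> b) = \<theta> S \<and> \<phi> (S \<otimes> b) = \<phi> S + weight (\<theta> S)"
begin

text \<open>The counterpart of being a translation of the line. The amount depends on \<theta>
  because right multiplication by a translation is scaled by the linear part of what stands to its
  left.\<close>

definition shifts :: "'a \<Rightarrow> (real \<Rightarrow> real) \<Rightarrow> bool" where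
  "shifts z f \<longleftrightarrow> z \<in> carrier G \<and> (\<forall>S\<in>carrier G. \<theta> (S \<otimes> z) = \<theta> S \<and> \<phi> (S \<otimes> z) = \<phi> S + f (\<theta> S))"

lemma pow_a:
  "S \<in> carrier G \<Longrightarrow> \<theta> (S \<otimes> a [^] (N::nat)) = \<theta> S + N \<and> \<phi> (S \<otimes> a [^] N) = \<phi> S"
proof (induction N)
  case (Suc N)
  have "S \<otimes> a [^] Suc N = (S \<otimes> a [^] N) \<otimes> a" using Suc.prems a by (simp add: m_assoc)
  then show ?case using Suc act_a[of "S \<otimes> a [^] N"] a by simp
qed simp

lemma inv_pow_a:
  assumes "S \<in> carrier G"
  shows "\<theta> (S \<otimes> inv (a [^] (N::nat))) = \<theta> S - N \<and> \<phi> (S \<otimes> inv (a [^] N)) = \<phi> S"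
  using pow_a[of "S \<otimes> inv (a [^] N)" N] assms a by (simp add: m_assoc)

lemma shifts_inv:
  assumes "shifts z f"
  shows "shifts (inv z) (\<lambda>t. - f t)"
proof -
  have z: "z \<in> carrier G" using assms by (simp add: shifts_def)
  have "\<theta> (S \<otimes> inv z) = \<theta> S \<and> \<phi> (S \<otimes> inv z) = \<phi> S - f (\<theta> S)" if S: "S \<in> carrier G" for S
  proof -
    have "S \<otimes> inv z \<in> carrier G" "S \<otimes> inv z \<otimes> z = S" using S z by (simp_all add: m_assoc)
    then have "\<theta> S = \<theta> (S \<otimes> inv z) \<and> \<phi> S = \<phi> (S \<otimes> inv z) + f (\<theta> (S \<otimes> inv z))"
      using assms unfolding shifts_def by metis
    then show ?thesis by simp
  qed
  then show ?thesis using z by (simp add: shifts_def)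
qed

lemma shifts_mult:
  assumes "shifts y f" "shifts z h"
  shows "shifts (y \<otimes> z) (\<lambda>t. f t + h t)"
  using assms by (auto simp: shifts_def simp flip: m_assoc)

lemma shifts_pow: "shifts z f \<Longrightarrow> shifts (z [^] (m::nat)) (\<lambda>t. m * f t)"
proof (induction m)
  case 0
  then show ?case by (simp add: shifts_def)
next
  case (Suc m)
  then show ?case using shifts_mult[OF Suc.IH[OF Suc.prems] Suc.prems] by (simp add: algebra_simps)
qed

text \<open>Conjugation by the power of \<open>a\<close> moves the argument of \<open>f\<close> by
  \<open>N\<close>, and shifts add up, so the commutator acts by a finite difference of
  \<open>f\<close>.\<close>

lemma shifts_commutator:
  assumes "shifts z f"
  shows "shifts (commutator G (a [^] (N::nat)) z) (\<lambda>t. f (t + N) - f t)"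
proof -
  have z: "z \<in> carrier G" using assms by (simp add: shifts_def)
  let ?X = "a [^] N"
  have X: "?X \<in> carrier G" using a by simp
  have "\<theta> (S \<otimes> commutator G ?X z) = \<theta> S \<and> \<phi> (S \<otimes> commutator G ?X z) = \<phi> S + (f (\<theta> S + N) - f (\<theta> S))"
    if S: "S \<in> carrier G" for S
  proof -
    have e: "S \<otimes> commutator G ?X z = S \<otimes> ?X \<otimes> z \<otimes> inv ?X \<otimes> inv z"
      unfolding commutator_def using S X z by (simp add: m_assoc)
    have "\<theta> (S \<otimes> ?X \<otimes> z) = \<theta> S + N \<and> \<phi> (S \<otimes> ?X \<otimes> z) = \<phi> S + f (\<theta> S + N)"
      using assms pow_a[OF S, of N] S X unfolding shifts_def by simp
    then have "\<theta> (S \<otimes> ?X \<otimes> z \<otimes> inv ?X) = \<theta> S \<and> \<phi> (S \<otimes> ?X \<otimes> z \<otimes> inv ?X) = \<phi> S + f (\<theta> S + N)"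
      using inv_pow_a[of "S \<otimes> ?X \<otimes> z" N] S X z by simp
    then show ?thesis using shifts_inv[OF assms] S X z unfolding shifts_def e by simp
  qed
  then show ?thesis using X z by (simp add: shifts_def)
qed

text \<open>The finite difference with step \<open>N\<close> multiplies \<open>2 powr t\<close> by
  \<open>2 ^ N - 1\<close>. The claim is confined to \<open>t \<ge> 0\<close>, where the weight is
  not cut off; the step leads upwards, so the range is preserved, and it contains \<theta> of the
  unit element.\<close>

lemma shifts_iterated_commutator:
  fixes N :: nat
  shows "\<exists>f. shifts (iterated_commutator G (a [^] N) (b [^] N) k) f \<and>
     (\<forall>t\<ge>0. f t = real N * (2 ^ N - 1) ^ k * 2 powr t)"
proof (induction k)
  case 0
  have "shifts b weight" using b act_b by (simp add: shifts_def)
  from shifts_pow[OF this, of N] show ?case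
  proof (intro exI conjI allI impI)
    fix t :: real assume "0 \<le> t"
    then have "1 \<le> 2 powr t" by (simp add: ge_one_powr_ge_zero)
    then show "real N * weight t = real N * (2 ^ N - 1) ^ 0 * 2 powr t" by (simp add: weight_def)
  qed simp
next
  case (Suc k)
  then obtain f where f: "shifts (iterated_commutator G (a [^] N) (b [^] N) k) f"
    "\<forall>t\<ge>0. f t = real N * (2 ^ N - 1) ^ k * 2 powr t" by blast
  from shifts_commutator[OF f(1), of N] show ?case
  proof (intro exI conjI allI impI)
    fix t :: real assume t: "0 \<le> t"
    show "f (t + N) - f t = real N * (2 ^ N - 1) ^ Suc k * 2 powr t"
      using f(2) t by (simp add: powr_add powr_realpow algebra_simps)
  qed simp
qed

lemma shifts_nontrivial: "shifts z f \<Longrightarrow> f 0 \<noteq> 0 \<Longrightarrow> z \<noteq> \<one>"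
  by (auto simp: shifts_def \<theta>_one dest: bspec[of _ _ \<one>])

lemma iterated_commutator_nontrivial:
  assumes "1 \<le> (N::nat)"
  shows "iterated_commutator G (a [^] N) (b [^] N) k \<noteq> \<one>"
proof -
  obtain f where f: "shifts (iterated_commutator G (a [^] N) (b [^] N) k) f"
    "f 0 = real N * (2 ^ N - 1) ^ k * 2 powr 0"
    using shifts_iterated_commutator[of N k] by auto
  have "1 < (2::real) ^ N" using assms by (intro one_less_power) auto
  then have "((2::real) ^ N - 1) ^ k \<noteq> 0" by (intro power_not_zero) linarith
  then have "f 0 \<noteq> 0" unfolding f(2) by (intro no_zero_divisors) (use assms in auto)
  then show ?thesis using shifts_nontrivial[OF f(1)] by simp
qed

text \<open>This is the iterated commutator with exponent 2 and depth 1: it shifts \<phi> of the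
  unit element by 6, and its power by \<open>6 * m\<close>.\<close>

lemma commutator_infinite_order:
  assumes "1 \<le> (m::nat)"
  shows "commutator G (a [^] (2::nat)) (b [^] (2::nat)) [^] m \<noteq> \<one>"
proof -
  obtain f where f: "shifts (iterated_commutator G (a [^] (2::nat)) (b [^] (2::nat)) 1) f"
    "f 0 = real 2 * (2 ^ 2 - 1) ^ 1 * 2 powr 0"
    using shifts_iterated_commutator[of 2 1] by auto
  then show ?thesis
    using shifts_nontrivial[OF shifts_pow[OF f(1), of m]] assms by simp
qed

end

lemma (in group) counter_infinite_order:
  fixes \<kappa> :: "'a \<Rightarrow> real"
  assumes c: "c \<in> carrier G" "\<And>S. S \<in> carrier G \<Longrightarrow> \<kappa> (S \<otimes> c) = \<kappa> S + 1" and m: "1 \<le> (m::nat)"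
  shows "c [^] m \<noteq> \<one>"
proof -
  have "\<kappa> (c [^] k) = \<kappa> \<one> + k" for k :: nat
    by (induction k) (use c in auto)
  from this[of m] show ?thesis using m by auto
qed

subsection \<open>Discrete groups of conformal transformations\<close>

text \<open>The difference may grow linearly in \<open>y\<close>, but the round metric shrinks by
  the factor \<open>s\<close> at \<open>f y\<close>, and \<open>norm y + 1\<close> is at most
  \<open>(R\<^sup>2 + R + 1) * s\<close> because \<open>f\<close> contracts by no more than
  \<open>R\<close>. Hence the bound is uniform on the sphere.\<close>

lemma similarity_close:
  fixes f f' :: "real ^ 'n::finite \<Rightarrow> real ^ 'n"
  assumes R: "1 \<le> R" and l: "1 / R \<le> l" and A: "orthogonal_transformation A" and t: "norm t \<le> R"
    and f: "\<And>y. f y = l *\<^sub>R A y + t" and d: "0 \<le> d" "norm (f y - f' y) \<le> d * (norm y + 1)"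
  shows "dist (inv_stereo (f y)) (inv_stereo (f' y)) \<le> 2 * d * (R\<^sup>2 + R + 1)"
proof -
  define s where "s = sqrt (1 + f y \<bullet> f y)"
  have s: "1 \<le> s" "norm (f y) \<le> s" "0 < s"
    unfolding s_def by (auto simp: norm_eq_sqrt_inner add_pos_nonneg)
  have "norm y * (1 / R) \<le> l * norm y" using l mult_right_mono[OF l norm_ge_zero[of y]] by (simp add: mult.commute)
  also have "l * norm y = norm (l *\<^sub>R A y)"
  proof -
    have "0 \<le> l" using l R by (smt (verit) divide_nonneg_pos)
    then show ?thesis using orthogonal_transformation_norm[OF A] by simp
  qed
  also have "\<dots> = norm (f y - t)" by (simp add: f)
  also have "\<dots> \<le> s + R" using norm_triangle_ineq4[of "f y" t] s(2) t by linarith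
  finally have "norm y \<le> R * (s + R)" using R by (simp add: field_simps)
  then have "norm y + 1 \<le> R * s + (R\<^sup>2 + 1) * 1" by (simp add: algebra_simps power2_eq_square)
  also have "\<dots> \<le> R * s + (R\<^sup>2 + 1) * s" using s(1) by (intro add_left_mono mult_left_mono) auto
  finally have y: "norm y + 1 \<le> (R\<^sup>2 + R + 1) * s" by (simp add: algebra_simps)
  have "dist (inv_stereo (f y)) (inv_stereo (f' y)) \<le> 2 * norm (f y - f' y) / s"
    using dist_inv_stereo_le[of "f y" "f' y"] by (simp add: s_def dist_norm)
  also have "\<dots> \<le> 2 * (d * ((R\<^sup>2 + R + 1) * s)) / s"
    using d y s by (intro divide_right_mono mult_left_mono order_trans[OF d(2)]) auto
  also have "\<dots> = 2 * d * (R\<^sup>2 + R + 1)" using s by simp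
  finally show ?thesis .
qed

lemma tendsto_inv_stereo_north:
  assumes "filterlim (\<lambda>k. norm (f k)) at_top F"
  shows "((\<lambda>k. inv_stereo (f k)) \<longlongrightarrow> north) F"
proof (rule metric_tendsto_imp_tendsto)
  have "filterlim (\<lambda>k. norm (f k) / 2) at_top F"
    using filterlim_tendsto_pos_mult_at_top[OF tendsto_const[of "1/2"] _ assms] by simp
  then show "((\<lambda>k. inverse (norm (f k) / 2)) \<longlongrightarrow> 0) F"
    by (rule tendsto_inverse_0_at_top)
  have "eventually (\<lambda>k. 0 < norm (f k)) F" using assms unfolding filterlim_at_top_dense by blast
  then show "eventually (\<lambda>k. dist (inv_stereo (f k)) north \<le> dist (inverse (norm (f k) / 2)) 0) F"
  proof (rule eventually_mono)
    fix k assume k: "0 < norm (f k)"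
    have "norm (f k) \<le> sqrt (1 + f k \<bullet> f k)" by (simp add: norm_eq_sqrt_inner)
    then show "dist (inv_stereo (f k)) north \<le> dist (inverse (norm (f k) / 2)) 0"
      unfolding dist_inv_stereo_north using k one_plus_inner_pos[of "f k"] by (simp add: divide_simps)
  qed
qed

lemma Conf_plus_bij: "a \<in> carrier Conf_plus \<Longrightarrow> bij_betw a round_sphere round_sphere"
  by (simp add: Conf_plus_def Bij_def)

lemma Conf_plus_continuous: "a \<in> carrier Conf_plus \<Longrightarrow> continuous_on round_sphere a"
  by (simp add: Conf_plus_def conformal_diffeo_def smooth_map_on_def)

lemma Conf_plus_mult:
  "a \<in> carrier Conf_plus \<Longrightarrow> b \<in> carrier Conf_plus \<Longrightarrow> a \<otimes>\<^bsub>Conf_plus\<^esub> b = compose round_sphere a b"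
  by (simp add: Conf_plus_def BijGroup_def)

lemma rotation_to:
  fixes v w :: "real ^ ('n::finite + 1)"
  assumes "v \<in> round_sphere" "w \<in> round_sphere"
  obtains P where "rotation_matrix P" "P *v v = w"
proof -
  have "2 \<le> CARD('n + 1)" by simp
  then obtain f where f: "orthogonal_transformation f" "det (matrix f) = 1" "f v = w"
    using rotation_exists_1[of v w] assms by auto
  have "rotation_matrix (matrix f)"
    using f by (simp add: rotation_matrix_def orthogonal_transformation_matrix)
  moreover have "matrix f *v v = w"
    using f by (simp add: matrix_works orthogonal_transformation_linear)
  ultimately show thesis using that by blast
qed

lemma orthogonal_transformation_diff: "orthogonal_transformation A \<Longrightarrow> A (x - y) = A x - A y"
  using linear_diff orthogonal_transformation_linear by blast

lemma orthogonal_transformation_zero: "orthogonal_transformation A \<Longrightarrow> A 0 = 0"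
  using linear_0 orthogonal_transformation_linear by blast

text \<open>Puts linear parts into a finite-dimensional normed space, where bounded sequences have
  convergent subsequences.\<close>

lemma scaled_orthogonal_blinfun:
  fixes A :: "'a::euclidean_space \<Rightarrow> 'a"
  assumes "orthogonal_transformation A" "0 \<le> l"
  shows "blinfun_apply (Blinfun (\<lambda>y. l *\<^sub>R A y)) y = l *\<^sub>R A y" "norm (Blinfun (\<lambda>y. l *\<^sub>R A y)) \<le> l"
proof -
  have "linear (\<lambda>y. l *\<^sub>R A y)"
    using assms(1) by (intro linear_compose_scale_right orthogonal_transformation_linear)
  then have "bounded_linear (\<lambda>y. l *\<^sub>R A y)" by (simp add: linear_conv_bounded_linear)
  then have e: "blinfun_apply (Blinfun (\<lambda>y. l *\<^sub>R A y)) = (\<lambda>y. l *\<^sub>R A y)"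
    by (rule bounded_linear_Blinfun_apply)
  show "blinfun_apply (Blinfun (\<lambda>y. l *\<^sub>R A y)) y = l *\<^sub>R A y" by (simp add: e)
  show "norm (Blinfun (\<lambda>y. l *\<^sub>R A y)) \<le> l"
    using assms by (intro norm_blinfun_bound) (auto simp: e orthogonal_transformation_norm)
qed

lemma rotation_blinfun:
  fixes P :: "real ^ 'm ^ 'm"
  assumes "rotation_matrix P"
  shows "blinfun_apply (Blinfun (\<lambda>v. P *v v)) v = P *v v" "norm (Blinfun (\<lambda>v. P *v v)) \<le> 1"
proof -
  have e: "blinfun_apply (Blinfun (\<lambda>v. P *v v)) = (\<lambda>v. P *v v)"
    by (intro bounded_linear_Blinfun_apply matrix_vector_mul_bounded_linear)
  show "blinfun_apply (Blinfun (\<lambda>v. P *v v)) v = P *v v" by (simp add: e)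
  show "norm (Blinfun (\<lambda>v. P *v v)) \<le> 1"
    using assms by (intro norm_blinfun_bound) (auto simp: e rotation_matrix_norm)
qed

lemma bounded_sequence_close:
  fixes Z :: "nat \<Rightarrow> 'a::heine_borel"
  assumes "bounded (range Z)" "0 < d"
  obtains i j where "i < j" "dist (Z i) (Z j) < d"
proof -
  obtain L r where r: "strict_mono r" "(Z \<circ> r) \<longlonglongrightarrow> L"
    using bounded_imp_convergent_subsequence[OF assms(1)] by blast
  then have "Cauchy (Z \<circ> r)" by (blast intro: LIMSEQ_imp_Cauchy)
  then obtain M where "\<forall>m\<ge>M. \<forall>n\<ge>M. dist ((Z \<circ> r) m) ((Z \<circ> r) n) < d"
    using assms(2) unfolding Cauchy_def by blast
  then have "dist (Z (r M)) (Z (r (Suc M))) < d" by simp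
  moreover have "r M < r (Suc M)" using r(1) by (simp add: strict_mono_def)
  ultimately show thesis using that by blast
qed

section \<open>Convergence properties of discrete groups\<close>

locale discrete_rep = group G for G (structure) +
  fixes \<rho> :: "'a \<Rightarrow> real ^ ('n::finite + 1) \<Rightarrow> real ^ ('n + 1)"
  assumes hom: "\<rho> \<in> hom G Conf_plus" and inj: "inj_on \<rho> (carrier G)"
    and discrete: "discrete_transformations (\<rho> ` carrier G)" and dim: "3 \<le> CARD('n)"
begin

abbreviation S :: "(real ^ ('n + 1)) set" where "S \<equiv> round_sphere"

lemma rho_Conf: "x \<in> carrier G \<Longrightarrow> \<rho> x \<in> carrier Conf_plus"
  using hom by (auto simp: hom_def)

lemma rho_sphere: "x \<in> carrier G \<Longrightarrow> v \<in> S \<Longrightarrow> \<rho> x v \<in> S"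
  using Conf_plus_bij[OF rho_Conf] by (metis bij_betwE)

lemma rho_inject: "x \<in> carrier G \<Longrightarrow> v \<in> S \<Longrightarrow> w \<in> S \<Longrightarrow> \<rho> x v = \<rho> x w \<longleftrightarrow> v = w"
  using Conf_plus_bij[OF rho_Conf] by (metis bij_betw_def inj_onD)

lemma rho_mult:
  assumes "x \<in> carrier G" "y \<in> carrier G" "v \<in> S"
  shows "\<rho> (x \<otimes> y) v = \<rho> x (\<rho> y v)"
proof -
  have "\<rho> (x \<otimes> y) = compose S (\<rho> x) (\<rho> y)"
    using assms hom Conf_plus_mult[OF rho_Conf rho_Conf] by (simp add: hom_def)
  then show ?thesis using assms(3) by (simp add: compose_def)
qed

lemma rho_one: "v \<in> S \<Longrightarrow> \<rho> \<one> v = v"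
  using rho_mult[of \<one> \<one> v] rho_inject[of \<one> "\<rho> \<one> v" v] rho_sphere[of \<one> v] by simp

lemma rho_inv:
  assumes "x \<in> carrier G" "v \<in> S"
  shows "\<rho> (inv x) (\<rho> x v) = v" "\<rho> x (\<rho> (inv x) v) = v"
  using assms rho_mult[of "inv x" x v] rho_mult[of x "inv x" v] by (simp_all add: rho_one)

text \<open>Composition on the right with a bijection of the sphere preserves uniform distance, so
  the radius isolating the identity serves for every pair of elements.\<close>

lemma separated:
  obtains \<epsilon> where "0 < \<epsilon>"
    "\<forall>x\<in>carrier G. \<forall>y\<in>carrier G. (\<forall>v\<in>S. dist (\<rho> x v) (\<rho> y v) < \<epsilon>) \<longrightarrow> x = y"
proof -
  have "\<rho> \<one> \<in> \<rho> ` carrier G" by simp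
  then obtain \<epsilon> where e: "0 < \<epsilon>"
    "\<forall>b\<in>\<rho> ` carrier G. (\<forall>v\<in>S. dist (\<rho> \<one> v) (b v) < \<epsilon>) \<longrightarrow> b = \<rho> \<one>"
    using discrete unfolding discrete_transformations_def by blast
  show thesis
  proof (rule that[OF e(1)], intro ballI impI)
    fix x y assume xy: "x \<in> carrier G" "y \<in> carrier G" and close: "\<forall>v\<in>S. dist (\<rho> x v) (\<rho> y v) < \<epsilon>"
    have c: "x \<otimes> inv y \<in> carrier G" using xy by simp
    have "dist (\<rho> \<one> v) (\<rho> (x \<otimes> inv y) v) < \<epsilon>" if v: "v \<in> S" for v
    proof -
      have w: "\<rho> (inv y) v \<in> S" using xy v by (simp only: rho_sphere inv_closed)
      have "\<rho> (x \<otimes> inv y) v = \<rho> x (\<rho> (inv y) v)" using xy v by (simp only: rho_mult inv_closed)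
      moreover have "\<rho> \<one> v = \<rho> y (\<rho> (inv y) v)" using rho_inv(2)[OF xy(2) v] rho_one[OF v] by simp
      ultimately show ?thesis using close w by (simp add: dist_commute)
    qed
    then have "\<rho> (x \<otimes> inv y) = \<rho> \<one>" using e(2) c by blast
    then have "x \<otimes> inv y = \<one>" using inj c by (auto dest: inj_onD)
    then show "x = y" using xy by (metis inv_equality inv_inv inv_closed)
  qed
qed

text \<open>Rotations, linear parts and translations all stay bounded, so two distinct members of
  the sequence have nearly the same data and are uniformly close on the sphere, against
  \<open>separated\<close>. The rotation \<open>P k\<close> may vary, which covers sequences that do
  not fix infinity.\<close>

lemma bounded_similarities:
  fixes X :: "nat \<Rightarrow> 'a" and A :: "nat \<Rightarrow> real ^ 'n \<Rightarrow> real ^ 'n"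
  assumes X: "\<And>k. X k \<in> carrier G" "inj X"
    and P: "\<And>k. rotation_matrix (P k)" and Q: "rotation_matrix Q"
    and N: "\<And>k. P k *v \<rho> (X k) (Q *v north) = north"
    and eq: "\<And>k y. P k *v \<rho> (X k) (Q *v inv_stereo y) = inv_stereo (l k *\<^sub>R A k y + t k)"
    and A: "\<And>k. orthogonal_transformation (A k)"
    and R: "1 \<le> R" "\<And>k. 1 / R \<le> l k" "\<And>k. l k \<le> R" "\<And>k. norm (t k) \<le> R"
  shows False
proof -
  obtain \<epsilon> where e: "0 < \<epsilon>"
    "\<forall>x\<in>carrier G. \<forall>y\<in>carrier G. (\<forall>v\<in>S. dist (\<rho> x v) (\<rho> y v) < \<epsilon>) \<longrightarrow> x = y"
    by (rule separated)
  \<comment> \<open>Chosen so that the error of the similarities,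
    \<open>2 * d * (R\<^sup>2 + R + 1)\<close>, and that of the rotations, \<open>d\<close>, add up
    to \<epsilon>.\<close>
  define d where "d = \<epsilon> / (2 * (R\<^sup>2 + R + 1) + 1)"
  have den: "0 < 2 * (R\<^sup>2 + R + 1) + 1" using R(1) by (simp add: add_pos_pos)
  then have d: "0 < d" using e(1) by (simp add: d_def)
  have "2 * d * (R\<^sup>2 + R + 1) + d = d * (2 * (R\<^sup>2 + R + 1) + 1)" by (simp add: algebra_simps)
  also have "\<dots> = \<epsilon>" unfolding d_def using den by simp
  finally have de: "2 * d * (R\<^sup>2 + R + 1) + d = \<epsilon>" .
  define Pb where "Pb k = Blinfun (\<lambda>v. transpose (P k) *v v)" for k
  define Mb where "Mb k = Blinfun (\<lambda>y. l k *\<^sub>R A k y)" for k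
  define Z where "Z k = (Pb k, Mb k, t k)" for k
  note P' = rotation_matrix_transpose[OF P]
  have l0: "0 \<le> l k" for k using R(1) R(2)[of k] by (smt (verit) divide_nonneg_pos)
  have Pb: "Pb k v = transpose (P k) *v v" "norm (Pb k) \<le> 1" for k v
    unfolding Pb_def using rotation_blinfun[OF P'] by auto
  have Mb: "Mb k y = l k *\<^sub>R A k y" "norm (Mb k) \<le> R" for k y
    unfolding Mb_def
    by (rule scaled_orthogonal_blinfun(1)[OF A l0]) (rule order_trans[OF scaled_orthogonal_blinfun(2)[OF A l0] R(3)])
  have "bounded (range Z)"
  proof (rule boundedI)
    fix z assume "z \<in> range Z"
    then obtain k where "z = (Pb k, Mb k, t k)" by (auto simp: Z_def)
    then show "norm z \<le> 1 + (R + R)"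
      using norm_Pair_le[of "Pb k" "(Mb k, t k)"] norm_Pair_le[of "Mb k" "t k"] Pb(2)[of k] Mb(2)[of k] R(4)[of k]
      by simp
  qed
  then obtain i j where ij: "i < j" "dist (Z i) (Z j) < d" by (rule bounded_sequence_close[OF _ d])
  have dP: "dist (Pb i) (Pb j) < d" using ij(2) dist_fst_le[of "Z i" "Z j"] by (simp add: Z_def)
  have dM: "dist (Mb i) (Mb j) < d" "dist (t i) (t j) < d"
    using ij(2) dist_snd_le[of "Z i" "Z j"] dist_fst_le[of "snd (Z i)" "snd (Z j)"] dist_snd_le[of "snd (Z i)" "snd (Z j)"]
    by (auto simp: Z_def)
  have Pij: "dist (Pb i v) (Pb j v) < d" if "v \<in> S" for v
  proof -
    have "dist (Pb i v) (Pb j v) = norm ((Pb i - Pb j) v)" by (simp add: dist_norm blinfun.diff_left)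
    also have "\<dots> \<le> norm (Pb i - Pb j) * 1" using norm_blinfun[of "Pb i - Pb j" v] that by simp
    finally show ?thesis using dP by (simp add: dist_norm)
  qed
  have "dist (\<rho> (X i) v) (\<rho> (X j) v) < \<epsilon>" if v: "v \<in> S" for v
  proof -
    have u: "transpose Q *v v \<in> S" using rotation_matrix_sphere[OF rotation_matrix_transpose[OF Q]] v by blast
    have vQ: "v = Q *v (transpose Q *v v)" by (simp only: rotation_matrix_cancel[OF Q])
    from u show ?thesis
    proof (cases rule: sphere_cases)
      case 1
      have "\<rho> (X k) v = Pb k north" for k
        using N[of k] vQ 1 rotation_matrix_cancel[OF P] unfolding Pb by metis
      then have "dist (\<rho> (X i) v) (\<rho> (X j) v) < d" using Pij[OF north_sphere] by simp
      moreover have "0 \<le> 2 * d * (R\<^sup>2 + R + 1)" using d R(1) by (simp add: add_nonneg_nonneg)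
      ultimately show ?thesis using de by linarith
    next
      case (2 y)
      define s where "s k = inv_stereo (l k *\<^sub>R A k y + t k)" for k
      have r: "\<rho> (X k) v = Pb k (s k)" for k
        using eq[of k y] vQ 2 rotation_matrix_cancel[OF P] unfolding Pb s_def by metis
      have "norm ((l i *\<^sub>R A i y + t i) - (l j *\<^sub>R A j y + t j)) \<le> d * (norm y + 1)"
      proof -
        have "(l i *\<^sub>R A i y + t i) - (l j *\<^sub>R A j y + t j) = (Mb i - Mb j) y + (t i - t j)"
          by (simp add: blinfun.diff_left Mb)
        also have "norm \<dots> \<le> norm (Mb i - Mb j) * norm y + norm (t i - t j)"
          using norm_triangle_ineq[of "(Mb i - Mb j) y" "t i - t j"] norm_blinfun[of "Mb i - Mb j" y] by linarith
        also have "\<dots> \<le> d * norm y + d"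
          using dM by (intro add_mono mult_right_mono) (auto simp: dist_norm)
        finally show ?thesis by (simp add: algebra_simps)
      qed
      then have "dist (s i) (s j) \<le> 2 * d * (R\<^sup>2 + R + 1)"
        unfolding s_def using d
        by (intro similarity_close[OF R(1) R(2)[of i] A[of i] R(4)[of i], where f="\<lambda>y. l i *\<^sub>R A i y + t i" and f'="\<lambda>y. l j *\<^sub>R A j y + t j"]) auto
      moreover have "dist (Pb i (s i)) (Pb i (s j)) = dist (s i) (s j)"
        unfolding Pb dist_norm using rotation_matrix_norm[OF P', of i "s i - s j"]
        by (simp add: matrix_vector_mult_diff_distrib)
      moreover have "dist (Pb i (s j)) (Pb j (s j)) < d"
        unfolding s_def by (rule Pij[OF inv_stereo_sphere])
      ultimately have "dist (Pb i (s i)) (Pb j (s j)) < 2 * d * (R\<^sup>2 + R + 1) + d"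
        using dist_triangle[of "Pb i (s i)" "Pb j (s j)" "Pb i (s j)"] by linarith
      then show ?thesis unfolding r de .
    qed
  qed
  then have "X i = X j" using e(2) X(1) by blast
  then show False using X(2) ij(1) by (auto dest: injD)
qed

lemma rho_similarity:
  assumes "x \<in> carrier G" "rotation_matrix P" "rotation_matrix Q" "P *v \<rho> x (Q *v north) = north"
  obtains l A t where "0 < l" "orthogonal_transformation A"
    "\<forall>y. P *v \<rho> x (Q *v inv_stereo y) = inv_stereo (l *\<^sub>R A y + t)"
  using Conf_plus_similarity[OF rho_Conf[OF assms(1)] assms(2-4) dim] by metis

text \<open>
  The convergence property of discrete groups of conformal transformations, in a weak, pointwise form.
\<close>

lemma converge_to_constant:
  fixes X :: "nat \<Rightarrow> 'a"
  assumes X: "\<And>k. X k \<in> carrier G" "inj X"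
  obtains r y0 x' where "strict_mono r" "y0 \<in> S"
    "\<forall>y. y \<noteq> x' \<longrightarrow> (\<lambda>k. \<rho> (X (r k)) (inv_stereo y)) \<longlonglongrightarrow> y0"
proof -
  let ?I = "mat 1 :: real ^ ('n + 1) ^ ('n + 1)"
  have I: "rotation_matrix ?I"
    by (simp add: rotation_matrix_def orthogonal_matrix_def transpose_mat matrix_mul_lid)
  \<comment> \<open>A rotation brings the image of the pole back to the pole, after which
    Liouville's theorem describes the element as a similarity. The four data are packed into one
    tuple for a single choice.\<close>
  have "\<exists>w. rotation_matrix (fst w) \<and> 0 < fst (snd w) \<and> orthogonal_transformation (fst (snd (snd w))) \<and>
     fst w *v \<rho> (X k) (?I *v north) = north \<and>
     (\<forall>y. fst w *v \<rho> (X k) (?I *v inv_stereo y) =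
        inv_stereo (fst (snd w) *\<^sub>R fst (snd (snd w)) y + snd (snd (snd w))))" for k
  proof -
    have "\<rho> (X k) (?I *v north) \<in> S" using rho_sphere[OF X(1) north_sphere] by simp
    then obtain P where P: "rotation_matrix P" "P *v \<rho> (X k) (?I *v north) = north"
      by (rule rotation_to[OF _ north_sphere])
    obtain l A t where "0 < l" "orthogonal_transformation A"
      "\<forall>y. P *v \<rho> (X k) (?I *v inv_stereo y) = inv_stereo (l *\<^sub>R A y + t)"
      by (rule rho_similarity[OF X(1) P(1) I P(2)])
    then show ?thesis using P by (intro exI[of _ "(P, l, A, t)"]) simp
  qed
  then obtain W where W: "\<forall>k. rotation_matrix (fst (W k)) \<and> 0 < fst (snd (W k)) \<and>
     orthogonal_transformation (fst (snd (snd (W k)))) \<and> fst (W k) *v \<rho> (X k) (?I *v north) = north \<and>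
     (\<forall>y. fst (W k) *v \<rho> (X k) (?I *v inv_stereo y) =
        inv_stereo (fst (snd (W k)) *\<^sub>R fst (snd (snd (W k))) y + snd (snd (snd (W k)))))"
    using choice[where Q="\<lambda>k w. rotation_matrix (fst w) \<and> 0 < fst (snd w) \<and> orthogonal_transformation (fst (snd (snd w))) \<and>
     fst w *v \<rho> (X k) (?I *v north) = north \<and>
     (\<forall>y. fst w *v \<rho> (X k) (?I *v inv_stereo y) =
        inv_stereo (fst (snd w) *\<^sub>R fst (snd (snd w)) y + snd (snd (snd w))))"] by blast
  define P l A t where PlAt: "P k = fst (W k)" "l k = fst (snd (W k))"
    "A k = fst (snd (snd (W k)))" "t k = snd (snd (snd (W k)))" for k
  have P: "\<And>k. rotation_matrix (P k)" and l: "\<And>k. 0 < l k"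
    and A: "\<And>k. orthogonal_transformation (A k)" and N: "\<And>k. P k *v \<rho> (X k) (?I *v north) = north"
    and eq: "\<And>k y. P k *v \<rho> (X k) (?I *v inv_stereo y) = inv_stereo (l k *\<^sub>R A k y + t k)"
    using W unfolding PlAt by blast+
  \<comment> \<open>Otherwise infinitely many members would obey the bounds, and that subsequence
    contradicts \<open>bounded_similarities\<close>.\<close>
  have unbounded: "eventually (\<lambda>k. \<not> (1 / R \<le> l k \<and> l k \<le> R \<and> norm (t k) \<le> R)) sequentially" if R: "1 \<le> R" for R
  proof (rule ccontr)
    assume "\<not> ?thesis"
    then have "infinite {k. 1 / R \<le> l k \<and> l k \<le> R \<and> norm (t k) \<le> R}"
      unfolding cofinite_eq_sequentially[symmetric] eventually_cofinite not_not .
    from infinite_enumerate[OF this] obtain r :: "nat \<Rightarrow> nat"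
      where r: "strict_mono r" "\<forall>k. r k \<in> {k. 1 / R \<le> l k \<and> l k \<le> R \<and> norm (t k) \<le> R}"
      by blast
    have "inj (\<lambda>k. X (r k))" using X(2) strict_mono_eq[OF r(1)] by (auto simp: inj_def)
    then show False
    proof (rule bounded_similarities[where X="\<lambda>k. X (r k)" and P="\<lambda>k. P (r k)" and Q="?I"
          and l="\<lambda>k. l (r k)" and A="\<lambda>k. A (r k)" and t="\<lambda>k. t (r k)" and R=R, rotated 1])
      show "P (r k) *v \<rho> (X (r k)) (?I *v inv_stereo y) = inv_stereo (l (r k) *\<^sub>R A (r k) y + t (r k))" for k y
        by (rule eq)
    qed (use X(1) P I N A R r(2) in auto)
  qed
  \<comment> \<open>Around the zero \<open>x k\<close> of the similarity, the norm of its value is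
    \<open>l k\<close> times the distance from \<open>x k\<close>.\<close>
  have "\<exists>x. l k *\<^sub>R A k x + t k = 0" for k
  proof -
    obtain x where "A k x = - (1 / l k) *\<^sub>R t k"
      using orthogonal_transformation_surj[OF A[of k]] by (metis surjD)
    then show ?thesis using l[of k] by (intro exI[of _ x]) simp
  qed
  then obtain x where x: "\<And>k. l k *\<^sub>R A k (x k) + t k = 0" by metis
  have Mx: "norm (l k *\<^sub>R A k y + t k) = l k * norm (y - x k)" for k y
  proof -
    have "l k *\<^sub>R A k y + t k = l k *\<^sub>R A k (y - x k)"
      using x[of k] by (simp add: orthogonal_transformation_diff[OF A] algebra_simps)
    then show ?thesis using l[of k] by (simp add: orthogonal_transformation_norm[OF A])
  qed
  define Pb where "Pb k = Blinfun (\<lambda>v. transpose (P k) *v v)" for k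
  have Pb: "Pb k v = transpose (P k) *v v" "norm (Pb k) \<le> 1" for k v
    unfolding Pb_def using rotation_blinfun[OF rotation_matrix_transpose[OF P]] by auto
  \<comment> \<open>Placing \<open>t k\<close> and \<open>x k\<close> on the sphere makes them
    subconverge even when they are unbounded.\<close>
  define Z where "Z k = (Pb k, inv_stereo (t k), inv_stereo (x k))" for k
  have "bounded (range Z)"
  proof (rule boundedI)
    fix z assume "z \<in> range Z"
    then obtain k where "z = (Pb k, inv_stereo (t k), inv_stereo (x k))" by (auto simp: Z_def)
    then show "norm z \<le> 1 + (1 + 1)"
      using norm_Pair_le[of "Pb k" "(inv_stereo (t k), inv_stereo (x k))"]
        norm_Pair_le[of "inv_stereo (t k)" "inv_stereo (x k)"] Pb(2)[of k]
        inv_stereo_sphere[of "t k"] inv_stereo_sphere[of "x k"] by simp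
  qed
  then obtain L r1 where r1: "strict_mono r1" "(Z \<circ> r1) \<longlonglongrightarrow> L"
    using bounded_imp_convergent_subsequence by blast
  obtain lim_l r2 where r2: "strict_mono r2" "((\<lambda>k. ereal (l (r1 k))) \<circ> r2) \<longlonglongrightarrow> lim_l"
    using compact_complete_linorder by blast
  define r where "r = r1 \<circ> r2"
  have r: "strict_mono r" unfolding r_def using r1(1) r2(1) by (rule strict_mono_o)
  have limZ: "(\<lambda>k. Z (r k)) \<longlonglongrightarrow> L" using LIMSEQ_subseq_LIMSEQ[OF r1(2) r2(1)] by (simp add: r_def comp_def)
  have limP: "(\<lambda>k. Pb (r k)) \<longlonglongrightarrow> fst L" and limt: "(\<lambda>k. inv_stereo (t (r k))) \<longlonglongrightarrow> fst (snd L)"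
    and limx: "(\<lambda>k. inv_stereo (x (r k))) \<longlonglongrightarrow> snd (snd L)"
    using tendsto_fst[OF limZ] tendsto_fst[OF tendsto_snd[OF limZ]] tendsto_snd[OF tendsto_snd[OF limZ]]
    by (simp_all add: Z_def)
  have liml: "(\<lambda>k. ereal (l (r k))) \<longlonglongrightarrow> lim_l" using r2(2) by (simp add: r_def comp_def)
  have unb: "eventually (\<lambda>k. \<not> (1 / R \<le> l (r k) \<and> l (r k) \<le> R \<and> norm (t (r k)) \<le> R)) sequentially" if "1 \<le> R" for R
    by (rule eventually_subseq[OF r unbounded[OF that]])
  define s where "s k y = inv_stereo (l (r k) *\<^sub>R A (r k) y + t (r k))" for k y
  \<comment> \<open>If the ratios tend to infinity, all points except a possible limit of the zeros
    escape to infinity. If they tend to 0, all points follow \<open>t (r k)\<close>. If they tend to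
    a positive number, the translations must be unbounded and carry all points to infinity.\<close>
  have "\<exists>s0 x'. \<forall>y. y \<noteq> x' \<longrightarrow> (\<lambda>k. s k y) \<longlonglongrightarrow> s0"
  proof (cases "lim_l = \<infinity>")
    case True
    then have inf: "filterlim (\<lambda>k. l (r k)) at_top sequentially"
      using liml tendsto_PInfty_eq_at_top by blast
    have "(\<lambda>k. s k y) \<longlonglongrightarrow> north" if y: "inv_stereo y \<noteq> snd (snd L)" for y
      unfolding s_def
    proof (rule tendsto_inv_stereo_north, rule filterlim_at_top_mono)
      define d where "d = dist (snd (snd L)) (inv_stereo y)"
      have d: "0 < d" using y by (simp add: d_def)
      have "(\<lambda>k. dist (inv_stereo (x (r k))) (inv_stereo y)) \<longlonglongrightarrow> d"
        unfolding d_def by (intro tendsto_intros limx)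
      then have "eventually (\<lambda>k. d / 2 < dist (inv_stereo (x (r k))) (inv_stereo y)) sequentially"
        using d by (intro order_tendstoD) auto
      then show "eventually (\<lambda>k. d / 4 * l (r k) \<le> norm (l (r k) *\<^sub>R A (r k) y + t (r k))) sequentially"
      proof (rule eventually_mono)
        fix k assume "d / 2 < dist (inv_stereo (x (r k))) (inv_stereo y)"
        then have "d / 4 \<le> norm (y - x (r k))"
          using dist_inv_stereo_le_two[of "x (r k)" y] by (simp add: dist_norm norm_minus_commute)
        then have "l (r k) * (d / 4) \<le> l (r k) * norm (y - x (r k))" using l[of "r k"] by (intro mult_left_mono) auto
        then show "d / 4 * l (r k) \<le> norm (l (r k) *\<^sub>R A (r k) y + t (r k))" unfolding Mx by (simp add: mult.commute)
      qed
      show "filterlim (\<lambda>k. d / 4 * l (r k)) at_top sequentially"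
        by (rule filterlim_tendsto_pos_mult_at_top[OF tendsto_const _ inf]) (use d in simp)
    qed
    moreover have "\<exists>x'. \<forall>y. y \<noteq> x' \<longrightarrow> inv_stereo y \<noteq> snd (snd L)"
      using inv_stereo_inject by metis
    ultimately show ?thesis by metis
  next
    case False
    have "0 \<le> lim_l" by (rule tendsto_lowerbound[OF liml]) (auto intro!: always_eventually less_imp_le l)
    then obtain m where m: "lim_l = ereal m" "0 \<le> m" using False by (cases lim_l) auto
    have lm: "(\<lambda>k. l (r k)) \<longlonglongrightarrow> m" using liml unfolding m(1) by simp
    show ?thesis
    proof (cases "m = 0")
      case True
      have "(\<lambda>k. s k y) \<longlonglongrightarrow> fst (snd L)" for y
      proof (rule Lim_transform[OF limt])
        have "(\<lambda>k. 2 * (l (r k) * norm y)) \<longlonglongrightarrow> 2 * (m * norm y)" by (intro tendsto_intros lm)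
        then have z: "(\<lambda>k. 2 * (l (r k) * norm y)) \<longlonglongrightarrow> 0" using True by simp
        show "(\<lambda>k. s k y - inv_stereo (t (r k))) \<longlonglongrightarrow> 0"
        proof (rule Lim_null_comparison[OF always_eventually z], rule allI)
          fix k
          have "dist (l (r k) *\<^sub>R A (r k) y + t (r k)) (t (r k)) = l (r k) * norm y"
            using l[of "r k"] by (simp add: dist_norm orthogonal_transformation_norm[OF A])
          then show "norm (s k y - inv_stereo (t (r k))) \<le> 2 * (l (r k) * norm y)"
            using dist_inv_stereo_le_two[of "l (r k) *\<^sub>R A (r k) y + t (r k)" "t (r k)"] by (simp add: s_def dist_norm)
        qed
      qed
      then show ?thesis by blast
    next
      case False
      then have m0: "0 < m" using m(2) by simp
      \<comment> \<open>The ratios eventually lie between \<open>m / 2\<close> and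
        \<open>2 * m\<close>, hence within the bounds given by \<open>R0\<close>; only the
        translations can then violate them.\<close>
      define R0 where "R0 = max 1 (max (2 * m) (2 / m))"
      have R0: "1 \<le> R0" "2 * m \<le> R0" "2 / m \<le> R0" by (auto simp: R0_def)
      have lower: "1 / R0 \<le> m / 2" using R0 m0 by (simp add: field_simps)
      have evl: "eventually (\<lambda>k. m / 2 < l (r k) \<and> l (r k) < 2 * m) sequentially"
        by (intro eventually_conj order_tendstoD[OF lm]) (use m0 in auto)
      have tinf: "filterlim (\<lambda>k. norm (t (r k))) at_top sequentially"
        unfolding filterlim_at_top
      proof
        fix c :: real
        have R: "1 \<le> max R0 c" using R0 by simp
        show "eventually (\<lambda>k. c \<le> norm (t (r k))) sequentially"
          using unb[OF R] evl
        proof eventually_elim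
          case (elim k)
          have "1 / max R0 c \<le> 1 / R0" using R0(1) by (intro divide_left_mono) auto
          then have "1 / max R0 c \<le> l (r k)" "l (r k) \<le> max R0 c" using elim(2) lower R0(2) by linarith+
          then show ?case using elim(1) by auto
        qed
      qed
      have "(\<lambda>k. s k y) \<longlonglongrightarrow> north" for y
        unfolding s_def
      proof (rule tendsto_inv_stereo_north, rule filterlim_at_top_mono)
        show "filterlim (\<lambda>k. - (2 * m * norm y) + norm (t (r k))) at_top sequentially"
          by (rule filterlim_tendsto_add_at_top[OF tendsto_const tinf])
        show "eventually (\<lambda>k. - (2 * m * norm y) + norm (t (r k)) \<le> norm (l (r k) *\<^sub>R A (r k) y + t (r k))) sequentially"
          using evl
        proof eventually_elim
          case (elim k)
          have "norm (l (r k) *\<^sub>R A (r k) y) = l (r k) * norm y"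
            using l[of "r k"] by (simp add: orthogonal_transformation_norm[OF A])
          also have "\<dots> \<le> 2 * m * norm y" using elim by (intro mult_right_mono) auto
          finally show ?case using norm_diff_ineq[of "t (r k)" "l (r k) *\<^sub>R A (r k) y"] by (simp add: add.commute)
        qed
      qed
      then show ?thesis by blast
    qed
  qed
  then obtain s0 x' where s0: "\<forall>y. y \<noteq> x' \<longrightarrow> (\<lambda>k. s k y) \<longlonglongrightarrow> s0" by blast
  have conv: "(\<lambda>k. \<rho> (X (r k)) (inv_stereo y)) \<longlonglongrightarrow> fst L s0" if "y \<noteq> x'" for y
  proof -
    have "\<rho> (X (r k)) (inv_stereo y) = Pb (r k) (s k y)" for k
      using eq[of "r k" y] rotation_matrix_cancel[OF P] unfolding Pb s_def by (metis matrix_vector_mul_lid)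
    then show ?thesis
      using bounded_bilinear.tendsto[OF bounded_bilinear_blinfun_apply limP] s0 that by simp
  qed
  have "fst L s0 \<in> S"
  proof -
    obtain y where y: "y \<noteq> x'"
      using ex_new_if_finite[OF infinite_UNIV_char_0, of "{x'}"] by auto
    show ?thesis
      by (rule closed_sequentially[OF closed_sphere _ conv[OF y]]) (rule rho_sphere[OF X(1) inv_stereo_sphere])
  qed
  then show thesis using that[OF r] conv by blast
qed

lemma infinite_order_inj_pow:
  assumes z: "z \<in> carrier G" and ord: "\<And>m. 1 \<le> m \<Longrightarrow> z [^] (m::nat) \<noteq> \<one>"
  shows "inj (\<lambda>k::nat. z [^] k)"
proof -
  have "z [^] i \<noteq> z [^] j" if "i < j" for i j :: nat
  proof
    assume e: "z [^] i = z [^] j"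
    have "z [^] i \<otimes> z [^] (j - i) = z [^] j" using that z by (simp add: nat_pow_mult)
    then have "z [^] (j - i) = \<one>" using e z l_cancel_one[of "z [^] i" "z [^] (j - i)"] by simp
    then show False using ord[of "j - i"] that by simp
  qed
  then show ?thesis by (metis (no_types, lifting) injI linorder_neqE_nat)
qed

text \<open>Since \<open>c\<close> commutes with its powers, the limit \<open>y0\<close> of the
  powers at a point and the limit at its image under \<open>c\<close> are related by
  \<open>c\<close>. Both limits equal \<open>y0\<close>.\<close>

lemma fixed_point_exists:
  assumes c: "c \<in> carrier G" and ord: "\<And>m. 1 \<le> m \<Longrightarrow> c [^] (m::nat) \<noteq> \<one>"
  obtains y0 where "y0 \<in> S" "\<rho> c y0 = y0"
proof -
  have "c [^] k \<in> carrier G" for k :: nat using c by simp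
  then obtain r y0 x' where r: "y0 \<in> S"
    "\<forall>y. y \<noteq> x' \<longrightarrow> (\<lambda>k. \<rho> (c [^] (r k :: nat)) (inv_stereo y)) \<longlonglongrightarrow> y0"
    by (rule converge_to_constant[of "\<lambda>k. c [^] k"]) (use infinite_order_inj_pow[OF c ord] in blast)+
  \<comment> \<open>Both the point and its image must avoid the exceptional point, and the image
    must have a coordinate. By injectivity of \<open>c\<close> this rules out finitely many points
    only.\<close>
  have "\<exists>y. y \<noteq> x' \<and> \<rho> c (inv_stereo y) \<noteq> north \<and> \<rho> c (inv_stereo y) \<noteq> inv_stereo x'"
  proof (rule ccontr)
    assume none: "\<not> ?thesis"
    define f where "f y = \<rho> c (inv_stereo y)" for y :: "real ^ 'n"
    have "inj f"
    proof (rule injI)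
      fix u v assume "f u = f v"
      then show "u = v"
        using rho_inject[OF c inv_stereo_sphere[of u] inv_stereo_sphere[of v]] by (simp add: f_def inv_stereo_inject)
    qed
    then have "finite (f -` {north, inv_stereo x'})" by (intro finite_vimageI) auto
    moreover have "UNIV \<subseteq> insert x' (f -` {north, inv_stereo x'})" using none by (auto simp: f_def)
    ultimately have "finite (UNIV :: (real ^ 'n) set)" by (meson finite_insert finite_subset)
    then show False using infinite_UNIV_char_0 by blast
  qed
  then obtain y where y: "y \<noteq> x'" "\<rho> c (inv_stereo y) \<noteq> north" "\<rho> c (inv_stereo y) \<noteq> inv_stereo x'" by blast
  have "\<rho> c (inv_stereo y) \<in> S" by (rule rho_sphere[OF c inv_stereo_sphere])
  then obtain y' where y': "\<rho> c (inv_stereo y) = inv_stereo y'" using y(2) sphere_cases by metis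
  have "y' \<noteq> x'" using y(3) y' by blast
  then have 1: "(\<lambda>k. \<rho> (c [^] r k) (inv_stereo y')) \<longlonglongrightarrow> y0" using r(2) by blast
  have "\<rho> c (\<rho> (c [^] r k) (inv_stereo y)) = \<rho> (c [^] r k) (inv_stereo y')" for k
  proof -
    have "c \<otimes> c [^] r k = c [^] r k \<otimes> c" using nat_pow_Suc2[OF c, of "r k"] by simp
    then show ?thesis using c inv_stereo_sphere y' by (metis rho_mult nat_pow_closed)
  qed
  moreover have "(\<lambda>k. \<rho> c (\<rho> (c [^] r k) (inv_stereo y))) \<longlonglongrightarrow> \<rho> c y0"
  proof (rule continuous_on_tendsto_compose[OF Conf_plus_continuous[OF rho_Conf[OF c]]])
    show "(\<lambda>k. \<rho> (c [^] r k) (inv_stereo y)) \<longlonglongrightarrow> y0" using r(2) y(1) by blast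
    show "eventually (\<lambda>k. \<rho> (c [^] r k) (inv_stereo y) \<in> S) sequentially"
      using rho_sphere[OF nat_pow_closed[OF c] inv_stereo_sphere] by (intro always_eventually) blast
  qed (rule r(1))
  ultimately have "(\<lambda>k. \<rho> (c [^] r k) (inv_stereo y')) \<longlonglongrightarrow> \<rho> c y0" by simp
  then have "\<rho> c y0 = y0" using 1 by (rule LIMSEQ_unique)
  then show thesis using that r(1) by blast
qed

end

text \<open>
  The point \<open>Q north\<close> of the sphere is moved to infinity: its stabilizer acts by similarities
  \<open>F x\<close> of Euclidean space.
\<close>

locale point_stabilizer = discrete_rep G \<rho> for G (structure) and \<rho> :: "'a \<Rightarrow> real ^ ('n::finite + 1) \<Rightarrow> real ^ ('n + 1)" +
  fixes Q :: "real ^ ('n + 1) ^ ('n + 1)"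
  assumes Q: "rotation_matrix Q"
begin

definition y0 where "y0 = Q *v north"

definition St where "St = {x \<in> carrier G. \<rho> x y0 = y0}"

definition F where "F x y = stereographic (transpose Q *v \<rho> x (Q *v inv_stereo y))"

definition dilates :: "'a \<Rightarrow> real \<Rightarrow> bool" where
  "dilates x l \<longleftrightarrow> 0 < l \<and> (\<forall>y z. dist (F x y) (F x z) = l * dist y z)"

lemma y0_sphere: "y0 \<in> S"
  unfolding y0_def using rotation_matrix_sphere[OF Q] north_sphere by blast

lemma Q_sphere: "Q *v inv_stereo y \<in> S"
  using rotation_matrix_sphere[OF Q] inv_stereo_sphere by blast

lemma Q_inject: "Q *v v = Q *v w \<longleftrightarrow> v = w"
  using rotation_matrix_cancel(1)[OF Q] by metis

lemma sphere_cases_Q: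
  assumes "v \<in> S"
  obtains "v = y0" | y where "v = Q *v inv_stereo y"
proof -
  have "transpose Q *v v \<in> S" using rotation_matrix_sphere[OF rotation_matrix_transpose[OF Q]] assms by blast
  moreover have "v = Q *v (transpose Q *v v)" using rotation_matrix_cancel(2)[OF Q] by simp
  ultimately show thesis using that sphere_cases y0_def by metis
qed

lemma St_carrier: "x \<in> St \<Longrightarrow> x \<in> carrier G"
  by (simp add: St_def)

lemma St_mult: "x \<in> St \<Longrightarrow> z \<in> St \<Longrightarrow> x \<otimes> z \<in> St"
  by (simp add: St_def rho_mult y0_sphere del: mem_sphere mem_sphere_0)

lemma St_one: "\<one> \<in> St"
  by (simp add: St_def rho_one y0_sphere del: mem_sphere mem_sphere_0)

lemma St_inv: "x \<in> St \<Longrightarrow> inv x \<in> St"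
  using rho_inv(1)[of x y0] by (simp add: St_def y0_sphere del: mem_sphere mem_sphere_0)

lemma St_pow: "x \<in> St \<Longrightarrow> x [^] (k::nat) \<in> St"
  by (induction k) (auto simp: St_one intro: St_mult)

lemma St_commutator: "x \<in> St \<Longrightarrow> z \<in> St \<Longrightarrow> commutator G x z \<in> St"
  unfolding commutator_def by (intro St_mult St_inv)

lemma F_similarity:
  assumes x: "x \<in> St"
  obtains l A t where "0 < l" "orthogonal_transformation A" "\<forall>y. F x y = l *\<^sub>R A y + t"
    "\<forall>y. \<rho> x (Q *v inv_stereo y) = Q *v inv_stereo (F x y)"
proof -
  have "transpose Q *v \<rho> x (Q *v north) = north"
    using x rotation_matrix_cancel(1)[OF Q] by (simp add: St_def y0_def)
  from rho_similarity[OF St_carrier[OF x] rotation_matrix_transpose[OF Q] Q this]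
  obtain l A t where lA: "0 < l" "orthogonal_transformation A"
    "\<forall>y. transpose Q *v \<rho> x (Q *v inv_stereo y) = inv_stereo (l *\<^sub>R A y + t)" by metis
  have 1: "\<forall>y. F x y = l *\<^sub>R A y + t" using lA(3) by (simp add: F_def stereographic_inv_stereo)
  moreover have "\<forall>y. \<rho> x (Q *v inv_stereo y) = Q *v inv_stereo (F x y)"
    using lA(3) 1 rotation_matrix_cancel(2)[OF Q] by metis
  ultimately show thesis using that lA by blast
qed

lemma rho_F: "x \<in> St \<Longrightarrow> \<rho> x (Q *v inv_stereo y) = Q *v inv_stereo (F x y)"
  using F_similarity by metis

lemma F_eqI: "Q *v inv_stereo (F x y) = Q *v inv_stereo z \<Longrightarrow> F x y = z"
  by (simp add: Q_inject inv_stereo_inject)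

lemma F_mult:
  assumes "x \<in> St" "z \<in> St"
  shows "F (x \<otimes> z) y = F x (F z y)"
proof (rule F_eqI)
  have "Q *v inv_stereo (F (x \<otimes> z) y) = \<rho> (x \<otimes> z) (Q *v inv_stereo y)"
    using rho_F[OF St_mult[OF assms]] by simp
  also have "\<dots> = \<rho> x (\<rho> z (Q *v inv_stereo y))"
    by (rule rho_mult[OF St_carrier[OF assms(1)] St_carrier[OF assms(2)] Q_sphere])
  finally show "Q *v inv_stereo (F (x \<otimes> z) y) = Q *v inv_stereo (F x (F z y))"
    by (simp only: rho_F[OF assms(1)] rho_F[OF assms(2)])
qed

lemma F_one: "F \<one> y = y"
  by (rule F_eqI) (simp only: rho_F[OF St_one, symmetric] rho_one[OF Q_sphere])

lemma F_inv: "x \<in> St \<Longrightarrow> F (inv x) (F x y) = y" "x \<in> St \<Longrightarrow> F x (F (inv x) y) = y"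
  using F_mult[of "inv x" x y] F_mult[of x "inv x" y] St_inv[of x] St_carrier[of x] by (simp_all add: F_one)

lemma dilates_exists: "x \<in> St \<Longrightarrow> \<exists>l. dilates x l"
proof -
  assume "x \<in> St"
  then obtain l A t where *: "0 < l" "orthogonal_transformation A" "\<forall>y. F x y = l *\<^sub>R A y + t"
    by (rule F_similarity)
  have "dist (F x y) (F x z) = l * dist y z" for y z
  proof -
    have "F x y - F x z = l *\<^sub>R A (y - z)" using * by (simp add: orthogonal_transformation_diff scaleR_diff_right)
    then show ?thesis using * by (simp add: dist_norm orthogonal_transformation_norm)
  qed
  then show ?thesis using *(1) by (auto simp: dilates_def)
qed

lemma dilates_mult: "x \<in> St \<Longrightarrow> z \<in> St \<Longrightarrow> dilates x l \<Longrightarrow> dilates z m \<Longrightarrow> dilates (x \<otimes> z) (l * m)"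
  by (simp add: dilates_def F_mult)

lemma dilates_one: "dilates \<one> 1"
  by (simp add: dilates_def F_one)

lemma dilates_inv: "x \<in> St \<Longrightarrow> dilates x l \<Longrightarrow> dilates (inv x) (1 / l)"
proof -
  assume x: "x \<in> St" and d: "dilates x l"
  have "dist (F (inv x) y) (F (inv x) z) = 1 / l * dist y z" for y z
    using d F_inv(2)[OF x, of y] F_inv(2)[OF x, of z] unfolding dilates_def
    by (metis nonzero_mult_div_cancel_left order_less_irrefl times_divide_eq_left mult_1)
  then show ?thesis using d by (auto simp: dilates_def)
qed

text \<open>The ratio is multiplicative with commuting values, so it cancels.\<close>

lemma dilates_commutator:
  assumes "x \<in> St" "z \<in> St"
  shows "dilates (commutator G x z) 1"
proof -
  obtain l m where lm: "dilates x l" "dilates z m" using dilates_exists assms by blast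
  then have "dilates (commutator G x z) (l * m * (1 / l) * (1 / m))"
    unfolding commutator_def using assms by (intro dilates_mult dilates_inv St_mult St_inv)
  then show ?thesis using lm by (simp add: dilates_def)
qed

lemma dilates_pow: "x \<in> St \<Longrightarrow> dilates x 1 \<Longrightarrow> dilates (x [^] (k::nat)) 1"
  by (induction k) (use dilates_one dilates_mult[OF St_pow, of x x _ 1 1] in auto)

lemma F_isometry:
  assumes x: "x \<in> St" "dilates x 1"
  obtains A t where "orthogonal_transformation A" "\<forall>y. F x y = A y + t"
proof -
  obtain l A t where *: "0 < l" "orthogonal_transformation A" "\<forall>y. F x y = l *\<^sub>R A y + t"
    by (rule F_similarity[OF x(1)])
  obtain u :: "real ^ 'n" where u: "norm u = 1" using norm_Basis nonempty_Basis by blast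
  have "dist (F x u) (F x 0) = 1" using x(2) u by (simp add: dilates_def)
  then have "l = 1" using * u by (simp add: dist_norm orthogonal_transformation_norm orthogonal_transformation_zero)
  then show thesis using that * by simp
qed

text \<open>All powers fix \<open>p\<close>, so their translation parts have norm at most
  \<open>2 * norm p\<close>. Infinitely many distinct powers would contradict
  \<open>bounded_similarities\<close>.\<close>

lemma isometry_fixed_point_finite_order:
  assumes z: "z \<in> St" "dilates z 1" "F z p = p"
  shows "\<exists>m\<ge>1. z [^] (m::nat) = \<one>"
proof (rule ccontr)
  assume "\<not> ?thesis"
  then have inj: "inj (\<lambda>k::nat. z [^] k)"
    using infinite_order_inj_pow[OF St_carrier[OF z(1)]] by blast
  have fx: "F (z [^] k) p = p" for k :: nat
    by (induction k) (use z F_one F_mult[OF St_pow] in auto)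
  have "\<exists>w. orthogonal_transformation (fst w) \<and> (\<forall>y. F (z [^] k) y = fst w y + snd w)" for k :: nat
    by (rule F_isometry[OF St_pow[OF z(1)] dilates_pow[OF z(1,2)], of k]) (metis fst_conv snd_conv)
  then obtain W where W: "\<forall>k. orthogonal_transformation (fst (W k)) \<and> (\<forall>y. F (z [^] (k::nat)) y = fst (W k) y + snd (W k))"
    using choice[where Q="\<lambda>k w. orthogonal_transformation (fst w) \<and> (\<forall>y. F (z [^] (k::nat)) y = fst w y + snd w)"] by blast
  define A t where At: "A k = fst (W k)" "t k = snd (W k)" for k :: nat
  have A: "orthogonal_transformation (A k)" "F (z [^] k) y = A k y + t k" for k y
    using W by (simp_all add: At)
  have tn: "norm (t k) \<le> 2 * norm p" for k
  proof -
    have "t k = p - A k p" using fx[of k] A(2)[of k p] by (simp add: algebra_simps)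
    then show ?thesis using norm_triangle_ineq4[of p "A k p"] orthogonal_transformation_norm[OF A(1)] by simp
  qed
  show False
  proof (rule bounded_similarities[where X="\<lambda>k. z [^] k" and P="\<lambda>k. transpose Q" and Q=Q
        and l="\<lambda>k. 1" and A=A and t=t and R="1 + 2 * norm p"])
    show "transpose Q *v \<rho> (z [^] k) (Q *v north) = north" for k :: nat
      using St_pow[OF z(1), of k] rotation_matrix_cancel(1)[OF Q] by (simp add: St_def y0_def)
    show "transpose Q *v \<rho> (z [^] k) (Q *v inv_stereo y) = inv_stereo (1 *\<^sub>R A k y + t k)" for k :: nat and y
      using rho_F[OF St_pow[OF z(1)], of k y] rotation_matrix_cancel(1)[OF Q] A(2)[of k y] by simp
    show "z [^] k \<in> carrier G" for k :: nat using St_carrier[OF z(1)] by simp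
    show "norm (t k) \<le> 1 + 2 * norm p" for k using tn[of k] by simp
    show "1 / (1 + 2 * norm p) \<le> 1" by (simp add: divide_simps add_pos_nonneg)
  qed (use inj Q rotation_matrix_transpose[OF Q] A(1) in auto)
qed

text \<open>A ratio different from 1 makes the identity minus the linear part injective, hence
  invertible; this treats contractions and expansions alike.\<close>

lemma dilation_fixed_point:
  assumes x: "x \<in> St" "dilates x l" "l \<noteq> 1"
  obtains p where "F x p = p" "\<forall>q. F x q = q \<longrightarrow> q = p"
proof -
  obtain m A t where *: "0 < m" "orthogonal_transformation A" "\<forall>y. F x y = m *\<^sub>R A y + t"
    by (rule F_similarity[OF x(1)])
  have uniq: "q = p" if "F x q = q" "F x p = p" for p q
  proof -
    have "dist q p = l * dist q p" using x(2) that unfolding dilates_def by metis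
    then show ?thesis using x(3) by simp
  qed
  define g where "g y = y - m *\<^sub>R A y" for y
  have lin: "linear g"
    unfolding g_def[abs_def] using orthogonal_transformation_linear[OF *(2)]
    by (intro linear_compose_sub linear_compose_scale_right linear_ident)
  have "inj g"
  proof (rule linear_injective_0[OF lin, THEN iffD2], intro allI impI)
    fix y assume "g y = 0"
    then have "F x y - F x 0 = y" using * by (simp add: g_def orthogonal_transformation_zero)
    moreover have "dist (F x y) (F x 0) = l * dist y 0" using x(2) by (simp add: dilates_def)
    ultimately have "norm y = l * norm y" by (simp add: dist_norm)
    then show "y = 0" using x(3) by simp
  qed
  then have "surj g" by (rule linear_inj_imp_surj[OF lin])
  then obtain p where "g p = t" by (metis surjD)
  then have "F x p = p" using *(3) by (simp add: g_def algebra_simps)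
  then show thesis using that uniq by blast
qed

lemma fixed_by_rho:
  assumes "x \<in> St" "v \<in> S" "\<rho> x v = v"
  shows "v = y0 \<or> (\<exists>y. v = Q *v inv_stereo y \<and> F x y = y)"
  using assms(2)
proof (cases rule: sphere_cases_Q)
  case (2 y)
  then have "Q *v inv_stereo (F x y) = Q *v inv_stereo y" using rho_F[OF assms(1), of y] assms(3) by simp
  then show ?thesis using 2 F_eqI by blast
qed simp

lemma commuting_fixed:
  assumes "a \<in> carrier G" "c \<in> carrier G" "a \<otimes> c = c \<otimes> a" "v \<in> S" "\<rho> c v = v"
  shows "\<rho> c (\<rho> a v) = \<rho> a v"
  using assms rho_mult by metis

text \<open>An element commuting with \<open>c\<close> permutes the two fixed points of
  \<open>c\<close>. It may interchange them, which is why the square is taken.\<close>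

lemma square_stabilizes:
  assumes c: "c \<in> St" and a: "a \<in> carrier G" "a \<otimes> c = c \<otimes> a"
    and p: "F c p = p" "\<forall>q. F c q = q \<longrightarrow> q = p"
  shows "a [^] (2::nat) \<in> St" "F (a [^] (2::nat)) p = p"
proof -
  let ?p = "Q *v inv_stereo p"
  have fp: "\<rho> c ?p = ?p" using rho_F[OF c, of p] p(1) by simp
  have fy: "\<rho> c y0 = y0" using c by (simp add: St_def)
  have two: "\<rho> a v = y0 \<or> \<rho> a v = ?p" if "v = y0 \<or> v = ?p" for v
  proof -
    have v: "v \<in> S" "\<rho> c v = v" using that y0_sphere Q_sphere fp fy by auto
    show ?thesis
      using fixed_by_rho[OF c rho_sphere[OF a(1) v(1)] commuting_fixed[OF a(1) St_carrier[OF c] a(2) v]] p(2) by blast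
  qed
  have ne: "\<rho> a y0 \<noteq> \<rho> a ?p"
    using rho_inject[OF a(1) y0_sphere Q_sphere] by (simp add: y0_def Q_inject inv_stereo_neq_north[symmetric])
  have sq: "\<rho> (a [^] (2::nat)) v = \<rho> a (\<rho> a v)" if "v \<in> S" for v
    using a(1) that by (simp add: numeral_2_eq_2 rho_mult del: mem_sphere mem_sphere_0)
  have "\<rho> a (\<rho> a y0) = y0" "\<rho> a (\<rho> a ?p) = ?p" using two[of y0] two[of ?p] ne by metis+
  then have "\<rho> (a [^] (2::nat)) y0 = y0" and q: "\<rho> (a [^] (2::nat)) ?p = ?p"
    using sq y0_sphere Q_sphere by metis+
  then show St: "a [^] (2::nat) \<in> St" using a(1) by (simp add: St_def)
  show "F (a [^] (2::nat)) p = p" by (rule F_eqI) (use rho_F[OF St, of p] q in simp)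
qed

lemma loxodromic_case:
  assumes c: "c \<in> St" "dilates c l" "l \<noteq> 1" and a: "a \<in> carrier G" "a \<otimes> c = c \<otimes> a"
    and b: "b \<in> carrier G" "b \<otimes> c = c \<otimes> b"
  shows "\<exists>m\<ge>1. commutator G (a [^] (2::nat)) (b [^] (2::nat)) [^] (m::nat) = \<one>"
proof -
  obtain p where p: "F c p = p" "\<forall>q. F c q = q \<longrightarrow> q = p" by (rule dilation_fixed_point[OF c])
  note A = square_stabilizes[OF c(1) a p] and B = square_stabilizes[OF c(1) b p]
  let ?a = "a [^] (2::nat)" and ?b = "b [^] (2::nat)"
  have i: "F (inv ?a) p = p" "F (inv ?b) p = p" using F_inv(1)[OF A(1), of p] F_inv(1)[OF B(1), of p] A B by auto
  have "F (commutator G ?a ?b) p = p"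
    unfolding commutator_def using A B i by (simp add: F_mult St_mult St_inv)
  then show ?thesis
    by (rule isometry_fixed_point_finite_order[OF St_commutator[OF A(1) B(1)] dilates_commutator[OF A(1) B(1)]])
qed

text \<open>The rotation bound \<beta> and the translation bound \<tau> are kept apart: powers make
  rotations close to the identity, while translations may start large.\<close>

definition near :: "'a \<Rightarrow> real \<Rightarrow> real \<Rightarrow> bool" where
  "near x \<beta> \<tau> \<longleftrightarrow> x \<in> St \<and> (\<exists>A t. orthogonal_transformation A \<and> (\<forall>y. F x y = A y + t) \<and>
     (\<forall>y. norm (A y - y) \<le> \<beta> * norm y) \<and> norm t \<le> \<tau>)"

lemma near_mono: "near x \<beta> \<tau> \<Longrightarrow> \<tau> \<le> \<tau>' \<Longrightarrow> near x \<beta> \<tau>'"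
  unfolding near_def by (meson order_trans)

text \<open>
  The contraction at the heart of Bieberbach's theorem: writing \<open>u = z x 0\<close>, the commutator moves \<open>u\<close> to
  \<open>x z 0\<close>, at distance at most \<open>\<beta> \<sigma> + \<tau> / 4\<close>.
\<close>

lemma near_commutator:
  assumes x: "near x (1/4) \<sigma>" and z: "near z \<beta> \<tau>" and \<beta>: "0 \<le> \<beta>" "\<beta> \<le> 1/4"
  shows "near (commutator G x z) (\<beta> / 2) (3/8 * \<tau> + 3/2 * \<beta> * \<sigma>)"
proof -
  obtain A s where A: "x \<in> St" "orthogonal_transformation A" "\<forall>y. F x y = A y + s"
    "\<forall>y. norm (A y - y) \<le> 1/4 * norm y" "norm s \<le> \<sigma>" using x unfolding near_def by blast
  obtain B t where B: "z \<in> St" "orthogonal_transformation B" "\<forall>y. F z y = B y + t"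
    "\<forall>y. norm (B y - y) \<le> \<beta> * norm y" "norm t \<le> \<tau>" using z unfolding near_def by blast
  note St = St_commutator[OF A(1) B(1)]
  obtain W w where W: "orthogonal_transformation W" "\<forall>y. F (commutator G x z) y = W y + w"
    by (rule F_isometry[OF St dilates_commutator[OF A(1) B(1)]])
  have rel: "F (commutator G x z) (F z (F x y)) = F x (F z y)" for y
  proof -
    have "commutator G x z \<otimes> (z \<otimes> x) = x \<otimes> z"
      by (rule commutator_mult[OF St_carrier[OF A(1)] St_carrier[OF B(1)]])
    then have "F (commutator G x z \<otimes> (z \<otimes> x)) y = F (x \<otimes> z) y" by simp
    then show ?thesis using A(1) B(1) St by (simp add: F_mult St_mult)
  qed
  have lin: "linear A" "linear B" "linear W"
    using A(2) B(2) W(1) by (simp_all add: orthogonal_transformation_linear)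
  have rel0: "W (B s + t) + w = A t + s"
    using rel[of 0] A(3) B(3) W(2) A(2) B(2) by (simp add: orthogonal_transformation_zero)
  have rot: "W (B (A y)) = A (B y)" for y
  proof -
    have "W (B (A y)) + (W (B s + t) + w) = A (B y) + (A t + s)"
      using rel[of y] A(3) B(3) W(2) by (simp add: linear_add[OF lin(1)] linear_add[OF lin(2)] linear_add[OF lin(3)] add_ac)
    then show ?thesis using rel0 by simp
  qed
  have "norm (W v - v) \<le> \<beta> / 2 * norm v" for v
  proof -
    obtain y where y: "v = B (A y)"
      using orthogonal_transformation_surj[OF A(2)] orthogonal_transformation_surj[OF B(2)] by (metis surjD)
    have nv: "norm v = norm y" using A(2) B(2) by (simp add: y orthogonal_transformation_norm)
    \<comment> \<open>The commutator of the operators measuring how far \<open>A\<close> and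
      \<open>B\<close> are from the identity; each of its terms is a product of two small
      factors.\<close>
    have "W v - v = (A (B y - y) - (B y - y)) - (B (A y - y) - (A y - y))"
      unfolding y rot using lin by (simp add: linear_diff algebra_simps)
    also have "norm \<dots> \<le> 1/4 * norm (B y - y) + \<beta> * norm (A y - y)"
      using A(4) B(4) norm_triangle_ineq4[of "A (B y - y) - (B y - y)" "B (A y - y) - (A y - y)"]
      by (smt (verit))
    also have "\<dots> \<le> 1/4 * (\<beta> * norm y) + \<beta> * (1/4 * norm y)"
      using A(4) B(4) \<beta>(1) by (intro add_mono mult_left_mono) auto
    finally show ?thesis unfolding nv by simp
  qed
  moreover have "norm w \<le> 3/8 * \<tau> + 3/2 * \<beta> * \<sigma>"
  proof -
    define u where "u = B s + t"
    have nu: "norm u \<le> \<sigma> + \<tau>"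
      using norm_triangle_ineq[of "B s" t] A(5) B(5) B(2) by (simp add: u_def orthogonal_transformation_norm)
    have \<sigma>: "0 \<le> \<sigma>" "0 \<le> \<tau>" using A(5) B(5) norm_ge_zero order_trans by blast+
    \<comment> \<open>In this form every translation is paired with a rotation close to the
      identity, so no term of the size of \<open>s\<close> or \<open>t\<close> survives.\<close>
    have "w = (A t - t) - (B s - s) - (W u - u)" using rel0 by (simp add: u_def algebra_simps)
    then have "norm w \<le> norm (A t - t) + norm (B s - s) + norm (W u - u)"
      using norm_triangle_ineq4[of "(A t - t) - (B s - s)" "W u - u"] norm_triangle_ineq4[of "A t - t" "B s - s"] by simp
    also have "\<dots> \<le> 1/4 * \<tau> + \<beta> * \<sigma> + \<beta> / 2 * (\<sigma> + \<tau>)"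
    proof (intro add_mono)
      show "norm (A t - t) \<le> 1/4 * \<tau>" using A(4)[rule_format, of t] B(5) by simp
      show "norm (B s - s) \<le> \<beta> * \<sigma>"
        using B(4)[rule_format, of s] mult_left_mono[OF A(5) \<beta>(1)] by linarith
      show "norm (W u - u) \<le> \<beta> / 2 * (\<sigma> + \<tau>)"
        using calculation(1) mult_left_mono[OF nu, of "\<beta> / 2"] \<beta>(1) \<open>norm (W u - u) \<le> \<beta> / 2 * norm u\<close> by linarith
    qed
    \<comment> \<open>Since \<open>\<beta> \<le> 1/4\<close>, the last term is at most an eighth of
      \<tau>. The resulting factor 3/8 stays below 1/2 and leaves room for the term with
      \<sigma>.\<close>
    also have "\<dots> = 1/4 * \<tau> + 3/2 * \<beta> * \<sigma> + 1/2 * (\<beta> * \<tau>)" by (simp add: field_simps)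
    also have "\<dots> \<le> 1/4 * \<tau> + 3/2 * \<beta> * \<sigma> + 1/2 * (1/4 * \<tau>)"
      using \<beta> \<sigma> by (intro add_left_mono mult_left_mono mult_right_mono) auto
    also have "\<dots> = 3/8 * \<tau> + 3/2 * \<beta> * \<sigma>" by simp
    finally show ?thesis .
  qed
  ultimately show ?thesis unfolding near_def using St W by blast
qed

text \<open>Both bounds halve at each step. The summand \<open>3 * \<sigma>\<close> absorbs the
  inhomogeneous term: 3 is the least \<open>K\<close> with
  \<open>3/8 * K + 3/8 \<le> K / 2\<close>.\<close>

lemma near_iterated_commutator:
  assumes x: "near x (1/4) \<sigma>" and z: "near z (1/4) \<tau>"
  shows "near (iterated_commutator G x z k) (1/4 / 2 ^ k) ((\<tau> + 3 * \<sigma>) / 2 ^ k)"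
proof (induction k)
  case 0
  have "0 \<le> \<sigma>" using x unfolding near_def by (meson norm_ge_zero order_trans)
  then show ?case using near_mono[OF z, of "\<tau> + 3 * \<sigma>"] by simp
next
  case (Suc k)
  have \<tau>: "0 \<le> \<tau>" using z unfolding near_def by (meson norm_ge_zero order_trans)
  have "near (commutator G x (iterated_commutator G x z k)) (1/4 / 2 ^ k / 2)
     (3/8 * ((\<tau> + 3 * \<sigma>) / 2 ^ k) + 3/2 * (1/4 / 2 ^ k) * \<sigma>)"
    by (rule near_commutator[OF x Suc]) (auto simp: divide_simps)
  then have "near (commutator G x (iterated_commutator G x z k)) (1/4 / 2 ^ k / 2) ((\<tau> + 3 * \<sigma>) / 2 ^ k / 2)"
    by (rule near_mono) (use \<tau> in \<open>simp add: field_simps\<close>)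
  then show ?case by (simp add: mult.commute)
qed

lemma near_one:
  obtains \<delta> where "0 < \<delta>" "\<And>x. near x \<delta> \<delta> \<Longrightarrow> x = \<one>"
proof -
  obtain \<epsilon> where e: "0 < \<epsilon>"
    "\<forall>x\<in>carrier G. \<forall>y\<in>carrier G. (\<forall>v\<in>S. dist (\<rho> x v) (\<rho> y v) < \<epsilon>) \<longrightarrow> x = y"
    by (rule separated)
  show thesis
  \<comment> \<open>With \<open>R = 1\<close>, \<open>similarity_close\<close> gives the bound
    \<open>6 * \<epsilon> / 7\<close>, which is below \<epsilon>.\<close>
  proof (rule that[of "\<epsilon> / 7"])
    show "0 < \<epsilon> / 7" using e by simp
    fix x assume "near x (\<epsilon> / 7) (\<epsilon> / 7)"
    then obtain A t where A: "x \<in> St" "orthogonal_transformation A" "\<forall>y. F x y = A y + t"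
      "\<forall>y. norm (A y - y) \<le> \<epsilon> / 7 * norm y" "norm t \<le> \<epsilon> / 7" unfolding near_def by blast
    have "dist (\<rho> x v) (\<rho> \<one> v) < \<epsilon>" if v: "v \<in> S" for v
      using v
    proof (cases rule: sphere_cases_Q)
      case 1
      then show ?thesis using A(1) e(1) rho_one[OF y0_sphere] by (simp add: St_def)
    next
      case (2 y)
      have "dist (inv_stereo y) (inv_stereo (F x y)) \<le> 2 * (\<epsilon> / 7) * (1\<^sup>2 + 1 + 1)"
      proof (rule similarity_close[where f="\<lambda>y. y" and f'="F x" and y=y and d="\<epsilon> / 7" and R=1 and l=1 and A="\<lambda>y. y" and t=0])
        have "norm (F x y - y) \<le> norm (A y - y) + norm t"
          using norm_triangle_ineq[of "A y - y" t] A(3) by (simp add: algebra_simps)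
        then show "norm (y - F x y) \<le> \<epsilon> / 7 * (norm y + 1)"
          using A(4)[rule_format, of y] A(5) by (simp add: norm_minus_commute algebra_simps)
      qed (use e in \<open>auto simp: orthogonal_transformation_id[unfolded id_def]\<close>)
      also have "\<dots> < \<epsilon>" using e(1) by simp
      finally have "dist (inv_stereo (F x y)) (inv_stereo y) < \<epsilon>" by (simp add: dist_commute)
      moreover have "\<rho> x v = Q *v inv_stereo (F x y)" "\<rho> \<one> v = Q *v inv_stereo y"
        using 2 rho_F[OF A(1)] rho_one[OF v] by auto
      moreover have "dist (Q *v p) (Q *v q) = dist p q" for p q
        using rotation_matrix_norm[OF Q, of "p - q"] by (simp add: dist_norm matrix_vector_mult_diff_distrib)
      ultimately show ?thesis by simp
    qed
    then show "x = \<one>" using e(2) St_carrier[OF A(1)] by blast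
  qed
qed

text \<open>Compactness is applied to the pairs of rotation parts of the powers of \<open>a\<close>
  and \<open>b\<close>, so that one exponent \<open>N = j - i\<close> serves both elements.\<close>

lemma near_powers:
  assumes a: "a \<in> St" "dilates a 1" and b: "b \<in> St" "dilates b 1"
  obtains N \<sigma> \<tau> where "1 \<le> (N::nat)" "near (a [^] N) (1/4) \<sigma>" "near (b [^] N) (1/4) \<tau>"
proof -
  have ex: "\<exists>w. orthogonal_transformation (fst w) \<and> (\<forall>y. F (x [^] k) y = fst w y + snd w)"
    if "x \<in> St" "dilates x 1" for x and k :: nat
    by (rule F_isometry[OF St_pow[OF that(1)] dilates_pow[OF that], of k]) (metis fst_conv snd_conv)
  define W where "W x k = (SOME w. orthogonal_transformation (fst w) \<and> (\<forall>y. F (x [^] k) y = fst w y + snd w))" for x and k :: nat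
  have W: "orthogonal_transformation (fst (W x k)) \<and> (\<forall>y. F (x [^] k) y = fst (W x k) y + snd (W x k))"
    if "x \<in> St" "dilates x 1" for x k
    unfolding W_def by (rule someI_ex[OF ex[OF that]])
  \<comment> \<open>The scalar 1 matches the form of
    \<open>scaled_orthogonal_blinfun\<close>.\<close>
  define Z where "Z k = (Blinfun (\<lambda>y. 1 *\<^sub>R fst (W a k) y), Blinfun (\<lambda>y. 1 *\<^sub>R fst (W b k) y))" for k
  have bl: "blinfun_apply (Blinfun (\<lambda>y. 1 *\<^sub>R fst (W x k) y)) y = fst (W x k) y"
    "norm (Blinfun (\<lambda>y. 1 *\<^sub>R fst (W x k) y)) \<le> 1" if "x \<in> St" "dilates x 1" for x k y
    using scaled_orthogonal_blinfun[OF conjunct1[OF W[OF that]], of 1 k] by simp_all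
  have quarter: "0 < (1/4 :: real)" by simp
  have "bounded (range Z)"
  proof (rule boundedI)
    fix z assume "z \<in> range Z"
    then obtain k where "z = Z k" by blast
    then show "norm z \<le> 1 + 1"
      unfolding Z_def by (simp only:) (intro order_trans[OF norm_Pair_le] add_mono bl(2) a b)
  qed
  then obtain i j where ij: "i < j" "dist (Z i) (Z j) < 1/4" by (rule bounded_sequence_close[OF _ quarter])
  have close: "near (x [^] (j - i)) (1/4) (norm (snd (W x (j - i))))"
    if x: "x \<in> St" "dilates x 1"
      and d: "dist (Blinfun (\<lambda>y. 1 *\<^sub>R fst (W x i) y)) (Blinfun (\<lambda>y. 1 *\<^sub>R fst (W x j) y)) < 1/4" for x
  proof -
    let ?A = "\<lambda>k. fst (W x k)" and ?t = "\<lambda>k. snd (W x k)" and ?N = "j - i"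
    note Wx = W[OF x]
    have "x [^] j = x [^] i \<otimes> x [^] ?N" using ij(1) St_carrier[OF x(1)] by (simp add: nat_pow_mult)
    then have e: "F (x [^] j) y = F (x [^] i) (F (x [^] ?N) y)" for y
      using F_mult[OF St_pow[OF x(1)] St_pow[OF x(1)]] by simp
    have lin: "linear (?A k)" for k using Wx orthogonal_transformation_linear by blast
    \<comment> \<open>Rotation parts multiply. As \<open>?A i\<close> preserves norms, closeness of
      the rotations for \<open>i\<close> and \<open>j\<close> means that the rotation for their
      difference is close to the identity.\<close>
    have "?A j y = ?A i (?A ?N y)" for y
    proof -
      have "?A j y + ?t j = ?A i (?A ?N y) + ?A i (?t ?N) + ?t i"
        using e[of y] Wx lin by (simp add: linear_add)
      moreover have "?t j = ?A i (?t ?N) + ?t i"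
        using e[of 0] Wx lin by (simp add: linear_add linear_0)
      ultimately show ?thesis by simp
    qed
    moreover have "norm (?A i y - ?A j y) \<le> 1/4 * norm y" for y
    proof -
      have "norm (?A i y - ?A j y) = norm (blinfun_apply (Blinfun (\<lambda>y. 1 *\<^sub>R ?A i y) - Blinfun (\<lambda>y. 1 *\<^sub>R ?A j y)) y)"
        by (simp only: blinfun.diff_left bl(1)[OF x])
      also have "\<dots> \<le> norm (Blinfun (\<lambda>y. 1 *\<^sub>R ?A i y) - Blinfun (\<lambda>y. 1 *\<^sub>R ?A j y)) * norm y" by (rule norm_blinfun)
      also have "\<dots> \<le> 1/4 * norm y" using d by (intro mult_right_mono) (auto simp: dist_norm)
      finally show ?thesis .
    qed
    moreover have "norm (?A ?N y - y) = norm (?A i (?A ?N y) - ?A i y)" for y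
      using Wx by (metis orthogonal_transformation_diff orthogonal_transformation_norm)
    ultimately have "norm (?A ?N y - y) \<le> 1/4 * norm y" for y by (metis norm_minus_commute)
    then show ?thesis unfolding near_def using Wx St_pow[OF x(1)] by blast
  qed
  have "near (a [^] (j - i)) (1/4) (norm (snd (W a (j - i))))"
    by (rule close[OF a]) (use ij(2) dist_fst_le[of "Z i" "Z j"] in \<open>simp add: Z_def\<close>)
  moreover have "near (b [^] (j - i)) (1/4) (norm (snd (W b (j - i))))"
    by (rule close[OF b]) (use ij(2) dist_snd_le[of "Z i" "Z j"] in \<open>simp add: Z_def\<close>)
  ultimately show thesis using that[of "j - i"] ij(1) by simp
qed

lemma isometry_case:
  assumes a: "a \<in> St" "dilates a 1" and b: "b \<in> St" "dilates b 1"
  shows "\<exists>N\<ge>1. \<exists>k. iterated_commutator G (a [^] (N::nat)) (b [^] N) k = \<one>"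
proof -
  obtain N \<sigma> \<tau> where N: "1 \<le> (N::nat)" "near (a [^] N) (1/4) \<sigma>" "near (b [^] N) (1/4) \<tau>"
    by (rule near_powers[OF a b])
  obtain \<delta> where \<delta>: "0 < \<delta>" "\<And>x. near x \<delta> \<delta> \<Longrightarrow> x = \<one>" using near_one by blast
  have "(\<lambda>k. (1/4 + \<bar>\<tau> + 3 * \<sigma>\<bar>) / 2 ^ k) \<longlonglongrightarrow> 0"
    using LIMSEQ_divide_realpow_zero[of 2 "1/4 + \<bar>\<tau> + 3 * \<sigma>\<bar>"] by simp
  then have "eventually (\<lambda>k. (1/4 + \<bar>\<tau> + 3 * \<sigma>\<bar>) / 2 ^ k < \<delta>) sequentially"
    using \<delta>(1) by (rule order_tendstoD(2))
  then obtain k where k: "(1/4 + \<bar>\<tau> + 3 * \<sigma>\<bar>) / 2 ^ k < \<delta>" by (auto simp: eventually_sequentially)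
  have "1/4 / 2 ^ k \<le> (1/4 + \<bar>\<tau> + 3 * \<sigma>\<bar>) / 2 ^ k" "(\<tau> + 3 * \<sigma>) / 2 ^ k \<le> (1/4 + \<bar>\<tau> + 3 * \<sigma>\<bar>) / 2 ^ k"
    by (intro divide_right_mono; simp)+
  then have s: "1/4 / 2 ^ k \<le> \<delta>" "(\<tau> + 3 * \<sigma>) / 2 ^ k \<le> \<delta>" using k by linarith+
  have "near (iterated_commutator G (a [^] N) (b [^] N) k) \<delta> \<delta>"
  proof -
    obtain A t where *: "iterated_commutator G (a [^] N) (b [^] N) k \<in> St" "orthogonal_transformation A"
      "\<forall>y. F (iterated_commutator G (a [^] N) (b [^] N) k) y = A y + t"
      "\<forall>y. norm (A y - y) \<le> 1/4 / 2 ^ k * norm y" "norm t \<le> (\<tau> + 3 * \<sigma>) / 2 ^ k"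
      using near_iterated_commutator[OF N(2,3), of k] unfolding near_def by blast
    have "norm (A y - y) \<le> \<delta> * norm y" for y
      using *(4)[rule_format, of y] mult_right_mono[OF s(1) norm_ge_zero[of y]] by linarith
    moreover have "norm t \<le> \<delta>" using *(5) s(2) by linarith
    ultimately show ?thesis unfolding near_def using *(1-3) by blast
  qed
  then show ?thesis using \<delta>(2) N(1) by blast
qed

lemma centralizer_contradiction:
  assumes c: "c \<in> St" and a: "a \<in> carrier G" "a \<otimes> c = c \<otimes> a" and b: "b \<in> carrier G" "b \<otimes> c = c \<otimes> b"
    and ord: "\<And>m. 1 \<le> m \<Longrightarrow> c [^] (m::nat) \<noteq> \<one>"
    and com: "\<And>m. 1 \<le> m \<Longrightarrow> commutator G (a [^] (2::nat)) (b [^] (2::nat)) [^] (m::nat) \<noteq> \<one>"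
    and iter: "\<And>N k. 1 \<le> N \<Longrightarrow> iterated_commutator G (a [^] (N::nat)) (b [^] N) k \<noteq> \<one>"
  shows False
proof -
  obtain l where l: "dilates c l" using dilates_exists[OF c] by blast
  show False
  proof (cases "l = 1")
    case False
    then show False using loxodromic_case[OF c l False a b] com by blast
  next
    case True
    then have c1: "dilates c 1" using l by simp
    \<comment> \<open>A fixed point would force finite order, so infinity is the only fixed point of
      \<open>c\<close>, and everything commuting with \<open>c\<close> fixes it.\<close>
    have nofix: "F c p \<noteq> p" for p
      using isometry_fixed_point_finite_order[OF c c1, of p] ord by blast
    have stab: "x \<in> St \<and> dilates x 1" if x: "x \<in> carrier G" "x \<otimes> c = c \<otimes> x" for x
    proof -
      have "\<rho> c y0 = y0" using c by (simp add: St_def)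
      then have "\<rho> c (\<rho> x y0) = \<rho> x y0" by (rule commuting_fixed[OF x(1) St_carrier[OF c] x(2) y0_sphere])
      then have "\<rho> x y0 = y0" using fixed_by_rho[OF c rho_sphere[OF x(1) y0_sphere]] nofix by blast
      then have xs: "x \<in> St" using x(1) by (simp add: St_def)
      obtain m where m: "dilates x m" using dilates_exists[OF xs] by blast
      have "m = 1"
      proof (rule ccontr)
        assume "m \<noteq> 1"
        \<comment> \<open>The unique finite fixed point of a proper similarity commuting with
          \<open>c\<close> would be fixed by \<open>c\<close> as well.\<close>
        then obtain q where q: "F x q = q" "\<forall>q'. F x q' = q' \<longrightarrow> q' = q"
          by (rule dilation_fixed_point[OF xs m])
        have "F x (F c q) = F c (F x q)" using F_mult[OF xs c, of q] F_mult[OF c xs, of q] x(2) by simp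
        then have "F c q = q" using q by metis
        then show False using nofix by blast
      qed
      then show ?thesis using xs m by simp
    qed
    show False
      using isometry_case[of a b] stab[OF a] stab[OF b] iter by blast
  qed
qed

end

context discrete_rep
begin

theorem no_centralized_pair:
  assumes c: "c \<in> carrier G" and a: "a \<in> carrier G" "a \<otimes> c = c \<otimes> a" and b: "b \<in> carrier G" "b \<otimes> c = c \<otimes> b"
    and ord: "\<And>m. 1 \<le> m \<Longrightarrow> c [^] (m::nat) \<noteq> \<one>"
    and com: "\<And>m. 1 \<le> m \<Longrightarrow> commutator G (a [^] (2::nat)) (b [^] (2::nat)) [^] (m::nat) \<noteq> \<one>"
    and iter: "\<And>N k. 1 \<le> N \<Longrightarrow> iterated_commutator G (a [^] (N::nat)) (b [^] N) k \<noteq> \<one>"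
  shows False
proof -
  obtain y where y: "y \<in> S" "\<rho> c y = y" using fixed_point_exists[OF c ord] by blast
  obtain Q where rot: "rotation_matrix Q" "Q *v north = y" by (rule rotation_to[OF north_sphere y(1)])
  interpret point_stabilizer G \<rho> Q by unfold_locales (rule rot(1))
  have "c \<in> St" using c y(2) rot(2) by (simp add: St_def y0_def)
  then show False by (rule centralizer_contradiction[OF _ a b ord com iter])
qed

end

theorem theorem1p2:
  fixes g h :: nat
    and S1 :: "'a::topological_space set" and A1 :: "('a, 2) chart set"
    and S2 :: "'b::topological_space set" and A2 :: "('b, 2) chart set"
    and C :: "'c::topological_space set" and p :: "'c \<Rightarrow> 'a \<times> 'b"
  assumes "g \<ge> 2" and "h \<ge> 1"
    and "closed_oriented_surface g S1 A1"
    and "closed_oriented_surface h S2 A2"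
    and "universal_cover C p (S1 \<times> S2)"
  shows "\<not> (\<exists>G. riemannian_metric (prod_atlas A1 A2) G \<and>
               locally_conformally_flat (S1 \<times> S2) (prod_atlas A1 A2) G \<and>
               (\<exists>D \<rho>. developing_map C p (S1 \<times> S2) (prod_atlas A1 A2) G D \<and>
                  holonomy_representation C p D \<rho> \<and>
                  inj_on \<rho> (carrier (deck_group C p)) \<and>
                  discrete_transformations (\<rho> ` carrier (deck_group C p))))"
proof (rule notI, elim exE conjE)
  fix D :: "'c \<Rightarrow> real ^ ((2 + 2) + 1)" and \<rho>
  assume hol: "holonomy_representation C p D \<rho>" and inj: "inj_on \<rho> (carrier (deck_group C p))"
    and disc: "discrete_transformations (\<rho> ` carrier (deck_group C p))"
  let ?G = "deck_group C p"
  interpret G: group ?G by (rule group_deck_group)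
  \<comment> \<open>The index type \<open>2 + 2\<close> has four elements, which settles the
    dimension bound of Liouville's theorem.\<close>
  interpret discrete_rep ?G \<rho>
    by unfold_locales (use hol inj disc in \<open>auto simp: holonomy_representation_def\<close>)
  obtain a b c \<theta> \<phi> \<kappa> where abc: "a \<in> carrier ?G" "b \<in> carrier ?G" "c \<in> carrier ?G"
    and comm: "a \<otimes>\<^bsub>?G\<^esub> c = c \<otimes>\<^bsub>?G\<^esub> a" "b \<otimes>\<^bsub>?G\<^esub> c = c \<otimes>\<^bsub>?G\<^esub> b"
    and \<theta>0: "\<theta> \<one>\<^bsub>?G\<^esub> = (0 :: real)"
    and A: "\<forall>S\<in>carrier ?G. \<theta> (S \<otimes>\<^bsub>?G\<^esub> a) = \<theta> S + 1 \<and> \<phi> (S \<otimes>\<^bsub>?G\<^esub> a) = (\<phi> S :: real)"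
    and B: "\<forall>S\<in>carrier ?G. \<theta> (S \<otimes>\<^bsub>?G\<^esub> b) = \<theta> S \<and> \<phi> (S \<otimes>\<^bsub>?G\<^esub> b) = \<phi> S + weight (\<theta> S)"
    and K: "\<forall>S\<in>carrier ?G. \<kappa> (S \<otimes>\<^bsub>?G\<^esub> c) = (\<kappa> S + 1 :: real)"
    by (rule surface_product_deck_group[OF assms])
  interpret weighted_counting ?G a b \<theta> \<phi>
    by unfold_locales (use abc \<theta>0 A B in auto)
  show False
    by (rule no_centralized_pair[OF abc(3,1) comm(1) abc(2) comm(2)])
       (use G.counter_infinite_order[OF abc(3), of \<kappa>] K commutator_infinite_order iterated_commutator_nontrivial in auto)
qed

end
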